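(* Let $(M_i)_{i\ge 1}$ be a sequence of arithmetic hyperbolic $2$- or $3$-orbifolds. If $\mathrm{Syst}_1(M_i)\to 0$, then the arithmetic orbifolds $M_i$ are non-commensurable and are defined over fields of degree going to $\infty$; that is, if $k_i$ denotes the field of definition of $M_i$, then $[k_i:\mathbb{Q}]\to\infty$ as $i\to\infty$.
   Context: A hyperbolic $2$-orbifold (resp. $3$-orbifold) here is a quotient $M=\Gamma\backslash\mathbb{H}^n$ with $n=2$ (resp. $n=3$), where $\Gamma$ is a discrete subgroup of finite covolume in $\mathrm{PSL}(2,\mathbb{R})$ (resp. $\mathrm{PSL}(2,\mathbb{C})$); $\Gamma$ may have torsion and $M$ need not be compact. $M$ is called arithmetic if $\Gamma$ is an arithmetic group in the following standard sense. There are a number field $k$ and a quaternion algebra $A$ over $k$ such that: if $n=2$, $k$ is totally real and $A$ is unramified at exactly one real place of $k$; if $n=3$, $k$ has exactly one complex place and $A$ is ramified at all real places. For a maximal order $\mathcal{O}\subset A$ with group $\mathcal{O}^1$ of elements of reduced norm $1$, let $\Gamma_{\mathcal{O}^1}$ be the image of $\mathcal{O}^1$ in $\mathrm{PSL}(2,\mathbb{R})$ (resp. $\mathrm{PSL}(2,\mathbb{C})$) under the embedding of $A$ given by the unique real place at which $A$ is unramified (resp. the complex place). Then $\Gamma$ is arithmetic if some conjugate of $\Gamma$ in $\mathrm{PSL}(2,\mathbb{R})$ (resp. $\mathrm{PSL}(2,\mathbb{C})$) is commensurable with such a $\Gamma_{\mathcal{O}^1}$, i.e. their intersection has finite index in both.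 The field $k$ is called the field of definition of $M$; it is determined by $M$ up to isomorphism. Two hyperbolic orbifolds of the same dimension are commensurable if they have isometric finite-sheeted orbifold covers. An element $\gamma$ of $\mathrm{PSL}(2,\mathbb{R})$ or $\mathrm{PSL}(2,\mathbb{C})$ is called hyperbolic if $\mathrm{tr}(\gamma)=u+u^{-1}$ (up to sign) with $|u|>1$; its displacement (translation length along its axis) is $\ell_0(\gamma)=2\log|u|$. The systole $\mathrm{Syst}_1(M)$ is the length of a shortest closed geodesic of $M$, that is, the smallest displacement of a hyperbolic element of $\Gamma$. *)

theory Defs
  imports "HOL-Analysis.Analysis" "HOL-Algebra.Coset"
begin

section \<open>The groups \<open>SL(2)\<close> and \<open>PSL(2)\<close>\<close>

definition SL2 :: "('f::field^2^2) monoid" where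
  "SL2 = \<lparr>carrier = {A. det A = 1}, mult = (**), one = mat 1\<rparr>"

definition PSL2 :: "('f::field^2^2) set monoid" where
  "PSL2 = SL2 Mod {mat 1, - mat 1}"

definition psl_proj :: "'f::field^2^2 \<Rightarrow> ('f^2^2) set" where
  "psl_proj A = {mat 1, - mat 1} #>\<^bsub>SL2\<^esub> A"

definition conj_subgroup :: "('g, 'm) monoid_scheme \<Rightarrow> 'g \<Rightarrow> 'g set \<Rightarrow> 'g set" where
  "conj_subgroup G g H = (\<lambda>h. g \<otimes>\<^bsub>G\<^esub> h \<otimes>\<^bsub>G\<^esub> inv\<^bsub>G\<^esub> g) ` H"

definition finite_index :: "('g, 'm) monoid_scheme \<Rightarrow> 'g set \<Rightarrow> 'g set \<Rightarrow> bool" where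
  "finite_index G H' H \<longleftrightarrow>
     subgroup H' (G\<lparr>carrier := H\<rparr>) \<and> finite (rcosets\<^bsub>G\<lparr>carrier := H\<rparr>\<^esub> H')"

definition commensurable_subgroups :: "('g, 'm) monoid_scheme \<Rightarrow> 'g set \<Rightarrow> 'g set \<Rightarrow> bool" where
  "commensurable_subgroups G H H' \<longleftrightarrow>
     finite_index G (H \<inter> H') H \<and> finite_index G (H \<inter> H') H'"

text \<open>A real \<open>\<gamma>\<close> whose trace is \<open>u + 1/u\<close> for a complex \<open>u\<close> with \<open>\<bar>u\<bar> > 1\<close> has \<open>u\<close> real,
  so over the reals it suffices to let \<open>u\<close> range over the reals. The sign ambiguity of the trace
  is accounted for by the two representatives \<open>A\<close> and \<open>-A\<close> of \<open>\<gamma>\<close>.\<close>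

definition hyperbolic_element :: "('f::real_normed_field^2^2) set \<Rightarrow> bool" where
  "hyperbolic_element \<gamma> \<longleftrightarrow> (\<exists>A\<in>\<gamma>. \<exists>u. trace A = u + inverse u \<and> norm u > 1)"

definition displacement :: "('f::real_normed_field^2^2) set \<Rightarrow> real" where
  "displacement \<gamma> =
     (THE l. \<exists>A\<in>\<gamma>. \<exists>u. trace A = u + inverse u \<and> norm u > 1 \<and> l = 2 * ln (norm u))"

section \<open>Hyperbolic space in the upper half-space model\<close>

definition H2 :: "complex set" where
  "H2 = {z. Im z > 0}"

definition dist_H2 :: "complex \<Rightarrow> complex \<Rightarrow> real" where
  "dist_H2 z w = arcosh (1 + (cmod (z - w))\<^sup>2 / (2 * Im z * Im w))"

definition vol_H2 :: "complex measure" where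
  "vol_H2 = density lborel (\<lambda>z. indicator H2 z * ennreal (1 / (Im z)\<^sup>2))"

definition moebius2 :: "real^2^2 \<Rightarrow> complex \<Rightarrow> complex" where
  "moebius2 A z = (of_real (A$1$1) * z + of_real (A$1$2)) / (of_real (A$2$1) * z + of_real (A$2$2))"

definition H3 :: "(complex \<times> real) set" where
  "H3 = {(z, t). t > 0}"

definition dist_H3 :: "complex \<times> real \<Rightarrow> complex \<times> real \<Rightarrow> real" where
  "dist_H3 p q =
     arcosh (1 + ((cmod (fst p - fst q))\<^sup>2 + (snd p - snd q)\<^sup>2) / (2 * snd p * snd q))"

definition vol_H3 :: "(complex \<times> real) measure" where
  "vol_H3 = density lborel (\<lambda>p. indicator H3 p * ennreal (1 / (snd p) ^ 3))"

text \<open>The Poincare extension: writing a point as the quaternion \<open>q = z + t j\<close>, this is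
  \<open>q \<mapsto> (a q + b) (c q + d)\<^sup>-\<^sup>1\<close>.\<close>

definition moebius3 :: "complex^2^2 \<Rightarrow> complex \<times> real \<Rightarrow> complex \<times> real" where
  "moebius3 A p =
    (let a = A$1$1; b = A$1$2; c = A$2$1; d = A$2$2; z = fst p; t = snd p;
         N = (cmod (c * z + d))\<^sup>2 + (cmod c)\<^sup>2 * t\<^sup>2
     in (((a * z + b) * cnj (c * z + d) + a * cnj c * of_real (t\<^sup>2)) / of_real N, t / N))"

text \<open>The actions of \<open>PSL(2)\<close>; the matrices \<open>A\<close> and \<open>-A\<close> act in the same way.\<close>

definition act2 :: "(real^2^2) set \<Rightarrow> complex \<Rightarrow> complex" where
  "act2 \<gamma> = moebius2 (SOME A. A \<in> \<gamma>)"

definition act3 :: "(complex^2^2) set \<Rightarrow> complex \<times> real \<Rightarrow> complex \<times> real" where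
  "act3 \<gamma> = moebius3 (SOME A. A \<in> \<gamma>)"

section \<open>Hyperbolic orbifolds\<close>

definition fundamental_domain ::
    "'p set \<Rightarrow> 'p measure \<Rightarrow> (('f::field^2^2) set \<Rightarrow> 'p \<Rightarrow> 'p) \<Rightarrow> ('f^2^2) set set \<Rightarrow> 'p set \<Rightarrow> bool"
  where
  "fundamental_domain X vol act \<Gamma> F \<longleftrightarrow>
     F \<subseteq> X \<and> F \<in> sets vol \<and> X = (\<Union>\<gamma>\<in>\<Gamma>. act \<gamma> ` F) \<and>
     (\<forall>\<gamma>\<in>\<Gamma>. \<gamma> \<noteq> \<one>\<^bsub>PSL2\<^esub> \<longrightarrow> act \<gamma> ` F \<inter> F \<in> null_sets vol)"

definition finite_covolume ::
    "'p set \<Rightarrow> 'p measure \<Rightarrow> (('f::field^2^2) set \<Rightarrow> 'p \<Rightarrow> 'p) \<Rightarrow> ('f^2^2) set set \<Rightarrow> bool"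
  where
  "finite_covolume X vol act \<Gamma> \<longleftrightarrow>
     (\<exists>F. fundamental_domain X vol act \<Gamma> F \<and> emeasure vol F < \<infinity>)"

text \<open>\<open>Orb2 \<Gamma>\<close> and \<open>Orb3 \<Gamma>\<close> stand for the quotients of the hyperbolic plane and of hyperbolic
  3-space by \<open>\<Gamma>\<close>. As the kernel of \<open>SL(2) \<rightarrow> PSL(2)\<close> is finite, \<open>\<Gamma>\<close> is discrete iff its preimage
  \<open>\<Union>\<Gamma>\<close> in \<open>SL(2)\<close> is.\<close>

datatype orbifold = Orb2 "(real^2^2) set set" | Orb3 "(complex^2^2) set set"

primrec hyperbolic_orbifold :: "orbifold \<Rightarrow> bool" where
  "hyperbolic_orbifold (Orb2 \<Gamma>) \<longleftrightarrow>
     subgroup \<Gamma> PSL2 \<and> discrete (\<Union>\<Gamma>) \<and> finite_covolume H2 vol_H2 act2 \<Gamma>"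
| "hyperbolic_orbifold (Orb3 \<Gamma>) \<longleftrightarrow>
     subgroup \<Gamma> PSL2 \<and> discrete (\<Union>\<Gamma>) \<and> finite_covolume H3 vol_H3 act3 \<Gamma>"

text \<open>The values are extended reals, so that the infimum of the empty set is \<open>\<infinity>\<close>.\<close>

primrec Syst1 :: "orbifold \<Rightarrow> ereal" where
  "Syst1 (Orb2 \<Gamma>) = (INF \<gamma>\<in>{\<gamma>\<in>\<Gamma>. hyperbolic_element \<gamma>}. ereal (displacement \<gamma>))"
| "Syst1 (Orb3 \<Gamma>) = (INF \<gamma>\<in>{\<gamma>\<in>\<Gamma>. hyperbolic_element \<gamma>}. ereal (displacement \<gamma>))"

text \<open>Isometries between the orbifolds \<open>X/\<Gamma>\<close> and \<open>X/\<Delta>\<close> are induced by the isometries \<open>f\<close> of \<open>X\<close>,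
  possibly orientation-reversing, that satisfy \<open>f \<Gamma> f\<^sup>-\<^sup>1 = \<Delta>\<close>, and the connected finite-sheeted
  orbifold covers of \<open>X/\<Gamma>\<close> are the quotients by the finite index subgroups of \<open>\<Gamma>\<close>.\<close>

definition isometric_quotients ::
    "'p set \<Rightarrow> ('p \<Rightarrow> 'p \<Rightarrow> real) \<Rightarrow> (('f::field^2^2) set \<Rightarrow> 'p \<Rightarrow> 'p)
       \<Rightarrow> ('f^2^2) set set \<Rightarrow> ('f^2^2) set set \<Rightarrow> bool" where
  "isometric_quotients X d act \<Gamma> \<Delta> \<longleftrightarrow>
     (\<exists>f. bij_betw f X X \<and> (\<forall>x\<in>X. \<forall>y\<in>X. d (f x) (f y) = d x y) \<and>
          (\<forall>\<gamma>\<in>\<Gamma>. \<exists>\<delta>\<in>\<Delta>. \<forall>x\<in>X. f (act \<gamma> x) = act \<delta> (f x)) \<and>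
          (\<forall>\<delta>\<in>\<Delta>. \<exists>\<gamma>\<in>\<Gamma>. \<forall>x\<in>X. f (act \<gamma> x) = act \<delta> (f x)))"

definition commensurable_quotients ::
    "'p set \<Rightarrow> ('p \<Rightarrow> 'p \<Rightarrow> real) \<Rightarrow> (('f::field^2^2) set \<Rightarrow> 'p \<Rightarrow> 'p)
       \<Rightarrow> ('f^2^2) set set \<Rightarrow> ('f^2^2) set set \<Rightarrow> bool" where
  "commensurable_quotients X d act \<Gamma> \<Delta> \<longleftrightarrow>
     (\<exists>\<Gamma>' \<Delta>'. finite_index PSL2 \<Gamma>' \<Gamma> \<and> finite_index PSL2 \<Delta>' \<Delta> \<and>
              isometric_quotients X d act \<Gamma>' \<Delta>')"

fun commensurable :: "orbifold \<Rightarrow> orbifold \<Rightarrow> bool" where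
  "commensurable (Orb2 \<Gamma>) (Orb2 \<Delta>) \<longleftrightarrow> commensurable_quotients H2 dist_H2 act2 \<Gamma> \<Delta>"
| "commensurable (Orb3 \<Gamma>) (Orb3 \<Delta>) \<longleftrightarrow> commensurable_quotients H3 dist_H3 act3 \<Gamma> \<Delta>"
| "commensurable _ _ \<longleftrightarrow> False"

section \<open>Number fields\<close>

text \<open>A number field is represented by a subfield of the complex numbers, but the inclusion plays
  no distinguished role: places are given by arbitrary embeddings.\<close>

interpretation rat_complex: vector_space "\<lambda>(q::rat) (z::complex). of_rat q * z"
  by unfold_locales (auto simp: algebra_simps of_rat_add of_rat_mult)

definition number_field :: "complex set \<Rightarrow> bool" where
  "number_field K \<longleftrightarrow>
     1 \<in> K \<and> (\<forall>x\<in>K. \<forall>y\<in>K. x - y \<in> K \<and> x * y \<in> K) \<and> (\<forall>x\<in>K. inverse x \<in> K) \<and>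
     (\<exists>B. finite B \<and> K = rat_complex.span B)"

definition degree_over_Q :: "complex set \<Rightarrow> nat" where
  "degree_over_Q K = rat_complex.dim K"

definition ring_of_integers :: "complex set \<Rightarrow> complex set" where
  "ring_of_integers K = {x\<in>K. algebraic_int x}"

definition embeddings :: "complex set \<Rightarrow> (complex \<Rightarrow> 'f::field) set" where
  "embeddings K = {\<sigma> \<in> extensional K. \<sigma> 1 = 1 \<and>
     (\<forall>x\<in>K. \<forall>y\<in>K. \<sigma> (x + y) = \<sigma> x + \<sigma> y \<and> \<sigma> (x * y) = \<sigma> x * \<sigma> y)}"

definition real_places :: "complex set \<Rightarrow> (complex \<Rightarrow> real) set" where
  "real_places K = embeddings K"

definition nonreal_embeddings :: "complex set \<Rightarrow> (complex \<Rightarrow> complex) set" where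
  "nonreal_embeddings K = {\<tau> \<in> embeddings K. \<not> \<tau> ` K \<subseteq> \<real>}"

definition complex_places :: "complex set \<Rightarrow> (complex \<Rightarrow> complex) set set" where
  "complex_places K = (\<lambda>\<tau>. {\<tau>, restrict (cnj \<circ> \<tau>) K}) ` nonreal_embeddings K"

definition totally_real :: "complex set \<Rightarrow> bool" where
  "totally_real K \<longleftrightarrow> nonreal_embeddings K = {}"

section \<open>Quaternion algebras\<close>

text \<open>The quaternion algebra with basis \<open>1, i, j, ij\<close> and relations \<open>i\<^sup>2 = a\<close>, \<open>j\<^sup>2 = b\<close>,
  \<open>ij = -ji\<close> (for nonzero \<open>a\<close>, \<open>b\<close>). The vector \<open>x\<close> stands for
  \<open>x$1 + x$2 i + x$3 j + x$4 ij\<close>; the componentwise product of vectors plays no role.\<close>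

definition quat :: "'f \<Rightarrow> 'f \<Rightarrow> 'f \<Rightarrow> 'f \<Rightarrow> 'f^4" where
  "quat x y z w = (\<chi> n. if n = 1 then x else if n = 2 then y else if n = 3 then z else w)"

definition qmult :: "'f::field \<Rightarrow> 'f \<Rightarrow> 'f^4 \<Rightarrow> 'f^4 \<Rightarrow> 'f^4" where
  "qmult a b x y = quat
     (x$1 * y$1 + a * x$2 * y$2 + b * x$3 * y$3 - a * b * x$4 * y$4)
     (x$1 * y$2 + x$2 * y$1 - b * x$3 * y$4 + b * x$4 * y$3)
     (x$1 * y$3 + x$3 * y$1 + a * x$2 * y$4 - a * x$4 * y$2)
     (x$1 * y$4 + x$4 * y$1 + x$2 * y$3 - x$3 * y$2)"

definition qone :: "'f::field^4" where
  "qone = quat 1 0 0 0"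

definition reduced_norm :: "'f::field \<Rightarrow> 'f \<Rightarrow> 'f^4 \<Rightarrow> 'f" where
  "reduced_norm a b x = (x$1)\<^sup>2 - a * (x$2)\<^sup>2 - b * (x$3)\<^sup>2 + a * b * (x$4)\<^sup>2"

definition qalg :: "complex set \<Rightarrow> (complex^4) set" where
  "qalg K = {x. \<forall>n. x$n \<in> K}"

text \<open>The completion of the algebra at a real place \<open>\<sigma>\<close> is the real quaternion algebra with
  parameters \<open>\<sigma> a\<close>, \<open>\<sigma> b\<close>.\<close>

definition ramified_at :: "complex \<Rightarrow> complex \<Rightarrow> (complex \<Rightarrow> real) \<Rightarrow> bool" where
  "ramified_at a b \<sigma> \<longleftrightarrow>
     (\<forall>x::real^4. x \<noteq> 0 \<longrightarrow>
        (\<exists>y. qmult (\<sigma> a) (\<sigma> b) x y = qone \<and> qmult (\<sigma> a) (\<sigma> b) y x = qone))"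

definition lin_span :: "'f::field set \<Rightarrow> ('f^4) set \<Rightarrow> ('f^4) set" where
  "lin_span R S = {\<Sum>v\<in>T. c v *s v | T c. finite T \<and> T \<subseteq> S \<and> c ` T \<subseteq> R}"

definition is_order :: "complex set \<Rightarrow> complex \<Rightarrow> complex \<Rightarrow> (complex^4) set \<Rightarrow> bool" where
  "is_order K a b \<O> \<longleftrightarrow>
     qone \<in> \<O> \<and> (\<forall>x\<in>\<O>. \<forall>y\<in>\<O>. qmult a b x y \<in> \<O>) \<and>
     (\<exists>S. finite S \<and> S \<subseteq> qalg K \<and> \<O> = lin_span (ring_of_integers K) S) \<and>
     lin_span K \<O> = qalg K"

definition maximal_order :: "complex set \<Rightarrow> complex \<Rightarrow> complex \<Rightarrow> (complex^4) set \<Rightarrow> bool" where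
  "maximal_order K a b \<O> \<longleftrightarrow>
     is_order K a b \<O> \<and> (\<forall>\<O>'. is_order K a b \<O>' \<and> \<O> \<subseteq> \<O>' \<longrightarrow> \<O>' = \<O>)"

definition norm_one :: "complex \<Rightarrow> complex \<Rightarrow> (complex^4) set \<Rightarrow> (complex^4) set" where
  "norm_one a b \<O> = {x\<in>\<O>. reduced_norm a b x = 1}"

definition matrix_embedding ::
    "complex set \<Rightarrow> complex \<Rightarrow> complex \<Rightarrow> (complex \<Rightarrow> 'f::field) \<Rightarrow> (complex^4 \<Rightarrow> 'f^2^2) \<Rightarrow> bool"
  where
  "matrix_embedding K a b \<sigma> \<rho> \<longleftrightarrow>
     inj_on \<rho> (qalg K) \<and>
     (\<forall>x\<in>qalg K. \<forall>y\<in>qalg K. \<rho> (x + y) = \<rho> x + \<rho> y \<and> \<rho> (qmult a b x y) = \<rho> x ** \<rho> y) \<and>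
     (\<forall>c\<in>K. \<rho> (c *s qone) = mat (\<sigma> c))"

section \<open>Arithmetic orbifolds\<close>

text \<open>The embedding \<open>\<rho>\<close> above a given \<open>\<sigma>\<close> is unique only up to conjugation by an invertible
  matrix.\<close>

definition arithmetic_via ::
    "complex set \<Rightarrow> complex \<Rightarrow> complex \<Rightarrow> (complex \<Rightarrow> 'f::field) \<Rightarrow> ('f^2^2) set set \<Rightarrow> bool" where
  "arithmetic_via K a b \<sigma> \<Gamma> \<longleftrightarrow>
     (\<exists>\<O> \<rho> g. maximal_order K a b \<O> \<and> matrix_embedding K a b \<sigma> \<rho> \<and> g \<in> carrier PSL2 \<and>
        commensurable_subgroups PSL2 (conj_subgroup PSL2 g \<Gamma>) (psl_proj ` \<rho> ` norm_one a b \<O>))"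

primrec field_of_definition :: "orbifold \<Rightarrow> complex set \<Rightarrow> bool" where
  "field_of_definition (Orb2 \<Gamma>) K \<longleftrightarrow>
     number_field K \<and> totally_real K \<and>
     (\<exists>a\<in>K - {0}. \<exists>b\<in>K - {0}. \<exists>\<sigma>. {v \<in> real_places K. \<not> ramified_at a b v} = {\<sigma>} \<and>
        arithmetic_via K a b \<sigma> \<Gamma>)"
| "field_of_definition (Orb3 \<Gamma>) K \<longleftrightarrow>
     number_field K \<and> card (complex_places K) = 1 \<and>
     (\<exists>a\<in>K - {0}. \<exists>b\<in>K - {0}. (\<forall>v\<in>real_places K. ramified_at a b v) \<and>
        (\<exists>\<tau>\<in>nonreal_embeddings K. arithmetic_via K a b \<tau> \<Gamma>))"

definition arithmetic :: "orbifold \<Rightarrow> bool" where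
  "arithmetic M \<longleftrightarrow> (\<exists>K. field_of_definition M K)"

end

theory Submission
  imports Defs "Jordan_Normal_Form.Char_Poly"
begin

text \<open>Let \<open>A \<in> SL(2)\<close> represent a hyperbolic element of an arithmetic group \<open>\<Gamma>\<close> with field \<open>k\<close>, and let
  \<open>u + u\<^sup>-\<^sup>1\<close> be its trace. A fixed power \<open>m\<close> carries \<open>\<Gamma>\<close> into the image of the order, so \<open>u\<^sup>m\<close> and
  \<open>u\<^sup>-\<^sup>m\<close> are algebraic integers. Because \<open>\<Gamma>\<close> is discrete of finite covolume, some \<open>g \<in> \<Gamma>\<close> moves the
  fixed points of \<open>h = A\<^sup>m\<close> into general position; otherwise \<open>\<Gamma>\<close> would preserve the axis of \<open>A\<close>, and a
  set of infinite volume would be covered with bounded multiplicity by a set of finite volume.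
  Then \<open>1, h, g h g\<^sup>-\<^sup>1, h g h g\<^sup>-\<^sup>1\<close> is a \<open>k\<close>-basis of the quaternion algebra, so conjugation by \<open>A\<close>
  preserves the algebra, and its trace \<open>(u + u\<^sup>-\<^sup>1)\<^sup>2\<close> is an integer of \<open>k\<close>. At a ramified real place
  conjugation by \<open>A\<close> preserves a definite form, so the conjugate of this integer is at most 4 in absolute
  value. If \<open>\<bar>u\<bar> \<le> 2\<close>, all conjugates of \<open>(u + u\<^sup>-\<^sup>1)\<^sup>2\<close> are bounded, which leaves finitely many values of
  \<open>u\<close> in each degree; hence short geodesics force the degree to infinity.

  Commensurable orbifolds have the same field, because every isometry of hyperbolic space is a Moebius
  transformation, possibly composed with a reflection. A sequence with infinitely many members of one
  commensurability class would therefore contradict the divergence of the degrees.\<close>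

text \<open>The obstacle is that an arithmetic group need not lie in the image of the algebra: only
  a power of each element does, up to sign, and the trace of \<open>A\<close> itself need not lie in
  the field. Conjugation by \<open>A\<close> does act on the algebra, and on this four-dimensional
  space its trace is tr(A) tr(A^-1) = tr(A)^2; hence squares of traces are estimated. All conjugates
  of this square can be bounded because only one place is left without the bound from ramification:
  the split real place, or the complex place with its two conjugate embeddings. There the conjugate
  is (u + 1/u)^2 or its complex conjugate, which is controlled by the size of \<open>u\<close>. Laws
  of the action, invariance of distance and invariance of volume are all reduced to two kinds of
  generators of SL(2), the horizontal translations and \<open>weyl\<close>. The plane inherits its
  action and metric from a vertical plane in space. The divergence of degrees is proved for any
  choice of fields with a one-sided arithmeticity condition. One field may thus be assigned to a
  whole commensurability class.\<close>

hide_const (open) Matrix.mat Matrix.vec Determinant.det Matrix.row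
hide_fact (open) Matrix.vec_eq_iff Matrix.mat_def Determinant.det_def
no_notation vec_index (infixl "$" 100)

section \<open>Algebraic integers\<close>

interpretation int_module: Modules.module "\<lambda>(n::int) (x::'a::field_char_0). of_int n * x"
  by unfold_locales (auto simp: algebra_simps)

text \<open>The column \<open>V\<close> is an eigenvector of the integer matrix \<open>c\<close>, so
  \<open>x\<close> is a root of its characteristic polynomial, which is monic and integral.\<close>

lemma algebraic_int_eigenvalue:
  fixes x :: "'a::field_char_0" and V :: "nat \<Rightarrow> 'a" and c :: "nat \<Rightarrow> nat \<Rightarrow> int"
  assumes "\<And>i. i < n \<Longrightarrow> x * V i = (\<Sum>j<n. of_int (c i j) * V j)" and k: "k < n" "V k \<noteq> 0"
  shows "algebraic_int x"
proof -
  define A where "A = Matrix.mat n n (\<lambda>(i,j). c i j)"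
  define A' where "A' = Matrix.map_mat (of_int :: int \<Rightarrow> 'a) A"
  have A: "A \<in> carrier_mat n n" "A' \<in> carrier_mat n n" by (auto simp: A_def A'_def)
  have "Matrix.vec n V \<noteq> 0\<^sub>v n"
  proof
    assume "Matrix.vec n V = 0\<^sub>v n"
    then have "vec_index (Matrix.vec n V) k = vec_index (0\<^sub>v n) k" by simp
    with k show False by simp
  qed
  moreover have "A' *\<^sub>v Matrix.vec n V = x \<cdot>\<^sub>v Matrix.vec n V"
    using assms(1) by (intro eq_vecI) (auto simp: A'_def A_def scalar_prod_def atLeast0LessThan)
  ultimately have "eigenvector A' (Matrix.vec n V) x"
    unfolding eigenvector_def using A by auto
  then have "poly (char_poly A') x = 0"
    using eigenvalue_root_char_poly[OF A(2)] by (auto simp: eigenvalue_def)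
  moreover have "char_poly A' = map_poly of_int (char_poly A)"
    unfolding A'_def by (rule of_int_hom.char_poly_hom[OF A(1)])
  moreover have "lead_coeff (char_poly A) = 1" using degree_monic_char_poly[OF A(1)] by simp
  ultimately show ?thesis by (auto simp: algebraic_int_altdef_ipoly)
qed

text \<open>Multiplication by \<open>x\<close> becomes an integer matrix that has the vector of
  generators as an eigenvector; \<open>s0\<close> makes this vector nonzero.\<close>

lemma algebraic_int_stable_module:
  fixes x :: "'a::field_char_0"
  assumes "finite S" "s0 \<in> S" "s0 \<noteq> 0" and st: "\<And>s. s \<in> S \<Longrightarrow> x * s \<in> int_module.span S"
  shows "algebraic_int x"
proof -
  obtain h where h: "bij_betw h {0..<card S} S" using assms(1) ex_bij_betw_nat_finite by blast
  have "\<exists>u. x * s = (\<Sum>t\<in>S. of_int (u t) * t)" if "s \<in> S" for s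
    using st[OF that] int_module.span_finite[OF assms(1)] by auto
  then obtain u where u: "\<And>s. s \<in> S \<Longrightarrow> x * s = (\<Sum>t\<in>S. of_int (u s t) * t)" by metis
  obtain k where k: "k < card S" "h k = s0"
    using h assms(2) unfolding bij_betw_def by (metis atLeastLessThan_iff imageE)
  show ?thesis
  proof (rule algebraic_int_eigenvalue[of "card S" x h "\<lambda>i j. u (h i) (h j)" k])
    fix i assume "i < card S"
    then have "h i \<in> S" using h by (auto simp: bij_betw_def)
    then have "x * h i = (\<Sum>t\<in>S. of_int (u (h i) t) * t)" using u by simp
    also have "\<dots> = (\<Sum>j\<in>{0..<card S}. of_int (u (h i) (h j)) * h j)"
      by (rule sum.reindex_bij_betw[OF h, symmetric])
    finally show "x * h i = (\<Sum>j<card S. of_int (u (h i) (h j)) * h j)"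
      by (simp add: atLeast0LessThan)
  qed (use k assms in auto)
qed

lemma span_mult_closed:
  fixes r :: "'a::field_char_0"
  assumes "\<And>s. s \<in> S \<Longrightarrow> r * s \<in> int_module.span U" "y \<in> int_module.span S"
  shows "r * y \<in> int_module.span U"
  using assms(2)
proof (induction rule: int_module.span_induct_alt)
  case base then show ?case by (simp add: int_module.span_zero)
next
  case (step c x y)
  have "r * (of_int c * x + y) = of_int c * (r * x) + r * y" by (simp add: algebra_simps)
  then show ?case using step assms(1)
    by (metis int_module.span_add int_module.span_scale)
qed

text \<open>The powers of \<open>x\<close> below the degree of a monic integral equation generate
  such a module, since the equation rewrites the next power.\<close>

lemma algebraic_int_power_module:
  fixes x :: "'a::field_char_0"
  assumes "algebraic_int x"
  shows "\<exists>S. finite S \<and> 1 \<in> S \<and> (\<forall>y\<in>int_module.span S. x * y \<in> int_module.span S)"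
proof -
  obtain p where p: "poly (map_poly of_int p) x = 0" "lead_coeff p = 1"
    using assms by (auto simp: algebraic_int_altdef_ipoly)
  define n where "n = degree p"
  have n: "n > 0"
  proof (rule ccontr)
    assume "\<not> n > 0"
    then obtain a where a: "p = [:a:]" by (auto simp: n_def elim: degree_eq_zeroE)
    then show False using p by (simp add: map_poly_pCons)
  qed
  let ?S = "(\<lambda>i. x ^ i) ` {..<n}"
  have xn: "x ^ n = - (\<Sum>i<n. of_int (coeff p i) * x ^ i)"
  proof -
    have "0 = (\<Sum>i\<le>n. of_int (coeff p i) * x ^ i)"
      using p(1) by (simp add: poly_altdef n_def degree_map_poly coeff_map_poly)
    also have "\<dots> = (\<Sum>i<n. of_int (coeff p i) * x ^ i) + x ^ n"
      using p(2) by (simp add: n_def flip: lessThan_Suc_atMost)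
    finally show ?thesis by (simp add: eq_neg_iff_add_eq_0 add.commute)
  qed
  have "x * s \<in> int_module.span ?S" if "s \<in> ?S" for s
  proof -
    obtain i where i: "i < n" "s = x ^ i" using \<open>s \<in> ?S\<close> by blast
    show ?thesis
    proof (cases "Suc i < n")
      case True then show ?thesis using i by (intro int_module.span_base) (auto intro!: image_eqI[of _ _ "Suc i"])
    next
      case False
      then have "x * s = x ^ n" using i by (metis Suc_lessI power_Suc)
      also have "\<dots> \<in> int_module.span ?S" unfolding xn
        by (intro int_module.span_neg int_module.span_sum int_module.span_scale int_module.span_base) auto
      finally show ?thesis .
    qed
  qed
  then have "\<forall>y\<in>int_module.span ?S. x * y \<in> int_module.span ?S" using span_mult_closed by blast
  moreover have "1 \<in> ?S" using n by (auto intro!: image_eqI[of _ _ 0])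
  ultimately show ?thesis by (intro exI[of _ ?S]) auto
qed

text \<open>Products of the generators of two modules work: \<open>a\<close> acts on the factor from
  \<open>S\<close>, the elements of \<open>R\<close> on the factor from \<open>T\<close>. A common
  module for two integers gives their sum and product at once.\<close>

lemma algebraic_ints_common_module:
  fixes R :: "'a::field_char_0 set"
  assumes "finite R" "\<And>x. x \<in> R \<Longrightarrow> algebraic_int x"
  shows "\<exists>S. finite S \<and> 1 \<in> S \<and> (\<forall>x\<in>R. \<forall>y\<in>int_module.span S. x * y \<in> int_module.span S)"
  using assms
proof (induction rule: finite_induct)
  case empty then show ?case by (intro exI[of _ "{1}"]) auto
next
  case (insert a R)
  then obtain T where T: "finite T" "1 \<in> T" "\<And>x y. x \<in> R \<Longrightarrow> y \<in> int_module.span T \<Longrightarrow> x * y \<in> int_module.span T"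
    by auto
  obtain S where S: "finite S" "1 \<in> S" "\<And>y. y \<in> int_module.span S \<Longrightarrow> a * y \<in> int_module.span S"
    using algebraic_int_power_module[of a] insert.prems by auto
  let ?U = "(\<lambda>(s,t). s * t) ` (S \<times> T)"
  have 1: "s * y \<in> int_module.span ?U" if "s \<in> S" "y \<in> int_module.span T" for s y
    by (rule span_mult_closed[OF _ that(2)], rule int_module.span_base) (use that in auto)
  have 2: "t * y \<in> int_module.span ?U" if "t \<in> T" "y \<in> int_module.span S" for t y
    by (rule span_mult_closed[OF _ that(2)], rule int_module.span_base) (use that in \<open>auto simp: mult.commute\<close>)
  have "x * u \<in> int_module.span ?U" if x: "x \<in> insert a R" and u: "u \<in> ?U" for x u
  proof -
    obtain s t where st: "s \<in> S" "t \<in> T" "u = s * t" using u by auto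
    show ?thesis
    proof (cases "x = a")
      case True
      have "t * (a * s) \<in> int_module.span ?U" using 2 S(3) st int_module.span_base by blast
      then show ?thesis using True st by (simp add: mult_ac)
    next
      case False
      then have "s * (x * t) \<in> int_module.span ?U" using 1 T(3) st int_module.span_base x by blast
      then show ?thesis using st by (simp add: mult_ac)
    qed
  qed
  then have "\<forall>x\<in>insert a R. \<forall>y\<in>int_module.span ?U. x * y \<in> int_module.span ?U"
    using span_mult_closed by blast
  moreover have "1 \<in> ?U" using S T by (auto intro!: image_eqI[of _ _ "(1,1)"])
  ultimately show ?case using S T by (intro exI[of _ ?U]) auto
qed

lemma algebraic_int_add_mult:
  fixes x y :: "'a::field_char_0"
  assumes "algebraic_int x" "algebraic_int y"
  shows "algebraic_int (x + y)" "algebraic_int (x * y)"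
proof -
  obtain S where S: "finite S" "1 \<in> S" "\<And>z r. z \<in> int_module.span S \<Longrightarrow> r \<in> {x,y} \<Longrightarrow> r * z \<in> int_module.span S"
    using algebraic_ints_common_module[of "{x,y}"] assms by (metis finite.emptyI finite.insertI insert_iff emptyE)
  have "(x + y) * s \<in> int_module.span S" if "s \<in> S" for s
    using S(3) int_module.span_base[OF that] by (simp add: int_module.span_add distrib_right)
  then show "algebraic_int (x + y)" using algebraic_int_stable_module[OF S(1,2)] by simp
  have "(x * y) * s \<in> int_module.span S" if "s \<in> S" for s
    using S(3) int_module.span_base[OF that] by (simp add: mult.assoc)
  then show "algebraic_int (x * y)" using algebraic_int_stable_module[OF S(1,2)] by simp
qed

text \<open>An order is a module over the integers of the field, not over the rational integers, so
  its multiplications have matrices with algebraic integers as entries. A module stable under all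
  entries, multiplied by the coordinates of the eigenvector, is stable under
  \<open>x\<close>.\<close>

lemma algebraic_int_eigenvalue_integral:
  fixes x :: "'a::field_char_0"
  assumes I: "finite I" and r: "\<And>i j. i \<in> I \<Longrightarrow> j \<in> I \<Longrightarrow> algebraic_int (r i j)"
    and ev: "\<And>i. i \<in> I \<Longrightarrow> x * V i = (\<Sum>j\<in>I. r i j * V j)" and k: "k \<in> I" "V k \<noteq> 0"
  shows "algebraic_int x"
proof -
  let ?R = "(\<lambda>(i,j). r i j) ` (I \<times> I)"
  have "finite ?R" "\<And>x. x \<in> ?R \<Longrightarrow> algebraic_int x" using I r by auto
  from algebraic_ints_common_module[OF this] obtain S where S: "finite S" "1 \<in> S"
    "\<And>x z. x \<in> ?R \<Longrightarrow> z \<in> int_module.span S \<Longrightarrow> x * z \<in> int_module.span S" by blast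
  have rS: "r i j * z \<in> int_module.span S" if "i \<in> I" "j \<in> I" "z \<in> int_module.span S" for i j z
    using S(3)[of "r i j" z] that by auto
  let ?U = "(\<lambda>(s,i). s * V i) ` (S \<times> I)"
  have 1: "V j * y \<in> int_module.span ?U" if "j \<in> I" "y \<in> int_module.span S" for j y
    by (rule span_mult_closed[OF _ that(2)], rule int_module.span_base) (use that in \<open>auto simp: mult.commute\<close>)
  show ?thesis
  proof (rule algebraic_int_stable_module[of ?U "V k"])
    fix u assume "u \<in> ?U"
    then obtain s i where si: "s \<in> S" "i \<in> I" "u = s * V i" by auto
    have "x * u = s * (\<Sum>j\<in>I. r i j * V j)" using ev[OF si(2)] si by (simp add: mult_ac)
    also have "\<dots> = (\<Sum>j\<in>I. V j * (r i j * s))" by (simp add: sum_distrib_left mult_ac)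
    also have "\<dots> \<in> int_module.span ?U"
      using 1 rS si int_module.span_base by (intro int_module.span_sum) blast
    finally show "x * u \<in> int_module.span ?U" .
  qed (use I S k in \<open>auto intro!: image_eqI[of _ _ "(1,k)"]\<close>)
qed

section \<open>Embeddings of number fields\<close>

text \<open>Number fields are sets of complex numbers rather than types, so a polynomial over
  \<open>L\<close> is a complex polynomial with restricted coefficients.\<close>

definition coeffs_in :: "complex set \<Rightarrow> complex poly set" where
  "coeffs_in L = {p. \<forall>i. coeff p i \<in> L}"

locale complex_subring =
  fixes L :: "complex set"
  assumes one_mem: "1 \<in> L" and diff_mem: "\<And>x y. x \<in> L \<Longrightarrow> y \<in> L \<Longrightarrow> x - y \<in> L"
    and mult_mem: "\<And>x y. x \<in> L \<Longrightarrow> y \<in> L \<Longrightarrow> x * y \<in> L"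
begin

lemma zero_mem: "0 \<in> L" using diff_mem[OF one_mem one_mem] by simp
lemma uminus_mem: "x \<in> L \<Longrightarrow> - x \<in> L" using diff_mem[OF zero_mem] by simp
lemma add_mem: "x \<in> L \<Longrightarrow> y \<in> L \<Longrightarrow> x + y \<in> L" using diff_mem[of x "- y"] uminus_mem by simp
lemma sum_mem: "(\<And>i. i \<in> I \<Longrightarrow> f i \<in> L) \<Longrightarrow> sum f I \<in> L"
  by (induction I rule: infinite_finite_induct) (auto simp: zero_mem add_mem)
lemma prod_mem: "(\<And>i. i \<in> I \<Longrightarrow> f i \<in> L) \<Longrightarrow> prod f I \<in> L"
  by (induction I rule: infinite_finite_induct) (auto simp: one_mem mult_mem)
lemma power_mem: "x \<in> L \<Longrightarrow> x ^ n \<in> L" by (induction n) (auto simp: one_mem mult_mem)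

lemma of_nat_mem: "of_nat n \<in> L" by (induction n) (auto simp: zero_mem one_mem add_mem)

lemma coeffs_in_diff: "p \<in> coeffs_in L \<Longrightarrow> q \<in> coeffs_in L \<Longrightarrow> p - q \<in> coeffs_in L"
  by (auto simp: coeffs_in_def diff_mem)
lemma coeffs_in_add: "p \<in> coeffs_in L \<Longrightarrow> q \<in> coeffs_in L \<Longrightarrow> p + q \<in> coeffs_in L"
  by (auto simp: coeffs_in_def add_mem)
lemma coeffs_in_mult: "p \<in> coeffs_in L \<Longrightarrow> q \<in> coeffs_in L \<Longrightarrow> p * q \<in> coeffs_in L"
  by (auto simp: coeffs_in_def coeff_mult intro!: sum_mem mult_mem)
lemma coeffs_in_pCons: "pCons a p \<in> coeffs_in L \<longleftrightarrow> a \<in> L \<and> p \<in> coeffs_in L"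
  by (fastforce simp: coeffs_in_def coeff_pCons split: nat.splits)
lemma coeffs_in_0: "0 \<in> coeffs_in L" by (simp add: coeffs_in_def zero_mem)
lemma coeffs_in_smult: "a \<in> L \<Longrightarrow> p \<in> coeffs_in L \<Longrightarrow> Polynomial.smult a p \<in> coeffs_in L"
  by (auto simp: coeffs_in_def mult_mem)
lemma poly_mem: "p \<in> coeffs_in L \<Longrightarrow> x \<in> L \<Longrightarrow> poly p x \<in> L"
  by (auto simp: poly_altdef coeffs_in_def intro!: sum_mem mult_mem power_mem)

text \<open>Stating that the coefficients of the remainder vanish from \<open>degree p\<close> on,
  instead of bounding its degree, includes the divisor 1, where the remainder is 0.\<close>

lemma monic_division:
  assumes "p \<in> coeffs_in L" "lead_coeff p = 1" "q \<in> coeffs_in L"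
  shows "\<exists>s t. s \<in> coeffs_in L \<and> t \<in> coeffs_in L \<and> q = p * s + t \<and> (\<forall>i\<ge>degree p. coeff t i = 0)"
  using assms(3)
proof (induction q)
  case 0 then show ?case by (intro exI[of _ 0]) (auto simp: coeffs_in_0)
next
  case (pCons c q)
  then obtain s t where st: "s \<in> coeffs_in L" "t \<in> coeffs_in L" "q = p * s + t"
    "\<And>i. i \<ge> degree p \<Longrightarrow> coeff t i = 0" by (auto simp: coeffs_in_pCons)
  \<comment> \<open>The coefficient that reaches degree \<open>degree p\<close> when the old
    remainder is shifted by one; subtracting \<open>e\<close> times \<open>p\<close> removes
    it.\<close>
  define e where "e = coeff (pCons c t) (degree p)"
  have ct: "pCons c t \<in> coeffs_in L" using st pCons.prems by (simp add: coeffs_in_pCons)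
  then have e: "e \<in> L" by (simp add: e_def coeffs_in_def)
  have "pCons c q = p * (pCons 0 s + [:e:]) + (pCons c t - Polynomial.smult e p)"
    by (simp add: st(3) algebra_simps)
  moreover have "coeff (pCons c t - Polynomial.smult e p) i = 0" if "i \<ge> degree p" for i
  proof (cases "i = degree p")
    case True then show ?thesis using assms(2) by (simp add: e_def)
  next
    case False
    then have "i > degree p" "i \<noteq> 0" using that by auto
    then obtain j where "i = Suc j" "j \<ge> degree p" by (cases i) auto
    then show ?thesis using st(4)[of j] \<open>i > degree p\<close> by (simp add: coeff_eq_0)
  qed
  moreover have "pCons 0 s + [:e:] \<in> coeffs_in L"
    using st e by (intro coeffs_in_add) (auto simp: coeffs_in_pCons zero_mem coeffs_in_0)
  moreover have "pCons c t - Polynomial.smult e p \<in> coeffs_in L"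
    using ct e assms by (intro coeffs_in_diff coeffs_in_smult)
  ultimately show ?case by blast
qed

end

definition ring_hom_on :: "complex set \<Rightarrow> (complex \<Rightarrow> 'f::field) \<Rightarrow> bool" where
  "ring_hom_on L v \<longleftrightarrow> v 1 = 1 \<and> (\<forall>x\<in>L. \<forall>y\<in>L. v (x + y) = v x + v y \<and> v (x * y) = v x * v y)"

locale complex_subring_hom = complex_subring +
  fixes v :: "complex \<Rightarrow> 'f::field"
  assumes hom: "ring_hom_on L v"
begin

lemma v_one: "v 1 = 1" and v_add: "x \<in> L \<Longrightarrow> y \<in> L \<Longrightarrow> v (x + y) = v x + v y"
  and v_mult: "x \<in> L \<Longrightarrow> y \<in> L \<Longrightarrow> v (x * y) = v x * v y"
  using hom by (auto simp: ring_hom_on_def)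
lemma v_zero: "v 0 = 0" by (metis add_0 add_cancel_right_right v_add zero_mem)
lemma v_minus: "x \<in> L \<Longrightarrow> v (- x) = - v x"
  using v_add[of x "- x"] uminus_mem v_zero by (simp add: eq_neg_iff_add_eq_0 add.commute)
lemma v_diff: "x \<in> L \<Longrightarrow> y \<in> L \<Longrightarrow> v (x - y) = v x - v y"
  using v_add[of x "- y"] uminus_mem v_minus by simp
lemma v_sum: "(\<And>i. i \<in> I \<Longrightarrow> f i \<in> L) \<Longrightarrow> v (sum f I) = (\<Sum>i\<in>I. v (f i))"
  by (induction I rule: infinite_finite_induct) (auto simp: v_zero v_add sum_mem)
lemma v_of_nat: "v (of_nat n) = of_nat n"
proof (induction n)
  case (Suc n)
  then show ?case by (simp add: v_add one_mem v_one of_nat_mem)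
qed (simp add: v_zero)
lemma v_of_int: "v (of_int n) = of_int n"
proof (cases n)
  case (nonneg m) then show ?thesis by (simp add: v_of_nat)
next
  case (neg m)
  then show ?thesis using v_minus[of "of_nat (Suc m)"] v_of_nat[of "Suc m"] of_nat_mem[of "Suc m"] by simp
qed
lemma v_nonzero: assumes "x \<in> L" "inverse x \<in> L" "x \<noteq> 0" shows "v x \<noteq> 0"
  using v_mult[OF assms(1,2)] assms v_one by auto
lemma v_inverse: assumes "x \<in> L" "inverse x \<in> L" shows "v (inverse x) = inverse (v x)"
proof (cases "x = 0")
  case False
  then have "v x * v (inverse x) = 1" using v_mult[OF assms] v_one by simp
  then show ?thesis by (metis inverse_unique)
qed (simp add: v_zero)

lemma map_poly_add: "p \<in> coeffs_in L \<Longrightarrow> q \<in> coeffs_in L \<Longrightarrow> map_poly v (p + q) = map_poly v p + map_poly v q"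
  by (rule poly_eqI) (auto simp: coeff_map_poly v_zero v_add coeffs_in_def)
lemma map_poly_diff: "p \<in> coeffs_in L \<Longrightarrow> q \<in> coeffs_in L \<Longrightarrow> map_poly v (p - q) = map_poly v p - map_poly v q"
  by (rule poly_eqI) (auto simp: coeff_map_poly v_zero v_diff coeffs_in_def)
lemma map_poly_mult: "p \<in> coeffs_in L \<Longrightarrow> q \<in> coeffs_in L \<Longrightarrow> map_poly v (p * q) = map_poly v p * map_poly v q"
  by (rule poly_eqI) (auto simp: coeff_map_poly v_zero v_mult coeffs_in_def coeff_mult v_sum mult_mem)
lemma poly_map_poly: assumes "p \<in> coeffs_in L" "x \<in> L" shows "poly (map_poly v p) (v x) = v (poly p x)"
  using assms(1)
proof (induction p)
  case (pCons a p)
  then have "map_poly v (pCons a p) = pCons (v a) (map_poly v p)"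
    by (intro map_poly_pCons) auto
  then show ?case using pCons assms poly_mem by (simp add: coeffs_in_pCons v_add v_mult mult_mem)
qed (simp add: v_zero)

end

text \<open>If the constant term \<open>a\<close> is nonzero, then \<open>a = - y * q\<close> with
  \<open>q\<close> the value of the remaining polynomial, and \<open>1/y = - q / a\<close>. If it is
  zero, a factor \<open>y\<close> cancels first.\<close>

lemma (in complex_subring) inverse_mem_algebraic:
  assumes "y \<in> L" "\<rat> \<subseteq> L" "p \<in> coeffs_in \<rat>" "p \<noteq> 0" "poly p y = 0"
  shows "inverse y \<in> L"
proof (cases "y = 0")
  case False
  interpret Q: complex_subring "\<rat>" by unfold_locales auto
  show ?thesis using assms(3-5)
  proof (induction p)
    case (pCons a p)
    show ?case
    proof (cases "a = 0")
      case True then show ?thesis using pCons False by (auto simp: Q.coeffs_in_pCons)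
    next
      case a: False
      have aQ: "inverse a \<in> L" "p \<in> coeffs_in \<rat>" using pCons.prems assms(2) by (auto simp: Q.coeffs_in_pCons)
      have "poly p y \<in> L" using aQ(2) assms(2) by (intro poly_mem assms(1)) (auto simp: coeffs_in_def)
      moreover have "a = - (y * poly p y)" using pCons.prems(3) by (simp add: eq_neg_iff_add_eq_0)
      then have "inverse y = - (poly p y * inverse a)" using a False by (simp add: field_simps)
      ultimately show ?thesis using aQ by (auto intro: uminus_mem mult_mem)
    qed
  qed simp
qed (simp add: zero_mem)

text \<open>This is the universal property of \<open>L[X]/(p)\<close>; the hypothesis
  \<open>min\<close> makes \<open>p\<close> the minimal polynomial of \<open>b\<close>. The
  extension evaluates the image of \<open>q\<close> at \<open>r\<close>, and this depends on
  \<open>poly q b\<close> alone because a polynomial vanishing at \<open>b\<close> leaves remainder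
  0 on division by \<open>p\<close>.\<close>

lemma (in complex_subring_hom) extend_hom:
  fixes r :: 'f
  assumes p: "p \<in> coeffs_in L" "lead_coeff p = 1" "poly p b = 0"
    and min: "\<And>q. q \<in> coeffs_in L \<Longrightarrow> poly q b = 0 \<Longrightarrow> \<forall>i\<ge>degree p. coeff q i = 0 \<Longrightarrow> q = 0"
    and r: "poly (map_poly v p) r = 0"
  shows "\<exists>L' v'. complex_subring L' \<and> ring_hom_on L' v' \<and> L' = (\<lambda>q. poly q b) ` coeffs_in L \<and> L \<subseteq> L' \<and> b \<in> L' \<and>
           (\<forall>x\<in>L. v' x = v x) \<and> v' b = r"
proof -
  define L' where "L' = (\<lambda>q. poly q b) ` coeffs_in L"
  define v' where "v' y = poly (map_poly v (SOME q. q \<in> coeffs_in L \<and> poly q b = y)) r" for y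
  have wd0: "poly (map_poly v q) r = 0" if q: "q \<in> coeffs_in L" "poly q b = 0" for q
  proof -
    obtain s t where st: "s \<in> coeffs_in L" "t \<in> coeffs_in L" "q = p * s + t" "\<forall>i\<ge>degree p. coeff t i = 0"
      using monic_division[OF p(1,2) q(1)] by blast
    have "poly t b = 0" using st(3) q(2) p(3) by simp
    then have "t = 0" using min st by blast
    then show ?thesis using st(3) r by (simp add: map_poly_mult[OF p(1) st(1)])
  qed
  have v': "v' (poly q b) = poly (map_poly v q) r" if q: "q \<in> coeffs_in L" for q
  proof -
    define q' where "q' = (SOME q'. q' \<in> coeffs_in L \<and> poly q' b = poly q b)"
    have q': "q' \<in> coeffs_in L" "poly q' b = poly q b"
      unfolding q'_def using someI[of "\<lambda>q'. q' \<in> coeffs_in L \<and> poly q' b = poly q b" q] q by auto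
    have "poly (map_poly v (q' - q)) r = 0" using q q' by (intro wd0 coeffs_in_diff) auto
    then have "poly (map_poly v q') r = poly (map_poly v q) r" using q q' by (simp add: map_poly_diff)
    then show ?thesis by (simp add: v'_def q'_def)
  qed
  have const: "[:x:] \<in> coeffs_in L" if "x \<in> L" for x using that by (simp add: coeffs_in_pCons coeffs_in_0)
  have v'c: "v' x = v x" if "x \<in> L" for x
  proof -
    have "map_poly v [:x:] = [:v x:]"
      by (rule poly_eqI) (simp add: coeff_map_poly v_zero coeff_pCons split: nat.split)
    then show ?thesis using v'[OF const[OF that]] by simp
  qed
  have X: "[:0,1:] \<in> coeffs_in L" by (simp add: coeffs_in_pCons coeffs_in_0 zero_mem one_mem)
  have v'b: "v' b = r" using v'[OF X] by (simp add: map_poly_pCons v_zero v_one)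
  have "L \<subseteq> L'" using const unfolding L'_def by (force intro: image_eqI[where x="[:x:]" for x])
  moreover have "b \<in> L'" using X unfolding L'_def by (intro image_eqI[of _ _ "[:0,1:]"]) auto
  moreover have "complex_subring L'"
  proof
    show "1 \<in> L'" using \<open>L \<subseteq> L'\<close> one_mem by auto
  next
    fix x y assume "x \<in> L'" "y \<in> L'"
    then obtain q s where "q \<in> coeffs_in L" "s \<in> coeffs_in L" "x = poly q b" "y = poly s b" by (auto simp: L'_def)
    then show "x - y \<in> L'" "x * y \<in> L'" unfolding L'_def
      using image_eqI[of _ "\<lambda>q. poly q b" "q - s"] image_eqI[of _ "\<lambda>q. poly q b" "q * s"] coeffs_in_diff coeffs_in_mult by auto
  qed
  moreover have "ring_hom_on L' v'"
    unfolding ring_hom_on_def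
  proof (intro conjI ballI)
    show "v' 1 = 1" using v'c[OF one_mem] v_one by simp
  next
    fix x y assume "x \<in> L'" "y \<in> L'"
    then obtain q s where qs: "q \<in> coeffs_in L" "s \<in> coeffs_in L" "x = poly q b" "y = poly s b" by (auto simp: L'_def)
    show "v' (x + y) = v' x + v' y" "v' (x * y) = v' x * v' y"
      using v'[OF coeffs_in_add[OF qs(1,2)]] v'[OF coeffs_in_mult[OF qs(1,2)]] v'[OF qs(1)] v'[OF qs(2)] qs
      by (auto simp: map_poly_add map_poly_mult)
  qed
  ultimately show ?thesis using v'c v'b L'_def by blast
qed

lemma number_field_subring: "number_field K \<Longrightarrow> complex_subring K"
  by (auto simp: number_field_def complex_subring_def)

lemma Rats_subset_number_field:
  assumes "number_field K" shows "\<rat> \<subseteq> K"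
proof
  fix x :: complex assume "x \<in> \<rat>"
  then obtain q where q: "x = of_rat q" by (auto elim: Rats_cases)
  obtain B where B: "K = rat_complex.span B" using assms by (auto simp: number_field_def)
  have "of_rat q * 1 \<in> rat_complex.span B"
    using assms B by (intro rat_complex.span_scale) (auto simp: number_field_def)
  then show "x \<in> K" using q B by simp
qed

lemma number_field_annihilator:
  assumes K: "number_field K" and x: "x \<in> K"
  shows "\<exists>p\<in>coeffs_in \<rat>. p \<noteq> 0 \<and> degree p \<le> degree_over_Q K \<and> poly p x = 0"
proof -
  interpret K: complex_subring K using K by (rule number_field_subring)
  define d where "d = degree_over_Q K"
  obtain B0 where B0: "finite B0" "K = rat_complex.span B0" using K by (auto simp: number_field_def)
  obtain B where B: "B \<subseteq> K" "rat_complex.independent B" "K \<subseteq> rat_complex.span B" "card B = d"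
    using rat_complex.basis_exists[of K] by (metis d_def degree_over_Q_def)
  have finB: "finite B" using rat_complex.independent_span_bound[OF B0(1) B(2)] B(1) B0(2) by simp
  show ?thesis
  \<comment> \<open>If powers coincide, the set of powers has fewer than \<open>d + 1\<close>
    elements and comparing its size with the dimension fails; the difference of two monomials is
    then an annihilator.\<close>
  proof (cases "inj_on (\<lambda>i. x ^ i) {..d}")
    case False
    then obtain i j where ij: "i \<le> d" "j \<le> d" "i < j" "x ^ i = x ^ j"
      by (auto simp: inj_on_def) (metis linorder_neqE_nat)
    let ?p = "Polynomial.monom 1 j - Polynomial.monom 1 i :: complex poly"
    have "coeff ?p j = 1" using ij by simp
    then have "?p \<noteq> 0" by (metis coeff_0 zero_neq_one)
    moreover have "degree ?p \<le> d" using ij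
      by (intro degree_diff_le) (auto intro: order_trans[OF degree_monom_le])
    moreover have "?p \<in> coeffs_in \<rat>" by (auto simp: coeffs_in_def)
    moreover have "poly ?p x = 0" using ij by (simp add: poly_monom)
    ultimately show ?thesis using d_def by blast
  next
    case inj: True
    let ?S = "(\<lambda>i. x ^ i) ` {..d}"
    have "card ?S = Suc d" using card_image[OF inj] by simp
    moreover have "?S \<subseteq> rat_complex.span B" using x K.power_mem B(3) by auto
    ultimately have "rat_complex.dependent ?S"
      using rat_complex.independent_span_bound[OF finB, of ?S] B(4) by auto
    then obtain u where u: "\<exists>y\<in>?S. u y \<noteq> 0" "(\<Sum>y\<in>?S. of_rat (u y) * y) = 0"
      by (subst (asm) rat_complex.dependent_finite) auto
    let ?p = "\<Sum>i\<le>d. Polynomial.monom (of_rat (u (x ^ i))) i :: complex poly"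
    have cf: "coeff ?p i = (if i \<le> d then of_rat (u (x ^ i)) else 0)" for i
      by (simp add: coeff_sum)
    have "?p \<in> coeffs_in \<rat>" by (auto simp: coeffs_in_def cf)
    moreover have "?p \<noteq> 0"
    proof
      assume "?p = 0"
      then have "coeff ?p i = 0" for i by simp
      then have "u (x ^ i) = 0" if "i \<le> d" for i using that unfolding cf by (metis of_rat_eq_0_iff)
      then show False using u(1) by auto
    qed
    moreover have "degree ?p \<le> d" by (rule degree_le) (auto simp: cf)
    moreover have "poly ?p x = 0"
      using u(2) by (simp add: poly_sum poly_monom sum.reindex[OF inj])
    ultimately show ?thesis using d_def by blast
  qed
qed

lemma (in complex_subring) monic_minimal_polynomial:
  assumes inv: "\<And>x. x \<in> L \<Longrightarrow> inverse x \<in> L"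
    and p0: "p0 \<in> coeffs_in L" "p0 \<noteq> 0" "poly p0 b = 0"
  shows "\<exists>p\<in>coeffs_in L. lead_coeff p = 1 \<and> poly p b = 0 \<and> degree p \<le> degree p0 \<and>
           (\<forall>q\<in>coeffs_in L. poly q b = 0 \<longrightarrow> (\<forall>i\<ge>degree p. coeff q i = 0) \<longrightarrow> q = 0)"
proof -
  let ?P = "\<lambda>p. p \<in> coeffs_in L \<and> p \<noteq> 0 \<and> poly p b = 0"
  obtain p where p: "?P p" "\<And>q. ?P q \<Longrightarrow> degree p \<le> degree q"
    using ex_has_least_nat[of ?P p0 degree] p0 by blast
  let ?p = "Polynomial.smult (inverse (lead_coeff p)) p"
  have "?p \<in> coeffs_in L" using p(1) inv by (intro coeffs_in_smult) (auto simp: coeffs_in_def)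
  moreover have "degree ?p = degree p" using p(1) by simp
  moreover have "lead_coeff ?p = 1" "poly ?p b = 0" using p(1) by auto
  moreover have "q = 0" if q: "q \<in> coeffs_in L" "poly q b = 0" "\<forall>i\<ge>degree p. coeff q i = 0" for q
  proof (rule ccontr)
    assume "q \<noteq> 0"
    then have "degree p \<le> degree q" using p(2) q by blast
    then have "lead_coeff q = 0" using q(3) by blast
    then show False using \<open>q \<noteq> 0\<close> by simp
  qed
  moreover have "degree p \<le> degree p0" using p(2) p0 by blast
  ultimately show ?thesis by (intro bexI[of _ ?p] conjI ballI impI) metis+
qed

lemma (in complex_subring) number_field_inverse_mem:
  assumes "number_field K" "L \<subseteq> K" "\<rat> \<subseteq> L" "x \<in> L"
  shows "inverse x \<in> L"
proof -
  have "x \<in> K" using assms by auto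
  then obtain p where "p \<in> coeffs_in \<rat>" "p \<noteq> 0" "poly p x = 0"
    using number_field_annihilator[OF assms(1)] by blast
  then show ?thesis by (rule inverse_mem_algebraic[OF assms(4,3)])
qed

text \<open>Generators are adjoined one at a time. The image of the minimal polynomial under the map
  built so far has a complex root, and this root becomes the image of the generator.\<close>

lemma extend_hom_finite:
  fixes v :: "complex \<Rightarrow> complex"
  assumes K: "number_field K" and L: "complex_subring L" "L \<subseteq> K" "\<rat> \<subseteq> L" "ring_hom_on L v"
    and B: "finite B" "B \<subseteq> K"
  shows "\<exists>L' v'. complex_subring L' \<and> ring_hom_on L' v' \<and> L \<union> B \<subseteq> L' \<and> L' \<subseteq> K \<and> (\<forall>x\<in>L. v' x = v x)"
  using B
proof (induction rule: finite_induct)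
  case empty then show ?case using L by auto
next
  case (insert b B)
  then obtain L1 v1 where L1: "complex_subring L1" "ring_hom_on L1 v1" "L \<union> B \<subseteq> L1" "L1 \<subseteq> K" "\<forall>x\<in>L. v1 x = v x"
    by auto
  interpret K: complex_subring K using K by (rule number_field_subring)
  interpret L1: complex_subring L1 by fact
  interpret v1: complex_subring_hom L1 v1 by unfold_locales fact
  have Q: "\<rat> \<subseteq> L1" using L L1 by auto
  have bK: "b \<in> K" using insert by auto
  obtain p0 where p0: "p0 \<in> coeffs_in \<rat>" "p0 \<noteq> 0" "poly p0 b = 0"
    using number_field_annihilator[OF K bK] by blast
  then have "p0 \<in> coeffs_in L1" using Q by (auto simp: coeffs_in_def)
  from L1.monic_minimal_polynomial[OF L1.number_field_inverse_mem[OF K L1(4) Q] this p0(2,3)]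
  obtain p where p: "p \<in> coeffs_in L1" "lead_coeff p = 1" "poly p b = 0"
    and min: "\<And>q. q \<in> coeffs_in L1 \<Longrightarrow> poly q b = 0 \<Longrightarrow> \<forall>i\<ge>degree p. coeff q i = 0 \<Longrightarrow> q = 0"
    by blast
  have "degree p \<noteq> 0"
  proof
    assume "degree p = 0"
    then obtain a where "p = [:a:]" by (auto elim: degree_eq_zeroE)
    then show False using p(2,3) by simp
  qed
  moreover have "coeff (map_poly v1 p) (degree p) = 1"
    using p(2) by (simp add: coeff_map_poly v1.v_zero v1.v_one)
  then have "degree (map_poly v1 p) \<ge> degree p" by (intro le_degree) simp
  ultimately have "\<not> constant (poly (map_poly v1 p))" by (simp add: constant_degree)
  then obtain r where r: "poly (map_poly v1 p) r = 0" using fundamental_theorem_of_algebra by blast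
  obtain L' v' where L': "complex_subring L'" "ring_hom_on L' v'" "L' = (\<lambda>q. poly q b) ` coeffs_in L1"
    "L1 \<subseteq> L'" "b \<in> L'" "\<forall>x\<in>L1. v' x = v1 x"
    using v1.extend_hom[OF p min r] by blast
  have "L' \<subseteq> K" unfolding L'(3) using L1(4) bK by (auto intro!: K.poly_mem simp: coeffs_in_def subset_iff)
  then show ?case using L' L1 by (intro exI[of _ L'] exI[of _ v']) auto
qed

text \<open>Since \<open>extend_hom\<close> sends an element to any prescribed root, this realises
  every root of its minimal polynomial over the rationals as the value of an embedding of
  \<open>K\<close>. A bound over all embeddings thus bounds all conjugates.\<close>

lemma extend_embedding:
  fixes v :: "complex \<Rightarrow> complex"
  assumes K: "number_field K" and L: "complex_subring L" "L \<subseteq> K" "\<rat> \<subseteq> L" "ring_hom_on L v"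
  shows "\<exists>v'\<in>embeddings K. \<forall>x\<in>L. v' x = v x"
proof -
  obtain B where B: "finite B" "K = rat_complex.span B" using K by (auto simp: number_field_def)
  have "B \<subseteq> K" using B rat_complex.span_superset by auto
  then obtain L' v' where L': "complex_subring L'" "ring_hom_on L' v'" "L \<union> B \<subseteq> L'" "L' \<subseteq> K" "\<forall>x\<in>L. v' x = v x"
    using extend_hom_finite[OF K L B(1)] by auto
  interpret L': complex_subring L' by fact
  have "rat_complex.subspace L'"
  proof -
    have "of_rat c \<in> L'" for c using L(3) L'(3) Rats_of_rat by blast
    then show ?thesis unfolding rat_complex.subspace_def
      by (simp add: L'.zero_mem L'.add_mem L'.mult_mem)
  qed
  then have "K \<subseteq> L'" unfolding B(2) using L'(3) by (intro rat_complex.span_minimal) auto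
  then have "L' = K" using L' by auto
  interpret K: complex_subring K using K by (rule number_field_subring)
  have "restrict v' K \<in> embeddings K"
    using L'(2) \<open>L' = K\<close> by (auto simp: embeddings_def ring_hom_on_def K.one_mem K.add_mem K.mult_mem)
  then show ?thesis using L' L(2) by (intro bexI[of _ "restrict v' K"]) auto
qed

section \<open>Finiteness of integral polynomials with bounded roots\<close>

text \<open>Multiplying by a factor \<open>X - r\<close> with \<open>|r| <= C\<close> enlarges the
  coefficient bound at most by the factor \<open>1 + C\<close>, and the coefficients stay algebraic
  integers if \<open>r\<close> is one.\<close>

lemma monic_root_bounds:
  fixes p :: "complex poly"
  assumes "lead_coeff p = 1" "\<And>r. poly p r = 0 \<Longrightarrow> norm r \<le> C \<and> algebraic_int r" "C \<ge> 0"
  shows "norm (coeff p i) \<le> (1 + C) ^ degree p \<and> algebraic_int (coeff p i)"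
  using assms(1,2)
proof (induction "degree p" arbitrary: p i)
  case 0
  then have "p = 1" by (auto elim!: degree_eq_zeroE simp: one_pCons)
  then show ?case by (auto simp: coeff_1)
next
  case (Suc n)
  have "\<not> constant (poly p)" using Suc.hyps(2) by (simp add: constant_degree)
  then obtain r where r: "poly p r = 0" using fundamental_theorem_of_algebra by blast
  then obtain q where q: "p = [:-r, 1:] * q" using poly_eq_0_iff_dvd dvdE by metis
  have "q \<noteq> 0" using Suc.hyps(2) q by auto
  then have dq: "degree q = n" using Suc.hyps(2) q by (simp add: degree_mult_eq del: mult_pCons_left)
  have lq: "lead_coeff q = 1" using Suc.prems(1) q by (simp add: lead_coeff_mult del: mult_pCons_left)
  have IH: "norm (coeff q i) \<le> (1 + C) ^ n \<and> algebraic_int (coeff q i)" for i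
    using Suc.hyps(1)[of q i] dq lq Suc.prems(2) q by (metis mult_zero_right poly_mult)
  have rC: "norm r \<le> C" "algebraic_int r" using Suc.prems(2) r by auto
  have cf: "coeff p i = (case i of 0 \<Rightarrow> 0 | Suc j \<Rightarrow> coeff q j) + - r * coeff q i"
    unfolding q by (simp add: coeff_pCons split: nat.split)
  have "norm (coeff p i) \<le> (1 + C) ^ n + C * (1 + C) ^ n"
    unfolding cf using IH rC assms(3)
    by (intro order_trans[OF norm_triangle_ineq] add_mono) (auto simp: norm_mult intro!: mult_mono split: nat.split)
  moreover have "algebraic_int (coeff p i)"
    unfolding cf using IH rC by (intro algebraic_int_add_mult) (auto split: nat.split)
  ultimately show ?case using Suc.hyps(2)[symmetric] by (simp add: algebra_simps)
qed

text \<open>The coefficient bound is the one that holds for a monic polynomial of degree at most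
  \<open>d\<close> with all roots of absolute value at most \<open>C\<close>, for
  \<open>C >= 0\<close>.\<close>

definition bounded_int_polys :: "nat \<Rightarrow> real \<Rightarrow> complex poly set" where
  "bounded_int_polys d C = {p. lead_coeff p = 1 \<and> degree p \<le> d \<and> (\<forall>i. coeff p i \<in> \<int> \<and> norm (coeff p i) \<le> (1 + C) ^ d)}"

lemma finite_bounded_int_polys: "finite (bounded_int_polys d C)"
proof -
  let ?I = "of_int ` {-\<lceil>(1+C)^d\<rceil>..\<lceil>(1+C)^d\<rceil>} :: complex set"
  have "bounded_int_polys d C \<subseteq> (\<lambda>xs. Poly xs) ` {xs. set xs \<subseteq> ?I \<and> length xs = Suc d}"
  proof
    fix p assume p: "p \<in> bounded_int_polys d C"
    let ?xs = "map (coeff p) [0..<Suc d]"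
    have "p = Poly ?xs"
      using p by (auto simp: poly_eq_iff coeff_Poly_eq nth_default_def bounded_int_polys_def coeff_eq_0 simp del: upt_Suc)
    moreover have "coeff p i \<in> ?I" for i
    proof -
      obtain k where k: "coeff p i = of_int k" using p by (auto simp: bounded_int_polys_def elim: Ints_cases)
      have "norm (coeff p i) \<le> (1 + C) ^ d" using p by (auto simp: bounded_int_polys_def)
      then have "\<bar>real_of_int k\<bar> \<le> (1 + C) ^ d" by (simp add: k)
      then have "\<bar>k\<bar> \<le> \<lceil>(1 + C) ^ d\<rceil>" by linarith
      then have "k \<in> {-\<lceil>(1+C)^d\<rceil>..\<lceil>(1+C)^d\<rceil>}" unfolding atLeastAtMost_iff by linarith
      then show ?thesis using k by blast
    qed
    then have "set ?xs \<subseteq> ?I" by auto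
    ultimately show "p \<in> (\<lambda>xs. Poly xs) ` {xs. set xs \<subseteq> ?I \<and> length xs = Suc d}"
      by (intro image_eqI[of _ _ ?xs]) auto
  qed
  moreover have "finite {xs. set xs \<subseteq> ?I \<and> length xs = Suc d}" by (rule finite_lists_length_eq) auto
  ultimately show ?thesis using finite_subset by blast
qed

text \<open>The minimal polynomial of \<open>x\<close> over the rationals does it. Its roots are
  algebraic integers of absolute value at most \<open>C\<close>, so its coefficients are rational
  algebraic integers, hence integers, of bounded size.\<close>

lemma embedding_bounded_int_poly:
  assumes K: "number_field K" and x: "x \<in> K" "algebraic_int x"
    and bd: "\<And>v. v \<in> embeddings K \<Longrightarrow> norm (v x :: complex) \<le> C" and C: "C \<ge> 0"
  shows "\<exists>p\<in>bounded_int_polys (degree_over_Q K) C. \<forall>v\<in>embeddings K. poly p (v x) = 0"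
proof -
  interpret K: complex_subring K using K by (rule number_field_subring)
  interpret Q: complex_subring "\<rat>" by unfold_locales auto
  interpret Q: complex_subring_hom "\<rat>" "\<lambda>x. x :: complex" by unfold_locales (auto simp: ring_hom_on_def)
  obtain p0 where p0: "p0 \<in> coeffs_in \<rat>" "p0 \<noteq> 0" "poly p0 x = 0" "degree p0 \<le> degree_over_Q K"
    using number_field_annihilator[OF K x(1)] by blast
  obtain p where p: "p \<in> coeffs_in \<rat>" "lead_coeff p = 1" "poly p x = 0" "degree p \<le> degree p0"
    and min: "\<And>q. q \<in> coeffs_in \<rat> \<Longrightarrow> poly q x = 0 \<Longrightarrow> \<forall>i\<ge>degree p. coeff q i = 0 \<Longrightarrow> q = 0"
    using Q.monic_minimal_polynomial[OF _ p0(1-3)] by (metis Rats_inverse)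
  obtain f where f: "lead_coeff f = 1" "\<forall>i. coeff f i \<in> \<int>" "poly f x = 0"
    using x(2) by (auto simp: algebraic_int.simps)
  have fQ: "f \<in> coeffs_in \<rat>" using f(2) Ints_subset_Rats by (auto simp: coeffs_in_def)
  have root: "norm r \<le> C \<and> algebraic_int r" if r: "poly p r = 0" for r
  proof
    have mid: "map_poly (\<lambda>x. x) p = p" by (rule poly_eqI) (simp add: coeff_map_poly)
    obtain L v where L: "complex_subring L" "ring_hom_on L v" "L = (\<lambda>q. poly q x) ` coeffs_in \<rat>" "\<rat> \<subseteq> L" "x \<in> L" "v x = r"
      using Q.extend_hom[OF p(1-3) min, of r] r unfolding mid by blast
    have "L \<subseteq> K" unfolding L(3) using Rats_subset_number_field[OF K] x(1)
      by (auto intro!: K.poly_mem simp: coeffs_in_def subset_iff)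
    then obtain v' where "v' \<in> embeddings K" "v' x = r"
      using extend_embedding[OF K L(1) _ L(4) L(2)] L by metis
    then show "norm r \<le> C" using bd by blast
    obtain s t where st: "s \<in> coeffs_in \<rat>" "t \<in> coeffs_in \<rat>" "f = p * s + t" "\<forall>i\<ge>degree p. coeff t i = 0"
      using Q.monic_division[OF p(1,2) fQ] by blast
    \<comment> \<open>So \<open>p\<close> divides the monic integral polynomial \<open>f\<close>,
      and every root of \<open>p\<close> is a root of \<open>f\<close>.\<close>
    have "t = 0" using st f(3) p(3) min by simp
    then have "poly f r = 0" using st(3) r by simp
    then show "algebraic_int r" using f by (auto intro: algebraic_int.intros)
  qed
  have "p \<in> bounded_int_polys (degree_over_Q K) C"
    unfolding bounded_int_polys_def
  proof (intro CollectI conjI allI)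
    fix i
    have *: "norm (coeff p i) \<le> (1 + C) ^ degree p \<and> algebraic_int (coeff p i)"
      by (rule monic_root_bounds) (use p root C in auto)
    then show "coeff p i \<in> \<int>" using p(1) rational_algebraic_int_is_int by (auto simp: coeffs_in_def)
    have "(1 + C) ^ degree p \<le> (1 + C) ^ degree_over_Q K" using C p(4) p0(4) by (intro power_increasing) auto
    then show "norm (coeff p i) \<le> (1 + C) ^ degree_over_Q K" using * by linarith
  qed (use p p0 in auto)
  moreover have "poly p (v x) = 0" if v: "v \<in> embeddings K" for v
  proof -
    interpret v: complex_subring_hom K v
      using v by unfold_locales (auto simp: ring_hom_on_def embeddings_def)
    have int: "coeff p i \<in> \<int>" for i using calculation by (auto simp: bounded_int_polys_def)
    have "map_poly v p = p"
    proof (rule poly_eqI)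
      fix i
      obtain k where "coeff p i = of_int k" using int by (auto elim: Ints_cases)
      then show "coeff (map_poly v p) i = coeff p i" by (simp add: coeff_map_poly v.v_zero v.v_of_int)
    qed
    moreover have "p \<in> coeffs_in K" using p(1) Rats_subset_number_field[OF K] by (auto simp: coeffs_in_def)
    ultimately show ?thesis using v.poly_map_poly[OF _ x(1), of p] p(3) v.v_zero by simp
  qed
  ultimately show ?thesis by blast
qed

section \<open>Matrix representations of quaternion algebras\<close>

lemma matrix2_eq_iff: "A = B \<longleftrightarrow> A$1$1 = B$1$1 \<and> A$1$2 = B$1$2 \<and> A$2$1 = B$2$1 \<and> A$2$2 = B$2$2"
  for A B :: "'a^2^2"
  by (auto simp: vec_eq_iff forall_2)

lemma matrix2_mult_nth: "(A ** B)$i$j = A$i$1 * B$1$j + A$i$2 * B$2$j" for A B :: "'a::semiring_1^2^2"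
  by (simp add: matrix_matrix_mult_def sum_2)

lemma mat2_nth: "(mat c :: 'a::zero^2^2)$1$1 = c" "(mat c :: 'a^2^2)$1$2 = 0"
  "(mat c :: 'a^2^2)$2$1 = 0" "(mat c :: 'a^2^2)$2$2 = c"
  by (simp_all add: mat_def)

lemma trace2: "trace (A :: 'a::semiring_1^2^2) = A$1$1 + A$2$2"
  by (simp add: trace_def sum_2)

lemmas matrix2_simps = matrix2_eq_iff matrix2_mult_nth mat2_nth trace2 det_2

text \<open>The adjugate, in the form given by Cayley-Hamilton. It serves as the inverse of matrices
  of determinant 1.\<close>

definition adj2 :: "'a::comm_ring_1^2^2 \<Rightarrow> 'a^2^2" where
  "adj2 A = mat (trace A) - A"

lemma mult_adj2: "A ** adj2 A = mat (det A)" "adj2 A ** A = mat (det A)"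
  by (auto simp: adj2_def matrix2_simps algebra_simps)

lemma trace_adj2 [simp]: "trace (adj2 A) = trace A" and det_adj2 [simp]: "det (adj2 A) = det A"
  by (auto simp: adj2_def matrix2_simps algebra_simps)

lemma mat_mult_nth2: "(mat c ** A)$i$j = c * A$i$j" for A :: "'a::comm_ring_1^2^2"
  using exhaust_2[of i] by (auto simp: matrix2_mult_nth mat2_nth)

lemma matrix2_add_mult: "(A + B) ** C = A ** C + B ** C" for A B C :: "'a::comm_ring_1^2^2"
  by (simp add: matrix2_simps algebra_simps)

lemma trace_mat_mult2: "trace (mat c ** A) = c * trace A" for A :: "'a::comm_ring_1^2^2"
  by (simp add: matrix2_simps algebra_simps)

lemma mat_mult_commute2: "A ** mat c = mat c ** A" for A :: "'a::comm_ring_1^2^2"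
  by (simp add: matrix2_simps algebra_simps)

lemma mat_mult_mat2: "mat c ** mat d = (mat (c * d) :: 'a::comm_ring_1^2^2)"
  by (simp add: matrix2_simps algebra_simps)

text \<open>Cyclicity of the trace gives tr(X Z Z) = tr(Z X Z) = - tr(X Z Z), and
  \<open>Z ** Z\<close> is a nonzero scalar.\<close>

lemma trace_zero_of_anticommute:
  fixes X Z :: "'a::field_char_0^2^2"
  assumes "X ** Z = - (Z ** X)" "Z ** Z = mat c" "c \<noteq> 0"
  shows "trace X = 0"
proof -
  have "c * trace X = trace ((X ** Z) ** Z)"
    by (simp add: matrix_mul_assoc[symmetric] assms(2) mat_mult_commute2 trace_mat_mult2)
  moreover have "trace ((X ** Z) ** Z) = trace (Z ** (X ** Z))" by (rule trace_mul_sym)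
  moreover have "Z ** (X ** Z) = - (X ** Z) ** Z" unfolding matrix_mul_assoc by (simp add: assms(1))
  moreover have "trace (- (X ** Z) ** Z) = - trace ((X ** Z) ** Z)" by (simp add: matrix2_simps algebra_simps)
  ultimately have "2 * (c * trace X) = 0" by (metis add.right_inverse mult_2)
  then show ?thesis using assms(3) by simp
qed

lemma quat_nth [simp]: "quat x y z w $ 1 = x" "quat x y z w $ 2 = y" "quat x y z w $ 3 = z" "quat x y z w $ 4 = w"
  by (simp_all add: quat_def)

lemma quat_eq_iff: "x = y \<longleftrightarrow> x$1 = y$1 \<and> x$2 = y$2 \<and> x$3 = y$3 \<and> x$4 = y$4" for x y :: "'a^4"
  by (auto simp: vec_eq_iff forall_4)

lemmas quat_simps = quat_eq_iff qmult_def qone_def algebra_simps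

lemma mem_qalg: "x \<in> qalg K \<longleftrightarrow> x$1 \<in> K \<and> x$2 \<in> K \<and> x$3 \<in> K \<and> x$4 \<in> K"
  by (auto simp: qalg_def forall_4)

text \<open>The embedding \<open>\<rho>\<close> is given by its properties, not by a formula, so
  traces and determinants are derived from the relations between the images of \<open>i\<close>,
  \<open>j\<close> and \<open>ij\<close>.\<close>

locale quaternion_rep =
  fixes K :: "complex set" and a b :: complex and \<sigma> :: "complex \<Rightarrow> 'f::field_char_0" and \<rho> :: "complex^4 \<Rightarrow> 'f^2^2"
  assumes K: "number_field K" and ab: "a \<in> K" "b \<in> K" "a \<noteq> 0" "b \<noteq> 0"
    and \<sigma>: "\<sigma> \<in> embeddings K" and emb: "matrix_embedding K a b \<sigma> \<rho>"
begin

sublocale complex_subring_hom K \<sigma>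
  using number_field_subring[OF K] \<sigma>
  by (auto simp: complex_subring_hom_def complex_subring_hom_axioms_def ring_hom_on_def embeddings_def)

lemma inverse_mem: "x \<in> K \<Longrightarrow> inverse x \<in> K" and divide_mem: "x \<in> K \<Longrightarrow> y \<in> K \<Longrightarrow> x / y \<in> K"
  using K by (auto simp: number_field_def divide_inverse)

lemma v_eq_0_iff: "x \<in> K \<Longrightarrow> \<sigma> x = 0 \<longleftrightarrow> x = 0"
  using v_nonzero inverse_mem v_zero by blast

lemma v_inj: "x \<in> K \<Longrightarrow> y \<in> K \<Longrightarrow> \<sigma> x = \<sigma> y \<Longrightarrow> x = y"
  using v_eq_0_iff[of "x - y"] v_diff[of x y] diff_mem by simp

lemma v_ab: "\<sigma> a \<noteq> 0" "\<sigma> b \<noteq> 0" using ab v_eq_0_iff by auto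

lemma qalg_closed:
  assumes "x \<in> qalg K" "y \<in> qalg K"
  shows "x + y \<in> qalg K" "qmult a b x y \<in> qalg K" "c \<in> K \<Longrightarrow> c *s x \<in> qalg K"
  using assms ab by (auto simp: mem_qalg qmult_def intro!: add_mem mult_mem diff_mem)

lemma rho_add: "x \<in> qalg K \<Longrightarrow> y \<in> qalg K \<Longrightarrow> \<rho> (x + y) = \<rho> x + \<rho> y"
  and rho_mult: "x \<in> qalg K \<Longrightarrow> y \<in> qalg K \<Longrightarrow> \<rho> (qmult a b x y) = \<rho> x ** \<rho> y"
  and rho_scalar: "c \<in> K \<Longrightarrow> \<rho> (c *s qone) = mat (\<sigma> c)"
  using emb by (auto simp: matrix_embedding_def inj_on_def)

lemma qone_mem: "qone \<in> qalg K" by (simp add: mem_qalg qone_def one_mem zero_mem)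

lemma rho_one: "\<rho> qone = mat 1" using rho_scalar[OF one_mem] by (simp add: v_one)

lemma rho_smult: assumes "c \<in> K" "x \<in> qalg K" shows "\<rho> (c *s x) = mat (\<sigma> c) ** \<rho> x"
proof -
  have "c *s x = qmult a b (c *s qone) x" by (simp add: quat_simps)
  then show ?thesis using rho_mult[OF qalg_closed(3)[OF qone_mem qone_mem assms(1)] assms(2)] rho_scalar[OF assms(1)] by simp
qed

definition "eI = (quat 0 1 0 0 :: complex^4)"
definition "eJ = (quat 0 0 1 0 :: complex^4)"
definition "eK = (quat 0 0 0 1 :: complex^4)"

lemma e_mem: "eI \<in> qalg K" "eJ \<in> qalg K" "eK \<in> qalg K"
  by (simp_all add: mem_qalg eI_def eJ_def eK_def one_mem zero_mem)

lemma rho_minus: assumes "x \<in> qalg K" shows "\<rho> (- x) = - \<rho> x"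
proof -
  have "- x = (-1) *s x" by (simp add: vec_eq_iff)
  then show ?thesis using rho_smult[of "-1" x] assms uminus_mem[OF one_mem] v_minus[OF one_mem] v_one
    by (simp add: matrix2_simps)
qed

lemma e_squares: "\<rho> eI ** \<rho> eI = mat (\<sigma> a)" "\<rho> eJ ** \<rho> eJ = mat (\<sigma> b)" "\<rho> eK ** \<rho> eK = mat (\<sigma> (- (a * b)))"
proof -
  have "qmult a b eI eI = a *s qone" "qmult a b eJ eJ = b *s qone" "qmult a b eK eK = (- (a * b)) *s qone"
    by (auto simp: quat_simps eI_def eJ_def eK_def)
  then show "\<rho> eI ** \<rho> eI = mat (\<sigma> a)" "\<rho> eJ ** \<rho> eJ = mat (\<sigma> b)" "\<rho> eK ** \<rho> eK = mat (\<sigma> (- (a * b)))"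
    using rho_mult e_mem rho_scalar ab uminus_mem mult_mem by metis+
qed

lemma trace_e: "trace (\<rho> eI) = 0" "trace (\<rho> eJ) = 0" "trace (\<rho> eK) = 0"
proof -
  have "qmult a b eI eJ = - qmult a b eJ eI" "qmult a b eJ eI = - qmult a b eI eJ" "qmult a b eK eI = - qmult a b eI eK"
    by (auto simp: quat_simps eI_def eJ_def eK_def)
  then have "\<rho> eI ** \<rho> eJ = - (\<rho> eJ ** \<rho> eI)" "\<rho> eJ ** \<rho> eI = - (\<rho> eI ** \<rho> eJ)" "\<rho> eK ** \<rho> eI = - (\<rho> eI ** \<rho> eK)"
    using rho_mult e_mem rho_minus qalg_closed(2) by metis+
  then show "trace (\<rho> eI) = 0" "trace (\<rho> eJ) = 0" "trace (\<rho> eK) = 0"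
    using trace_zero_of_anticommute e_squares v_ab by blast+
qed

lemma rho_expand:
  assumes "x \<in> qalg K"
  shows "\<rho> x = mat (\<sigma> (x$1)) + mat (\<sigma> (x$2)) ** \<rho> eI + mat (\<sigma> (x$3)) ** \<rho> eJ + mat (\<sigma> (x$4)) ** \<rho> eK"
proof -
  have x: "x = x$1 *s qone + x$2 *s eI + x$3 *s eJ + x$4 *s eK"
    by (simp add: quat_eq_iff qone_def eI_def eJ_def eK_def)
  have K: "x$1 \<in> K" "x$2 \<in> K" "x$3 \<in> K" "x$4 \<in> K" using assms by (auto simp: mem_qalg)
  then have "\<rho> x = \<rho> (x$1 *s qone) + \<rho> (x$2 *s eI) + \<rho> (x$3 *s eJ) + \<rho> (x$4 *s eK)"
    using rho_add qalg_closed e_mem qone_mem x by (metis (no_types, lifting))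
  then show ?thesis using K by (simp add: rho_smult e_mem rho_scalar)
qed

lemma trace_rho: assumes "x \<in> qalg K" shows "trace (\<rho> x) = 2 * \<sigma> (x$1)"
  using trace_e by (subst rho_expand[OF assms]) (simp add: trace_add trace_mat_mult2, simp add: trace2 mat2_nth)

text \<open>The quaternion conjugate of \<open>x\<close>, twice its scalar part minus
  \<open>x\<close>, is sent to the adjugate of \<open>\<rho> x\<close>. The product of
  \<open>x\<close> with its conjugate is the reduced norm, that of a matrix with its adjugate is the
  determinant.\<close>

lemma det_rho: assumes x: "x \<in> qalg K" shows "det (\<rho> x) = \<sigma> (reduced_norm a b x)"
proof -
  let ?y = "2 * x$1 *s qone + - x"
  have xK: "x$1 \<in> K" "x$2 \<in> K" "x$3 \<in> K" "x$4 \<in> K" using x by (auto simp: mem_qalg)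
  have K2: "2 * x$1 \<in> K" unfolding mult_2 using xK by (intro add_mem)
  have mx: "- x \<in> qalg K" using xK by (simp add: mem_qalg uminus_mem)
  have N: "reduced_norm a b x \<in> K" using xK ab
    by (auto simp: reduced_norm_def power2_eq_square intro!: add_mem mult_mem diff_mem)
  have "\<sigma> (2 * x$1) = 2 * \<sigma> (x$1)" unfolding mult_2 using v_add[OF xK(1) xK(1)] .
  then have "\<rho> ?y = adj2 (\<rho> x)"
    using rho_add[OF qalg_closed(3)[OF qone_mem qone_mem K2] mx] K2 x
    by (simp add: rho_scalar rho_minus adj2_def trace_rho)
  moreover have "qmult a b x ?y = reduced_norm a b x *s qone"
    by (simp add: quat_simps reduced_norm_def power2_eq_square)
  moreover have "\<rho> (qmult a b x ?y) = \<rho> x ** \<rho> ?y"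
    using x mx K2 by (intro rho_mult qalg_closed qone_mem)
  ultimately have "mat (\<sigma> (reduced_norm a b x)) = \<rho> x ** adj2 (\<rho> x)"
    using rho_scalar[OF N] by simp
  also have "\<dots> = mat (det (\<rho> x))" by (rule mult_adj2)
  finally show ?thesis by (simp add: matrix2_simps)
qed

text \<open>The sum of \<open>e Y e\<^sup>-\<^sup>1\<close> over the basis elements \<open>e = 1, i, j, ij\<close>, which averages \<open>Y\<close> into
  the centre.\<close>

definition conj_sum :: "'f^2^2 \<Rightarrow> 'f^2^2" where
  "conj_sum Y = Y + mat (inverse (\<sigma> a)) ** (\<rho> eI ** Y ** \<rho> eI) + mat (inverse (\<sigma> b)) ** (\<rho> eJ ** Y ** \<rho> eJ)
     - mat (inverse (\<sigma> a * \<sigma> b)) ** (\<rho> eK ** Y ** \<rho> eK)"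

text \<open>Each of \<open>i\<close>, \<open>j\<close>, \<open>ij\<close> commutes with two of the
  four basis elements and anticommutes with the other two, so the sum kills it. The scalar part,
  half the trace, is counted four times.\<close>

lemma conj_sum_rho:
  assumes x: "x \<in> qalg K"
  shows "conj_sum (\<rho> x) = mat (2 * trace (\<rho> x))"
proof -
  let ?q = "qmult a b"
  let ?u = "?q (?q eI x) eI" and ?v = "?q (?q eJ x) eJ" and ?w = "?q (?q eK x) eK"
  let ?c = "- inverse (a * b)"
  let ?z = "x + (inverse a *s ?u + (inverse b *s ?v + ?c *s ?w))"
  have xK: "x$1 \<in> K" "x$2 \<in> K" "x$3 \<in> K" "x$4 \<in> K" using x by (auto simp: mem_qalg)
  have abK: "a * b \<in> K" "inverse (a * b) \<in> K" using ab by (auto intro!: inverse_mem mult_mem simp del: inverse_mult_distrib)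
  have iK: "inverse a \<in> K" "inverse b \<in> K" "?c \<in> K"
    using ab abK by (auto intro!: inverse_mem uminus_mem simp del: inverse_mult_distrib)
  have v: "\<sigma> (inverse a) = inverse (\<sigma> a)" "\<sigma> (inverse b) = inverse (\<sigma> b)" "\<sigma> ?c = - inverse (\<sigma> a * \<sigma> b)"
    using v_inverse[of a] v_inverse[of b] v_inverse[of "a * b"] v_minus[of "inverse (a * b)"] v_mult[of a b] ab iK abK by metis+
  have q: "?u \<in> qalg K" "?v \<in> qalg K" "?w \<in> qalg K" by (rule qalg_closed(2)[OF qalg_closed(2)[OF _ x]]; rule e_mem)+
  have r: "\<rho> ?u = \<rho> eI ** \<rho> x ** \<rho> eI" "\<rho> ?v = \<rho> eJ ** \<rho> x ** \<rho> eJ" "\<rho> ?w = \<rho> eK ** \<rho> x ** \<rho> eK"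
    using x e_mem rho_mult qalg_closed(2) by metis+
  have z: "?z = (4 * x$1) *s qone"
    using ab by (simp add: quat_eq_iff qmult_def qone_def eI_def eJ_def eK_def field_simps)
  have "\<rho> ?z = \<rho> x + (\<rho> (inverse a *s ?u) + (\<rho> (inverse b *s ?v) + \<rho> (?c *s ?w)))"
    using rho_add qalg_closed(1) qalg_closed(3)[OF q(1) q(1) iK(1)] qalg_closed(3)[OF q(2) q(2) iK(2)]
      qalg_closed(3)[OF q(3) q(3) iK(3)] x by metis
  also have "\<dots> = \<rho> x + (mat (inverse (\<sigma> a)) ** (\<rho> eI ** \<rho> x ** \<rho> eI) + (mat (inverse (\<sigma> b)) ** (\<rho> eJ ** \<rho> x ** \<rho> eJ)
      + mat (- inverse (\<sigma> a * \<sigma> b)) ** (\<rho> eK ** \<rho> x ** \<rho> eK)))"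
    by (simp only: rho_smult[OF iK(1) q(1)] rho_smult[OF iK(2) q(2)] rho_smult[OF iK(3) q(3)] v r)
  also have "\<dots> = conj_sum (\<rho> x)"
    unfolding conj_sum_def by (simp add: matrix2_eq_iff matrix2_mult_nth[of "mat _"] mat2_nth)
  finally have cz: "\<rho> ?z = conj_sum (\<rho> x)" .
  have "4 * x$1 \<in> K" "\<sigma> (4 * x$1) = 4 * \<sigma> (x$1)"
    using xK v_mult[of 4 "x$1"] v_of_nat[of 4] of_nat_mem[of 4] by (auto intro: mult_mem)
  then have "\<rho> ?z = mat (4 * \<sigma> (x$1))" unfolding z by (simp add: rho_scalar)
  then show ?thesis unfolding cz by (simp add: trace_rho[OF x])
qed

lemma conj_sum_linear:
  "conj_sum (X + Y) = conj_sum X + conj_sum Y" "conj_sum (mat c ** X) = mat c ** conj_sum X"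
proof -
  have 1: "P ** (X + Y) ** P = P ** X ** P + P ** Y ** P" for P X Y :: "'f^2^2"
    by (simp add: matrix_add_ldistrib matrix2_add_mult)
  have 2: "P ** (mat c ** X) ** P = mat c ** (P ** X ** P)" for P X :: "'f^2^2" and c
    by (metis mat_mult_commute2 matrix_mul_assoc)
  show "conj_sum (X + Y) = conj_sum X + conj_sum Y"
    unfolding conj_sum_def 1 by (simp add: matrix_add_ldistrib)
  show "conj_sum (mat c ** X) = mat c ** conj_sum X"
    unfolding conj_sum_def 2 by (simp add: matrix2_eq_iff matrix2_mult_nth[of "mat _"] mat2_nth algebra_simps)
qed

lemma prod_hom: "(\<And>i. i \<in> I \<Longrightarrow> f i \<in> K) \<Longrightarrow> \<sigma> (prod f I) = (\<Prod>i\<in>I. \<sigma> (f i))"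
  by (induction I rule: infinite_finite_induct) (auto simp: v_one v_mult prod_mem)

lemma of_int_mem: "of_int n \<in> K"
  by (cases n) (simp_all add: of_nat_mem uminus_mem del: of_nat_Suc)

lemma det_mem: fixes W :: "complex^'n^'n" assumes "\<And>i j. W$i$j \<in> K" shows "det W \<in> K"
  unfolding det_def using assms by (intro sum_mem mult_mem of_int_mem prod_mem)

lemma det_hom: fixes W :: "complex^'n^'n" assumes "\<And>i j. W$i$j \<in> K" shows "\<sigma> (det W) = det (\<chi> i j. \<sigma> (W$i$j))"
  unfolding det_def using assms
  by (simp add: v_sum v_mult prod_hom v_of_int of_int_mem prod_mem mult_mem)

end

text \<open>If the image of \<open>a\<close> had a real square root, then \<open>sqrt a + i\<close>
  would have norm 0 without being 0, so it could not be invertible; likewise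
  \<open>sqrt b + j\<close>.\<close>

lemma ramified_neg:
  assumes "ramified_at a b v" shows "v a < 0" "v b < 0"
proof -
  have inv: "\<exists>y. qmult (v a) (v b) x y = qone" if "x \<noteq> 0" for x using assms that by (auto simp: ramified_at_def)
  show "v a < 0"
  proof (rule ccontr)
    assume "\<not> v a < 0"
    then have s: "sqrt (v a) * sqrt (v a) = v a" by simp
    have "quat (sqrt (v a)) 1 0 0 \<noteq> 0" by (simp add: quat_eq_iff)
    then obtain y where "qmult (v a) (v b) (quat (sqrt (v a)) 1 0 0) y = qone" using inv by blast
    then have "sqrt (v a) * y$1 + v a * y$2 = 1" "sqrt (v a) * y$2 + y$1 = 0" by (auto simp: quat_eq_iff qmult_def qone_def)
    then show False using s by (metis (no_types, lifting) distrib_left mult.assoc add.commute mult_zero_right zero_neq_one)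
  qed
  show "v b < 0"
  proof (rule ccontr)
    assume "\<not> v b < 0"
    then have s: "sqrt (v b) * sqrt (v b) = v b" by simp
    have "quat (sqrt (v b)) 0 1 0 \<noteq> 0" by (simp add: quat_eq_iff)
    then obtain y where "qmult (v a) (v b) (quat (sqrt (v b)) 0 1 0) y = qone" using inv by blast
    then have "sqrt (v b) * y$1 + v b * y$3 = 1" "sqrt (v b) * y$3 + y$1 = 0" by (auto simp: quat_eq_iff qmult_def qone_def)
    then show False using s by (metis (no_types, lifting) distrib_left mult.assoc add.commute mult_zero_right zero_neq_one)
  qed
qed

context quaternion_rep
begin

text \<open>Conjugation by \<open>A\<close> maps the algebra to itself, although \<open>A\<close>
  may lie outside its image. Its trace is tr(A) tr(A^-1), and its matrix in the basis 1, i, j, ij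
  has entries in \<open>K\<close>. At a ramified place it preserves a definite diagonal form, so
  each of the four diagonal entries is at most 1 in absolute value; this gives the bound 4.\<close>

lemma trace_sq_in_field:
  fixes A :: "'f^2^2" and w :: "4 \<Rightarrow> complex^4"
  assumes A: "det A = 1" and w: "\<And>k. w k \<in> qalg K"
    and indep: "\<And>d. (\<Sum>k\<in>UNIV. mat (d k) ** \<rho> (w k)) = 0 \<Longrightarrow> \<forall>k. d k = 0"
    and conj: "\<And>k. \<exists>y\<in>qalg K. A ** \<rho> (w k) ** adj2 A = \<rho> y"
  shows "\<exists>x\<in>K. \<sigma> x = (trace A)\<^sup>2 \<and> (\<forall>v\<in>embeddings K. ramified_at a b v \<longrightarrow> \<bar>v x\<bar> \<le> 4)"
proof -
  let ?n = "\<lambda>k. \<rho> (w k)"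
  have wK: "w k $ i \<in> K" for k i using w by (simp add: qalg_def)
  have comb: "(\<Sum>k\<in>UNIV. mat (d k) ** ?n k) $ i $ j = (\<Sum>k\<in>UNIV. d k * ?n k $ i $ j)" for d i j
    by (simp add: mat_mult_nth2)
  \<comment> \<open>The columns list the entries of the four matrices; invertibility turns linear
    independence into spanning the whole matrix ring.\<close>
  define P :: "'f^4^4" where "P = (\<chi> i k. quat (?n k $1$1) (?n k $1$2) (?n k $2$1) (?n k $2$2) $ i)"
  have Pd: "(\<Sum>k\<in>UNIV. mat (d$k) ** ?n k)$1$1 = (P *v d)$1" "(\<Sum>k\<in>UNIV. mat (d$k) ** ?n k)$1$2 = (P *v d)$2"
    "(\<Sum>k\<in>UNIV. mat (d$k) ** ?n k)$2$1 = (P *v d)$3" "(\<Sum>k\<in>UNIV. mat (d$k) ** ?n k)$2$2 = (P *v d)$4" for d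
    unfolding comb by (auto simp: matrix_vector_mult_def P_def intro!: sum.cong)
  have "P *v d = 0 \<Longrightarrow> d = 0" for d
  proof -
    assume "P *v d = 0"
    then have "(\<Sum>k\<in>UNIV. mat (d$k) ** ?n k) = 0"
      unfolding matrix2_eq_iff Pd by simp
    then have "\<forall>k. d$k = 0" by (rule indep)
    then show "d = 0" by (simp add: vec_eq_iff)
  qed
  then have "\<forall>d. P *v d = 0 \<longrightarrow> d = 0" by simp
  then obtain Q where Q: "Q ** P = mat 1" using iffD2[OF matrix_left_invertible_ker[of P]] by metis
  then have PQ: "P ** Q = mat 1" using matrix_left_right_inverse by blast
  have span: "\<exists>d. Z = (\<Sum>k\<in>UNIV. mat (d k) ** ?n k)" for Z
  proof -
    define d where "d = Q *v quat (Z$1$1) (Z$1$2) (Z$2$1) (Z$2$2)"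
    have "P *v d = quat (Z$1$1) (Z$1$2) (Z$2$1) (Z$2$2)"
      unfolding d_def by (simp add: matrix_vector_mul_assoc PQ)
    then have "Z = (\<Sum>k\<in>UNIV. mat (d$k) ** ?n k)"
      unfolding matrix2_eq_iff Pd by simp
    then show ?thesis by blast
  qed
  \<comment> \<open>Both sides are linear in \<open>Z\<close> and agree on the spanning set. The
    identity is applied below to \<open>adj2 A\<close>, which may lie outside the image of the
    algebra.\<close>
  have conj_sum: "conj_sum Z = mat (2 * trace Z)" for Z
  proof -
    obtain d where d: "Z = (\<Sum>k\<in>UNIV. mat (d k) ** ?n k)" using span by blast
    have "conj_sum Z = (\<Sum>k\<in>UNIV. mat (d k) ** mat (2 * trace (?n k)))"
      unfolding d sum_4 by (simp only: conj_sum_linear conj_sum_rho[OF w])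
    also have "\<dots> = mat (2 * trace Z)"
      unfolding d sum_4 by (simp add: trace_add trace_mat_mult2 mat_mult_mat2) (simp add: matrix2_eq_iff mat2_nth algebra_simps)
    finally show ?thesis .
  qed
  \<comment> \<open>The coordinates of the \<open>w k\<close> in the standard basis. A vanishing
    determinant would, after applying \<open>\<sigma>\<close>, yield a linear relation between the
    \<open>\<rho> (w k)\<close>.\<close>
  define W :: "complex^4^4" where "W = (\<chi> i k. w k $ i)"
  have WK: "W$i$j \<in> K" for i j by (simp add: W_def wK)
  have detW: "det W \<noteq> 0"
  proof
    assume "det W = 0"
    then have "det (\<chi> i j. \<sigma> (W$i$j)) = 0" using det_hom[of W] WK v_zero by simp
    then have "\<not> invertible (\<chi> i j. \<sigma> (W$i$j))" by (simp add: invertible_det_nz)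
    then obtain d where d: "(\<chi> i j. \<sigma> (W$i$j)) *v d = 0" "d \<noteq> 0"
      unfolding invertible_left_inverse matrix_left_invertible_ker by metis
    have e: "(\<Sum>k\<in>UNIV. d$k * \<sigma> (w k $ i)) = 0" for i
    proof -
      have "((\<chi> i j. \<sigma> (W$i$j)) *v d)$i = (\<Sum>k\<in>UNIV. d$k * \<sigma> (w k $ i))"
        unfolding matrix_vector_mult_def W_def by (auto intro!: sum.cong)
      then show ?thesis by (simp add: d(1))
    qed
    have "(\<Sum>k\<in>UNIV. mat (d$k) ** ?n k) $ i $ j = 0" for i j
    proof -
      have "?n k $ i $ j = \<sigma> (w k $ 1) * mat 1 $i$j + \<sigma> (w k $ 2) * \<rho> eI $i$j + \<sigma> (w k $ 3) * \<rho> eJ $i$j + \<sigma> (w k $ 4) * \<rho> eK $i$j" for k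
        by (subst rho_expand[OF w]) (use exhaust_2[of i] exhaust_2[of j] in \<open>auto simp: matrix2_mult_nth mat2_nth\<close>)
      then have "(\<Sum>k\<in>UNIV. mat (d$k) ** ?n k) $ i $ j =
        (\<Sum>k\<in>UNIV. d$k * \<sigma> (w k $ 1)) * mat 1 $i$j + (\<Sum>k\<in>UNIV. d$k * \<sigma> (w k $ 2)) * \<rho> eI $i$j
        + (\<Sum>k\<in>UNIV. d$k * \<sigma> (w k $ 3)) * \<rho> eJ $i$j + (\<Sum>k\<in>UNIV. d$k * \<sigma> (w k $ 4)) * \<rho> eK $i$j"
        unfolding comb by (simp add: sum_4 algebra_simps)
      then show ?thesis by (simp add: e)
    qed
    then have "(\<Sum>k\<in>UNIV. mat (d$k) ** ?n k) = 0" by (simp add: matrix2_eq_iff)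
    then have "\<forall>k. d$k = 0" by (rule indep)
    then show False using d(2) by (simp add: vec_eq_iff)
  qed
  have conj_all: "\<exists>y\<in>qalg K. A ** \<rho> x ** adj2 A = \<rho> y" if x: "x \<in> qalg K" for x
  proof -
    have xK: "x$i \<in> K" for i using x by (simp add: qalg_def)
    \<comment> \<open>Cramer's rule keeps the coefficients of \<open>x\<close> with respect to the
      \<open>w k\<close> inside \<open>K\<close>.\<close>
    define c where "c = (\<chi> k. det (\<chi> i j. if j = k then x$i else W$i$j) / det W)"
    have cK: "c$k \<in> K" for k unfolding c_def using WK xK by (auto intro!: divide_mem det_mem)
    have "W *v c = x" using cramer[OF detW] c_def by blast
    then have xc: "x = (\<Sum>k\<in>UNIV. c$k *s w k)"
    proof (subst vec_eq_iff, intro allI)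
      fix i
      have "(W *v c)$i = (\<Sum>k\<in>UNIV. c$k *s w k)$i"
        unfolding matrix_vector_mult_def W_def by (auto intro!: sum.cong)
      then show "x$i = (\<Sum>k\<in>UNIV. c$k *s w k)$i" using \<open>W *v c = x\<close> by simp
    qed
    obtain y where y: "\<And>k. y k \<in> qalg K" "\<And>k. A ** \<rho> (w k) ** adj2 A = \<rho> (y k)" using conj by metis
    have cw: "c$k *s w k \<in> qalg K" "c$k *s y k \<in> qalg K" for k using cK w y qalg_closed(3) by blast+
    have scal: "A ** (mat t ** X) ** adj2 A = mat t ** (A ** X ** adj2 A)" for t X
      by (metis mat_mult_commute2 matrix_mul_assoc)
    have "\<rho> x = (\<Sum>k\<in>UNIV. mat (\<sigma> (c$k)) ** \<rho> (w k))"
      unfolding xc sum_4 using cw cK w by (simp add: rho_add qalg_closed(1) rho_smult)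
    then have "A ** \<rho> x ** adj2 A = (\<Sum>k\<in>UNIV. mat (\<sigma> (c$k)) ** \<rho> (y k))"
      unfolding sum_4 by (simp add: matrix_add_ldistrib matrix2_add_mult scal y)
    also have "\<dots> = \<rho> (\<Sum>k\<in>UNIV. c$k *s y k)"
      unfolding sum_4 using cw cK y by (simp add: rho_add qalg_closed(1) rho_smult)
    finally show ?thesis unfolding sum_4 using cw qalg_closed(1) by blast
  qed
  have adjA: "adj2 A ** A = mat 1" "A ** adj2 A = mat 1" using A by (simp_all add: mult_adj2)
  have norm: "reduced_norm a b y = reduced_norm a b x"
    if "x \<in> qalg K" "y \<in> qalg K" "A ** \<rho> x ** adj2 A = \<rho> y" for x y
  proof -
    have "det (\<rho> y) = det (\<rho> x)" using that(3) A by (metis det_adj2 det_mul mult.right_neutral mult_1)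
    moreover have "reduced_norm a b z \<in> K" if "z \<in> qalg K" for z using that ab
      by (auto simp: mem_qalg reduced_norm_def power2_eq_square intro!: add_mem mult_mem diff_mem)
    ultimately show ?thesis using that v_inj by (simp add: det_rho)
  qed
  obtain yI yJ yK where y: "yI \<in> qalg K" "yJ \<in> qalg K" "yK \<in> qalg K"
    "A ** \<rho> eI ** adj2 A = \<rho> yI" "A ** \<rho> eJ ** adj2 A = \<rho> yJ" "A ** \<rho> eK ** adj2 A = \<rho> yK"
    using conj_all e_mem by metis
  have yK: "yI$i \<in> K" "yJ$i \<in> K" "yK$i \<in> K" for i using y by (auto simp: qalg_def)
  \<comment> \<open>The sum of the diagonal entries of the conjugation in the basis 1, i, j, ij; the
    first entry is 1 because 1 is fixed.\<close>
  define x where "x = 1 + yI$2 + yJ$3 + yK$4"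
  have xK: "x \<in> K" unfolding x_def using yK by (intro add_mem one_mem)
  have tr: "trace (\<rho> y ** \<rho> e) = 2 * \<sigma> (qmult a b y e $ 1)" if "y \<in> qalg K" "e \<in> qalg K" for y e
    using that trace_rho[of "qmult a b y e"] rho_mult qalg_closed(2) by simp
  have t: "trace (\<rho> yI ** \<rho> eI) = 2 * (\<sigma> a * \<sigma> (yI$2))" "trace (\<rho> yJ ** \<rho> eJ) = 2 * (\<sigma> b * \<sigma> (yJ$3))"
     "trace (\<rho> yK ** \<rho> eK) = - 2 * (\<sigma> a * \<sigma> b * \<sigma> (yK$4))"
    using tr[OF y(1) e_mem(1)] tr[OF y(2) e_mem(2)] tr[OF y(3) e_mem(3)] yK ab
    by (simp_all add: qmult_def eI_def eJ_def eK_def v_mult v_minus mult_mem)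
  \<comment> \<open>The right-hand side is the sum of the traces of \<open>A e A^-1 e^-1\<close>
    over the four basis elements \<open>e\<close>, and each of these is twice a diagonal entry of
    the conjugation.\<close>
  have "2 * (trace A)\<^sup>2 = trace (A ** conj_sum (adj2 A))"
    unfolding conj_sum mat_mult_commute2 trace_mat_mult2 by (simp add: power2_eq_square)
  also have "\<dots> = trace (A ** adj2 A) + inverse (\<sigma> a) * trace (\<rho> yI ** \<rho> eI) + inverse (\<sigma> b) * trace (\<rho> yJ ** \<rho> eJ)
     - inverse (\<sigma> a * \<sigma> b) * trace (\<rho> yK ** \<rho> eK)"
  proof -
    have "A ** (X - Y) = A ** X - A ** Y" for X Y :: "'f^2^2" by (simp add: matrix2_simps algebra_simps)
    moreover have "A ** (mat t ** (E ** Z ** E)) = mat t ** (A ** E ** Z ** E)" for t and E Z :: "'f^2^2"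
      by (metis mat_mult_commute2 matrix_mul_assoc)
    ultimately show ?thesis
      unfolding conj_sum_def by (simp only: matrix_add_ldistrib trace_add trace_sub trace_mat_mult2 y(4-6))
  qed
  also have "\<dots> = 2 * \<sigma> x"
    unfolding t adjA x_def using v_ab yK by (simp add: trace2 mat2_nth v_add v_one one_mem add_mem field_simps)
  finally have "\<sigma> x = (trace A)\<^sup>2" by simp
  moreover have "\<bar>v x\<bar> \<le> 4" if v: "v \<in> embeddings K" "ramified_at a b v" for v :: "complex \<Rightarrow> real"
  proof -
    interpret v: complex_subring_hom K v
      using v by unfold_locales (auto simp: ring_hom_on_def embeddings_def)
    note neg = ramified_neg[OF v(2)]
    have nv: "v (reduced_norm a b z) = (v (z$1))\<^sup>2 + (- v a) * (v (z$2))\<^sup>2 + (- v b) * (v (z$3))\<^sup>2 + (v a * v b) * (v (z$4))\<^sup>2"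
      if "z \<in> qalg K" for z
      using that ab by (simp add: mem_qalg reduced_norm_def power2_eq_square v.v_add v.v_diff v.v_mult add_mem diff_mem mult_mem)
    have pos: "v a * v b > 0" "- v a > 0" "- v b > 0" using neg by (auto simp: mult_neg_neg)
    have le1: "\<bar>t\<bar> \<le> 1" if "c * t\<^sup>2 \<le> c" "c > 0" for c t :: real
      using that by (simp add: abs_square_le_1 mult_le_cancel_left1)
    \<comment> \<open>Conjugation preserves the reduced norm, so the image of \<open>i\<close> has
      norm \<open>- a\<close>. All four terms of the norm form are nonnegative at \<open>v\<close>,
      and the term of the \<open>i\<close>-coordinate is at most the whole.\<close>
    have I: "\<bar>v (yI$2)\<bar> \<le> 1"
    proof (rule le1[of "- v a"])
      have "v (reduced_norm a b yI) = - v a" using norm[OF e_mem(1) y(1,4)] ab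
        by (simp add: eI_def reduced_norm_def v.v_minus)
      then show "- v a * (v (yI $ 2))\<^sup>2 \<le> - v a" unfolding nv[OF y(1)] using pos
        by (smt (verit) mult_nonneg_nonneg zero_le_power2)
    qed (use pos in simp)
    have J: "\<bar>v (yJ$3)\<bar> \<le> 1"
    proof (rule le1[of "- v b"])
      have "v (reduced_norm a b yJ) = - v b" using norm[OF e_mem(2) y(2,5)] ab
        by (simp add: eJ_def reduced_norm_def v.v_minus)
      then show "- v b * (v (yJ $ 3))\<^sup>2 \<le> - v b" unfolding nv[OF y(2)] using pos
        by (smt (verit) mult_nonneg_nonneg zero_le_power2)
    qed (use pos in simp)
    have K: "\<bar>v (yK$4)\<bar> \<le> 1"
    proof (rule le1[of "v a * v b"])
      have "v (reduced_norm a b yK) = v a * v b" using norm[OF e_mem(3) y(3,6)] ab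
        by (simp add: eK_def reduced_norm_def v.v_mult)
      then show "v a * v b * (v (yK $ 4))\<^sup>2 \<le> v a * v b" unfolding nv[OF y(3)] using pos
        by (smt (verit) mult_nonneg_nonneg zero_le_power2)
    qed (use pos in simp)
    have "v x = 1 + v (yI$2) + v (yJ$3) + v (yK$4)"
      unfolding x_def using yK by (simp add: v.v_add v.v_one one_mem add_mem)
    then show ?thesis using I J K by linarith
  qed
  ultimately show ?thesis using xK by blast
qed

end

section \<open>Powers and eigenvalues of matrices\<close>

definition mpow :: "'a::comm_ring_1^2^2 \<Rightarrow> nat \<Rightarrow> 'a^2^2" where
  "mpow A n = ((**) A ^^ n) (mat 1)"

lemma mpow_0 [simp]: "mpow A 0 = mat 1" and mpow_Suc: "mpow A (Suc n) = A ** mpow A n"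
  by (simp_all add: mpow_def)

lemma mpow_add: "mpow A (m + n) = mpow A m ** mpow A n"
  by (induction m) (simp_all add: mpow_Suc matrix_mul_assoc)

lemma mpow_mult: "mpow A (m * n) = mpow (mpow A m) n"
  by (induction n) (simp_all add: mpow_Suc mpow_add)

lemma mpow_uminus: "mpow (- A) n = mpow A n \<or> mpow (- A) n = - mpow A n"
  by (induction n) (auto simp: mpow_Suc matrix2_simps)

lemma det_mpow: "det A = 1 \<Longrightarrow> det (mpow A n) = 1"
  by (induction n) (auto simp: mpow_Suc det_mul)

lemma mpow_conj:
  assumes "det P = 1"
  shows "mpow (P ** A ** adj2 P) n = P ** mpow A n ** adj2 P"
proof (induction n)
  case (Suc n)
  have "P ** A ** adj2 P ** (P ** mpow A n ** adj2 P) = P ** A ** (adj2 P ** P) ** mpow A n ** adj2 P"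
    by (simp add: matrix_mul_assoc)
  then show ?case using Suc assms by (simp add: mpow_Suc mult_adj2 matrix_mul_assoc)
qed (use assms in \<open>simp add: mult_adj2\<close>)

definition mat22 :: "'a \<Rightarrow> 'a \<Rightarrow> 'a \<Rightarrow> 'a \<Rightarrow> 'a::zero^2^2" where
  "mat22 a b c d = vector [vector [a, b], vector [c, d]]"

lemma mat22_nth [simp]: "mat22 a b c d $1$1 = a" "mat22 a b c d $1$2 = b" "mat22 a b c d $2$1 = c" "mat22 a b c d $2$2 = d"
  by (simp_all add: mat22_def)

lemma mat22_mult: "mat22 a b c d ** mat22 a' b' c' d' = mat22 (a*a' + b*c') (a*b' + b*d') (c*a' + d*c') (c*b' + d*d')"
  for a :: "'a::comm_ring_1"
  by (simp add: matrix2_simps)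

lemma mpow_diag: "mpow (mat22 a 0 0 d) n = mat22 (a ^ n) 0 0 (d ^ n)"
  by (induction n) (simp_all add: mpow_Suc matrix2_simps)

lemma diagonalise:
  fixes A :: "'f::field_char_0^2^2"
  assumes det: "det A = 1" and tr: "trace A = u + inverse u" and u: "u \<noteq> 0" "u\<^sup>2 \<noteq> 1"
  shows "\<exists>P. det P = 1 \<and> A = P ** mat22 u 0 0 (inverse u) ** adj2 P"
proof -
  define a b c d where "a = A$1$1" "b = A$1$2" "c = A$2$1" "d = A$2$2"
  note abcd = a_b_c_d_def
  have ad: "a * d - b * c = 1" "a + d = u + inverse u" using det tr by (simp_all add: abcd det_2 trace2)
  have uu: "u \<noteq> inverse u" using u by (auto simp: power2_eq_square field_simps)
  have "\<exists>Q. det Q \<noteq> 0 \<and> A ** Q = Q ** mat22 u 0 0 (inverse u)"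
  proof (cases "c = 0")
    case False
    \<comment> \<open>The columns are eigenvectors for \<open>u\<close> and
      \<open>inverse u\<close>.\<close>
    let ?Q = "mat22 (u - d) (inverse u - d) c c"
    have "det ?Q = c * (u - inverse u)" by (simp add: det_2 algebra_simps)
    moreover have "A ** ?Q = ?Q ** mat22 u 0 0 (inverse u)"
    proof -
      have "a * (u - d) + b * c = (u - d) * u" "a * (inverse u - d) + b * c = (inverse u - d) * inverse u"
      proof -
        have a: "a = u + inverse u - d" using ad(2) by (simp add: algebra_simps)
        have bc: "b * c = a * d - 1" using ad(1) by (simp add: algebra_simps)
        show "a * (u - d) + b * c = (u - d) * u" unfolding bc a using u by (simp add: field_simps)
        show "a * (inverse u - d) + b * c = (inverse u - d) * inverse u" unfolding bc a using u by (simp add: field_simps)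
      qed
      then show ?thesis by (simp add: matrix2_simps abcd) (simp add: algebra_simps)
    qed
    ultimately show ?thesis using False uu by (intro exI[of _ ?Q]) auto
  next
    case True
    then have ad1: "a * d = 1" using ad by simp
    then have "d = inverse a" by (metis inverse_unique)
    have "(a - u) * (a - inverse u) = 0"
    proof -
      have "a * (u + inverse u) = a * a + 1" unfolding ad(2)[symmetric] distrib_left ad1 ..
      moreover have "(a - u) * (a - inverse u) = a * a - a * (u + inverse u) + 1" using u by (simp add: algebra_simps)
      ultimately show ?thesis by simp
    qed
    then consider "a = u" "d = inverse u" | "a = inverse u" "d = u" using \<open>d = inverse a\<close> by auto
    then show ?thesis
    proof cases
      case 1
      then show ?thesis using uu True u
        by (intro exI[of _ "mat22 1 b 0 (d - a)"]) (auto simp: matrix2_simps abcd algebra_simps)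
    next
      case 2
      then show ?thesis using uu True u
        by (intro exI[of _ "mat22 b 1 (d - a) 0"]) (auto simp: matrix2_simps abcd algebra_simps)
    qed
  qed
  then obtain Q where Q: "det Q \<noteq> 0" "A ** Q = Q ** mat22 u 0 0 (inverse u)" by blast
  \<comment> \<open>Rescaling the first eigenvector normalises the determinant to 1.\<close>
  define P where "P = Q ** mat22 (inverse (det Q)) 0 0 1"
  have "det P = 1" using Q(1) by (simp add: P_def det_mul) (simp add: det_2)
  have "A ** P = P ** mat22 u 0 0 (inverse u)"
    unfolding P_def matrix_mul_assoc Q(2) by (simp add: matrix_mul_assoc[symmetric] mat22_mult mult.commute)
  then have "P ** mat22 u 0 0 (inverse u) ** adj2 P = A ** (P ** adj2 P)" by (simp add: matrix_mul_assoc)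
  then show ?thesis using \<open>det P = 1\<close> by (intro exI[of _ P]) (simp add: mult_adj2)
qed

section \<open>Integrality of squared traces\<close>

context quaternion_rep
begin

lemma algebraic_int_hom:
  assumes "r \<in> K" shows "algebraic_int (\<sigma> r) \<longleftrightarrow> algebraic_int r"
proof -
  have c: "map_poly of_int p \<in> coeffs_in K" for p
    by (simp add: coeffs_in_def coeff_map_poly of_int_mem)
  have m: "map_poly \<sigma> (map_poly of_int p) = map_poly of_int p" for p
    by (rule poly_eqI) (simp add: coeff_map_poly v_zero v_of_int)
  have "poly (map_poly of_int p) (\<sigma> r) = \<sigma> (poly (map_poly of_int p) r)" for p
    using poly_map_poly[OF c assms, of p] m by simp
  moreover have "poly (map_poly of_int p) r \<in> K" for p by (rule poly_mem[OF c assms])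
  ultimately show ?thesis unfolding algebraic_int_altdef_ipoly using v_eq_0_iff by auto
qed

lemma order_subset: assumes "is_order K a b \<O>" shows "\<O> \<subseteq> qalg K"
proof -
  obtain S where S: "finite S" "S \<subseteq> qalg K" "\<O> = lin_span (ring_of_integers K) S"
    using assms by (auto simp: is_order_def)
  show ?thesis
  proof
    fix x assume "x \<in> \<O>"
    then obtain T c where T: "finite T" "T \<subseteq> S" "c ` T \<subseteq> ring_of_integers K" "x = (\<Sum>v\<in>T. c v *s v)"
      unfolding S(3) lin_span_def by auto
    have "c v * v$n \<in> K" if "v \<in> T" for v n
      using T S(2) that by (auto simp: ring_of_integers_def qalg_def intro!: mult_mem)
    then show "x \<in> qalg K" unfolding T(4) qalg_def by (auto intro!: sum_mem)
  qed
qed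

lemma rho_sum:
  assumes "finite T" "\<And>v. v \<in> T \<Longrightarrow> f v \<in> qalg K"
  shows "\<rho> (sum f T) = (\<Sum>v\<in>T. \<rho> (f v)) \<and> sum f T \<in> qalg K"
  using assms
proof (induction T rule: finite_induct)
  case empty
  have "\<rho> 0 + \<rho> 0 = \<rho> 0" using rho_add[of 0 0] by (simp add: mem_qalg zero_mem)
  then show ?case by (simp add: mem_qalg zero_mem)
qed (auto simp: rho_add qalg_closed)

text \<open>Left multiplication by \<open>x\<close> on generators \<open>s\<close> of the order has
  a matrix over the ring of integers. Since V rho(x s) = nu V rho(s), for each \<open>l\<close> the
  numbers \<open>W l s\<close> satisfy the eigenvector equation of that matrix. Row vectors are used
  because \<open>x\<close> multiplies from the left.\<close>

lemma order_eigenvalue_algebraic_int: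
  fixes V :: "'f^2"
  assumes O: "is_order K a b \<O>" and x: "x \<in> \<O>" and V: "V \<noteq> 0" "V v* \<rho> x = \<nu> *s V"
  shows "algebraic_int \<nu>"
proof -
  obtain S where S: "finite S" "S \<subseteq> qalg K" "\<O> = lin_span (ring_of_integers K) S"
    using O by (auto simp: is_order_def)
  have expand: "\<exists>c. (\<forall>s\<in>S. c s \<in> ring_of_integers K) \<and> y = (\<Sum>s\<in>S. c s *s s)" if y: "y \<in> \<O>" for y
  proof -
    obtain T c where T: "finite T" "T \<subseteq> S" "c ` T \<subseteq> ring_of_integers K" "y = (\<Sum>v\<in>T. c v *s v)"
      using y unfolding S(3) lin_span_def by auto
    let ?c = "\<lambda>s. if s \<in> T then c s else 0"
    have "y = (\<Sum>s\<in>S. ?c s *s s)" unfolding T(4)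
      using S(1) T(2) by (intro sum.mono_neutral_cong_left) auto
    moreover have "\<forall>s\<in>S. ?c s \<in> ring_of_integers K" using T(3) zero_mem by (auto simp: ring_of_integers_def)
    ultimately show ?thesis by (intro exI[of _ ?c] conjI)
  qed
  have SO: "s \<in> \<O>" if "s \<in> S" for s
    unfolding S(3) lin_span_def
    using that one_mem by (intro CollectI exI[of _ "{s}"] exI[of _ "\<lambda>_. 1"]) (auto simp: ring_of_integers_def vec_eq_iff)
  have "\<exists>r. (\<forall>t\<in>S. r t \<in> ring_of_integers K) \<and> qmult a b x s = (\<Sum>t\<in>S. r t *s t)" if "s \<in> S" for s
    using expand O x SO[OF that] by (auto simp: is_order_def)
  then obtain r where r: "\<And>s t. s \<in> S \<Longrightarrow> t \<in> S \<Longrightarrow> r s t \<in> ring_of_integers K"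
    "\<And>s. s \<in> S \<Longrightarrow> qmult a b x s = (\<Sum>t\<in>S. r s t *s t)" by metis
  have rK: "r s t \<in> K" "algebraic_int (\<sigma> (r s t))" if "s \<in> S" "t \<in> S" for s t
    using r(1)[OF that] algebraic_int_hom by (auto simp: ring_of_integers_def)
  have xK: "x \<in> qalg K" using order_subset[OF O] x by auto
  have comb: "\<rho> (\<Sum>t\<in>S. c t *s t) = (\<Sum>t\<in>S. mat (\<sigma> (c t)) ** \<rho> t)" if "\<And>t. t \<in> S \<Longrightarrow> c t \<in> K" for c
  proof -
    have "\<rho> (\<Sum>t\<in>S. c t *s t) = (\<Sum>t\<in>S. \<rho> (c t *s t))"
      using rho_sum[OF S(1), of "\<lambda>t. c t *s t"] S(2) that qalg_closed(3) by blast
    also have "\<dots> = (\<Sum>t\<in>S. mat (\<sigma> (c t)) ** \<rho> t)"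
      using S(2) that by (intro sum.cong) (auto simp: rho_smult)
    finally show ?thesis .
  qed
  define W where "W l s = (V v* \<rho> s) $ l" for l s
  have vsum: "(V v* (\<Sum>t\<in>S. mat (c t) ** \<rho> t)) $ l = (\<Sum>t\<in>S. c t * W l t)" for c l
    unfolding W_def by (simp add: vector_matrix_mult_def sum_2 mat_mult_nth2 sum_distrib_left sum_distrib_right sum.distrib algebra_simps)
  have ev: "\<nu> * W l s = (\<Sum>t\<in>S. \<sigma> (r s t) * W l t)" if "s \<in> S" for l s
  proof -
    have "V v* \<rho> (qmult a b x s) = (V v* \<rho> x) v* \<rho> s"
      using rho_mult[OF xK] S(2) that by (auto simp: vector_matrix_mul_assoc)
    also have "\<dots> $ l = \<nu> * W l s"
      unfolding V(2) W_def by (simp add: vector_matrix_mult_def sum_2 algebra_simps)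
    finally have eq1: "(V v* \<rho> (qmult a b x s)) $ l = \<nu> * W l s" .
    have eq2: "\<rho> (qmult a b x s) = (\<Sum>t\<in>S. mat (\<sigma> (r s t)) ** \<rho> t)"
      unfolding r(2)[OF that] using rK that by (intro comb) auto
    show ?thesis unfolding eq1[symmetric] eq2 by (rule vsum)
  qed
  \<comment> \<open>The unit is a combination of the generators, so \<open>V\<close> is a
    combination of the rows \<open>V v* \<rho> s\<close>; they cannot all vanish.\<close>
  have "\<exists>l. \<exists>s\<in>S. W l s \<noteq> 0"
  proof (rule ccontr)
    assume "\<not> ?thesis"
    then have W0: "W l s = 0" if "s \<in> S" for l s using that by blast
    obtain c where c: "\<And>s. s \<in> S \<Longrightarrow> c s \<in> ring_of_integers K" "qone = (\<Sum>s\<in>S. c s *s s)"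
      using expand[of qone] O by (auto simp: is_order_def)
    have cK: "c s \<in> K" if "s \<in> S" for s using c(1)[OF that] by (simp add: ring_of_integers_def)
    have "mat 1 = (\<Sum>t\<in>S. mat (\<sigma> (c t)) ** \<rho> t)"
      using comb[of c] cK c(2) rho_one by simp
    then have "V = V v* (\<Sum>t\<in>S. mat (\<sigma> (c t)) ** \<rho> t)" by (metis vector_matrix_mul_rid)
    then have "V $ l = (\<Sum>t\<in>S. \<sigma> (c t) * W l t)" for l using vsum[of "\<lambda>t. \<sigma> (c t)" l] by simp
    then have "V = 0" using W0 by (simp add: vec_eq_iff)
    then show False using V by simp
  qed
  then obtain l s where ls: "s \<in> S" "W l s \<noteq> 0" by blast
  show ?thesis
    by (rule algebraic_int_eigenvalue_integral[of S "\<lambda>s t. \<sigma> (r s t)" \<nu> "W l" s]) (use S rK ev ls in auto)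
qed

text \<open>The rows of \<open>adj2 P\<close> are left eigenvectors of \<open>mpow A m\<close> for
  u^m and u^-m, so these are algebraic integers, and therefore so are their \<open>m\<close>-th
  roots \<open>u\<close> and \<open>inverse u\<close>. The sign ambiguity only negates an
  eigenvalue.\<close>

lemma trace_sq_algebraic_int:
  fixes A :: "'f^2^2"
  assumes O: "is_order K a b \<O>" and x: "x \<in> \<O>" "mpow A m = \<rho> x \<or> mpow A m = - \<rho> x" and m: "m > 0"
    and A: "det A = 1" "trace A = u + inverse u" "u \<noteq> 0" "u\<^sup>2 \<noteq> 1"
  shows "algebraic_int ((trace A)\<^sup>2)"
proof -
  obtain P where P: "det P = 1" "A = P ** mat22 u 0 0 (inverse u) ** adj2 P" using diagonalise[OF A] by blast
  have Am: "mpow A m = P ** mat22 (u ^ m) 0 0 (inverse u ^ m) ** adj2 P"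
    unfolding P(2) mpow_conj[OF P(1)] mpow_diag ..
  have row: "adj2 P ** mpow A m = mat22 (u ^ m) 0 0 (inverse u ^ m) ** adj2 P"
    unfolding Am by (simp add: matrix_mul_assoc mult_adj2 P(1))
  have rows: "(adj2 P $ 1) v* mpow A m = u ^ m *s (adj2 P $ 1)" "(adj2 P $ 2) v* mpow A m = inverse u ^ m *s (adj2 P $ 2)"
    using row by (simp_all add: matrix2_eq_iff matrix2_mult_nth vec_eq_iff forall_2 vector_matrix_mult_def sum_2 mult.commute)
  have nz: "adj2 P $ 1 \<noteq> 0" "adj2 P $ 2 \<noteq> 0"
    using det_adj2[of P] P(1) by (auto simp: det_2 simp del: det_adj2)
  have neg: "V v* (- X) = - (V v* X)" for V :: "'f^2" and X :: "'f^2^2"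
    by (simp add: vec_eq_iff vector_matrix_mult_def sum_2)
  have ai: "algebraic_int \<nu>" if "V v* mpow A m = \<nu> *s V" "V \<noteq> 0" for V \<nu>
  proof (cases "mpow A m = \<rho> x")
    case True then show ?thesis using order_eigenvalue_algebraic_int[OF O x(1) that(2)] that(1) by simp
  next
    case False
    then have "\<rho> x = - mpow A m" using x(2) by simp
    then have "V v* \<rho> x = - (V v* mpow A m)" by (simp only: neg)
    then have "V v* \<rho> x = (- \<nu>) *s V" unfolding that(1) by (simp add: vec_eq_iff)
    then have "algebraic_int (- \<nu>)" using order_eigenvalue_algebraic_int[OF O x(1) that(2)] by blast
    then show ?thesis by simp
  qed
  have root: "algebraic_int t" if "algebraic_int (t ^ m)" for t :: 'f
  proof (rule algebraic_int_root[OF that, of "Polynomial.monom 1 m"])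
    show "poly (Polynomial.monom 1 m) t = t ^ m" by (simp add: poly_monom)
    show "lead_coeff (Polynomial.monom (1::'f) m) = 1" by (simp add: degree_monom_eq)
    show "degree (Polynomial.monom (1::'f) m) > 0" using m by (simp add: degree_monom_eq)
  qed simp
  have "algebraic_int u" "algebraic_int (inverse u)"
    using ai[OF rows(1) nz(1)] ai[OF rows(2) nz(2)] root by blast+
  then show ?thesis unfolding A(2) power2_eq_square by (intro algebraic_int_add_mult)
qed

end

text \<open>The off-diagonal entries involve \<open>d3\<close> and \<open>d4\<close> only and give
  two equations with the distinct factors \<open>\<mu>\<close> and \<open>inverse \<mu>\<close>; the
  diagonal entries then do the same for \<open>d1\<close> and \<open>d2\<close>.\<close>

lemma linear_independent_conj:
  fixes n :: "'f::field^2^2"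
  assumes \<mu>: "\<mu> \<noteq> 0" "\<mu>\<^sup>2 \<noteq> 1" and n: "n$1$2 \<noteq> 0" "n$2$1 \<noteq> 0"
    and z: "mat d1 ** mat 1 + mat d2 ** mat22 \<mu> 0 0 (inverse \<mu>) + mat d3 ** n + mat d4 ** (mat22 \<mu> 0 0 (inverse \<mu>) ** n) = 0"
  shows "d1 = 0 \<and> d2 = 0 \<and> d3 = 0 \<and> d4 = 0"
proof -
  have \<mu>2: "\<mu> \<noteq> inverse \<mu>" using \<mu> by (auto simp: power2_eq_square field_simps)
  have lin0: "s = 0 \<and> t = 0" if "s + t * \<mu> = 0" "s + t * inverse \<mu> = 0" for s t
  proof -
    have "t * \<mu> = t * inverse \<mu>" using that by (metis add_left_cancel)
    then have "t * (\<mu> - inverse \<mu>) = 0" by (simp add: right_diff_distrib)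
    then have "t = 0" using \<mu>2 by simp
    then show ?thesis using that by simp
  qed
  have e: "d1 + d2 * \<mu> + d3 * n$1$1 + d4 * (\<mu> * n$1$1) = 0" "d3 * n$1$2 + d4 * (\<mu> * n$1$2) = 0"
    "d3 * n$2$1 + d4 * (inverse \<mu> * n$2$1) = 0" "d1 + d2 * inverse \<mu> + d3 * n$2$2 + d4 * (inverse \<mu> * n$2$2) = 0"
    using z by (simp_all add: matrix2_simps)
  have "(d3 + d4 * \<mu>) * n$1$2 = 0" "(d3 + d4 * inverse \<mu>) * n$2$1 = 0" using e(2,3) by (simp_all add: algebra_simps)
  then have d34: "d3 = 0" "d4 = 0" using lin0[of d3 d4] n by auto
  then show ?thesis using e(1,4) lin0[of d1 d2] by simp
qed

section \<open>The group \<open>PSL(2)\<close>\<close>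

lemma SL2_simps [simp]: "carrier SL2 = {A. det A = 1}" "mult SL2 = (**)" "one SL2 = mat 1"
  by (simp_all add: SL2_def)

lemma det_mat1_neg [simp]: "det (- mat 1 :: 'a::field^2^2) = 1" by (simp add: det_2 mat2_nth)

lemma group_SL2: "group (SL2 :: ('a::field^2^2) monoid)"
proof (rule groupI)
  fix A :: "'a^2^2" assume "A \<in> carrier SL2"
  then show "\<exists>B\<in>carrier SL2. B \<otimes>\<^bsub>SL2\<^esub> A = \<one>\<^bsub>SL2\<^esub>"
    by (intro bexI[of _ "adj2 A"]) (auto simp: mult_adj2)
qed (auto simp: det_mul matrix_mul_assoc)

lemma neg_mult2: "(- A) ** B = - (A ** B)" "A ** (- B) = - (A ** B)" for A B :: "'a::comm_ring_1^2^2"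
  by (simp_all add: matrix2_simps)

lemma det_neg2 [simp]: "det (- A) = det A" for A :: "'a::comm_ring_1^2^2" by (simp add: det_2)

lemma normal_center: "{mat 1, - mat 1} \<lhd> (SL2 :: ('a::field^2^2) monoid)"
proof (rule group.normal_invI[OF group_SL2])
  interpret group "SL2 :: ('a^2^2) monoid" by (rule group_SL2)
  have "inv\<^bsub>SL2\<^esub> (- mat 1 :: 'a^2^2) = - mat 1" by (rule inv_equality) (auto simp: neg_mult2)
  moreover have "inv\<^bsub>SL2\<^esub> (mat 1 :: 'a^2^2) = mat 1" by (rule inv_equality) auto
  ultimately show "subgroup {mat 1, - mat 1} (SL2 :: ('a^2^2) monoid)"
    by unfold_locales (auto simp: neg_mult2)
  fix x h :: "'a^2^2" assume "x \<in> carrier SL2" "h \<in> {mat 1, - mat 1}"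
  then have "x \<otimes>\<^bsub>SL2\<^esub> h \<otimes>\<^bsub>SL2\<^esub> inv\<^bsub>SL2\<^esub> x = h \<otimes>\<^bsub>SL2\<^esub> (x \<otimes>\<^bsub>SL2\<^esub> inv\<^bsub>SL2\<^esub> x)"
    by (auto simp: neg_mult2)
  moreover have "x \<otimes>\<^bsub>SL2\<^esub> inv\<^bsub>SL2\<^esub> x = mat 1" using \<open>x \<in> carrier SL2\<close> r_inv by simp
  ultimately show "x \<otimes>\<^bsub>SL2\<^esub> h \<otimes>\<^bsub>SL2\<^esub> inv\<^bsub>SL2\<^esub> x \<in> {mat 1, - mat 1}" using \<open>h \<in> _\<close> by simp
qed

lemma psl_proj_eq: "psl_proj A = {A, - A}" for A :: "'a::field^2^2"
  by (auto simp: psl_proj_def r_coset_def neg_mult2)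

lemma group_PSL2: "group (PSL2 :: ('a::field^2^2) set monoid)"
  unfolding PSL2_def by (rule normal.factorgroup_is_group[OF normal_center])

lemma carrier_PSL2: "carrier PSL2 = psl_proj ` {A :: 'a::field^2^2. det A = 1}"
  by (auto simp: PSL2_def FactGroup_def RCOSETS_def psl_proj_def)

lemma psl_proj_carrier: "det A = 1 \<Longrightarrow> psl_proj A \<in> carrier PSL2" by (auto simp: carrier_PSL2)

lemma psl_proj_mult: "det A = 1 \<Longrightarrow> det B = 1 \<Longrightarrow> psl_proj A \<otimes>\<^bsub>PSL2\<^esub> psl_proj B = psl_proj (A ** B)"
  for A B :: "'a::field^2^2"
  unfolding PSL2_def psl_proj_def using normal.rcos_sum[OF normal_center, of A B] by simp

lemma one_PSL2: "\<one>\<^bsub>PSL2\<^esub> = psl_proj (mat 1 :: 'a::field^2^2)"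
  by (simp add: PSL2_def psl_proj_eq)

lemma psl_proj_eq_iff: "psl_proj A = psl_proj B \<longleftrightarrow> A = B \<or> A = - B" for A B :: "'a::field^2^2"
  by (auto simp: psl_proj_eq doubleton_eq_iff)

lemma psl_proj_inv: "det A = 1 \<Longrightarrow> inv\<^bsub>PSL2\<^esub> (psl_proj A) = psl_proj (adj2 A)" for A :: "'a::field^2^2"
  by (rule group.inv_equality[OF group_PSL2])
     (auto simp: psl_proj_mult one_PSL2 mult_adj2 psl_proj_carrier)

lemma psl_proj_pow: "det A = 1 \<Longrightarrow> psl_proj A [^]\<^bsub>PSL2\<^esub> (n::nat) = psl_proj (mpow A n)" for A :: "'a::field^2^2"
proof (induction n)
  case 0 then show ?case using group.is_monoid[OF group_PSL2] by (simp add: one_PSL2)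
next
  case (Suc n)
  moreover have "mpow A (Suc n) = mpow A n ** A" using mpow_add[of A n 1] mpow_Suc[of A 0] by simp
  ultimately show ?case
    using group.is_monoid[OF group_PSL2] by (simp add: monoid.nat_pow_Suc psl_proj_mult det_mpow)
qed

text \<open>Subgroups of PSL(2) are studied through their preimages in SL(2), with the adjugate as
  inverse.\<close>

locale matrix_group =
  fixes G :: "('f::field^2^2) set"
  assumes det_one: "A \<in> G \<Longrightarrow> det A = 1" and mat1_mem: "mat 1 \<in> G"
    and mult_mem: "A \<in> G \<Longrightarrow> B \<in> G \<Longrightarrow> A ** B \<in> G"
    and adj_mem: "A \<in> G \<Longrightarrow> adj2 A \<in> G"
begin

lemma conj_group:
  assumes P: "det P = 1"
  shows "matrix_group ((\<lambda>A. P ** A ** adj2 P) ` G)"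
proof
  have PP: "adj2 P ** P = mat 1" "P ** adj2 P = mat 1" using P by (simp_all add: mult_adj2)
  fix A B assume "A \<in> (\<lambda>A. P ** A ** adj2 P) ` G" "B \<in> (\<lambda>A. P ** A ** adj2 P) ` G"
  then obtain A' B' where A: "A = P ** A' ** adj2 P" "B = P ** B' ** adj2 P" "A' \<in> G" "B' \<in> G" by blast
  show "det A = 1" using A det_one P by (simp add: det_mul)
  have "A ** B = P ** A' ** (adj2 P ** P) ** B' ** adj2 P" unfolding A by (simp add: matrix_mul_assoc)
  then have "A ** B = P ** (A' ** B') ** adj2 P" by (simp add: PP matrix_mul_assoc)
  then show "A ** B \<in> (\<lambda>A. P ** A ** adj2 P) ` G" using A mult_mem by blast
  have "adj2 A = P ** adj2 A' ** adj2 P"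
  proof -
    have "trace A = trace A'" unfolding A by (metis PP(1) matrix_mul_assoc matrix_mul_lid trace_mul_sym)
    moreover have "P ** (mat t - A') ** adj2 P = mat t - A" for t
    proof -
      have "P ** (mat t - A') ** adj2 P = P ** mat t ** adj2 P - P ** A' ** adj2 P"
        by (simp add: matrix2_simps algebra_simps)
      moreover have "P ** mat t ** adj2 P = mat t" by (metis PP(2) mat_mult_commute2 matrix_mul_assoc matrix_mul_rid)
      ultimately show ?thesis by (simp add: A(1))
    qed
    ultimately show ?thesis by (simp add: adj2_def)
  qed
  then show "adj2 A \<in> (\<lambda>A. P ** A ** adj2 P) ` G" using A adj_mem by blast
next
  show "mat 1 \<in> (\<lambda>A. P ** A ** adj2 P) ` G"
    using mat1_mem P by (intro image_eqI[of _ _ "mat 1"]) (simp_all add: mult_adj2)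
qed

end

text \<open>Elements of \<open>PSL2\<close> are cosets \<open>{A, - A}\<close>, so the union of a
  subgroup is its preimage in SL(2).\<close>

lemma subgroup_PSL2_lifts:
  fixes \<Gamma> :: "('a::field^2^2) set set"
  assumes "subgroup \<Gamma> PSL2"
  shows "matrix_group (\<Union>\<Gamma>)" "A \<in> \<Union>\<Gamma> \<longleftrightarrow> psl_proj A \<in> \<Gamma>" "\<gamma> \<in> \<Gamma> \<Longrightarrow> A \<in> \<gamma> \<Longrightarrow> \<gamma> = psl_proj A"
    "\<gamma> \<in> \<Gamma> \<Longrightarrow> \<exists>A. det A = 1 \<and> \<gamma> = psl_proj A"
proof -
  interpret subgroup \<Gamma> PSL2 by fact
  show ex: "\<exists>A. det A = 1 \<and> \<gamma> = psl_proj A" if "\<gamma> \<in> \<Gamma>" for \<gamma>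
    using mem_carrier[OF that] by (auto simp: carrier_PSL2)
  show rep: "\<gamma> = psl_proj A" if "\<gamma> \<in> \<Gamma>" "A \<in> \<gamma>" for \<gamma> A
    using ex[OF that(1)] that(2) by (auto simp: psl_proj_eq)
  show iff: "A \<in> \<Union>\<Gamma> \<longleftrightarrow> psl_proj A \<in> \<Gamma>" for A
    using rep by (auto simp: psl_proj_eq)
  have det: "det A = 1" if "psl_proj A \<in> \<Gamma>" for A
    using ex[OF that] by (auto simp: psl_proj_eq_iff)
  show "matrix_group (\<Union>\<Gamma>)"
  proof
    fix A B assume "A \<in> \<Union>\<Gamma>" "B \<in> \<Union>\<Gamma>"
    then have AB: "psl_proj A \<in> \<Gamma>" "psl_proj B \<in> \<Gamma>" by (simp_all only: iff)
    then show "det A = 1" "A ** B \<in> \<Union>\<Gamma>" "adj2 A \<in> \<Union>\<Gamma>"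
      unfolding iff using det[OF AB(1)] det[OF AB(2)] m_closed[OF AB] m_inv_closed[OF AB(1)]
      by (simp_all add: psl_proj_mult psl_proj_inv)
  next
    show "mat 1 \<in> \<Union>\<Gamma>" unfolding iff using one_closed by (simp add: one_PSL2)
  qed
qed

section \<open>Discrete groups of matrices\<close>

lemma tendsto_matrix_mult:
  fixes A B :: "_ \<Rightarrow> 'f::real_normed_field^2^2"
  assumes "(A \<longlongrightarrow> a) F" "(B \<longlongrightarrow> b) F"
  shows "((\<lambda>n. A n ** B n) \<longlongrightarrow> a ** b) F"
  unfolding matrix_matrix_mult_def
  by (intro vec_tendstoI) (simp add: sum_2, intro tendsto_intros assms)

lemma adj2_nth: "adj2 A $1$1 = A$2$2" "adj2 A $1$2 = - A$1$2" "adj2 A $2$1 = - A$2$1" "adj2 A $2$2 = A$1$1"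
  for A :: "'a::comm_ring_1^2^2"
  by (simp_all add: adj2_def trace2 mat2_nth)

lemma tendsto_adj2:
  fixes A :: "_ \<Rightarrow> 'f::real_normed_field^2^2"
  assumes "(A \<longlongrightarrow> a) F"
  shows "((\<lambda>n. adj2 (A n)) \<longlongrightarrow> adj2 a) F"
proof (intro vec_tendstoI)
  fix i j
  show "((\<lambda>n. adj2 (A n) $ i $ j) \<longlongrightarrow> adj2 a $ i $ j) F"
    using exhaust_2[of i] exhaust_2[of j]
    by (elim disjE; simp only: adj2_nth; intro tendsto_vec_nth tendsto_minus assms)
qed

text \<open>Discreteness isolates each point separately; the group law makes this uniform. If
  elements \<open>f n\<close> accumulate at \<open>x\<close>, some quotients
  \<open>adj2 (f n) ** f m\<close> come so close to the identity that they equal it, and the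
  sequence becomes constant.\<close>

lemma discrete_finite_bounded:
  fixes G :: "('f::{real_normed_field,euclidean_space}^2^2) set"
  assumes G: "matrix_group G" and disc: "discrete G" and S: "bounded S"
  shows "finite (G \<inter> S)"
proof (rule ccontr)
  interpret matrix_group G by fact
  assume inf: "infinite (G \<inter> S)"
  obtain e where e: "e > 0" "\<And>y. y \<in> G \<Longrightarrow> dist (mat 1) y < e \<Longrightarrow> y = mat 1"
    using disc mat1_mem by (metis discreteD isolated_in_dist_Ex_iff)
  have "bounded (G \<inter> S)" using S by (rule bounded_subset) auto
  then obtain x where x: "x islimpt (G \<inter> S)" using inf bounded_infinite_imp_islimpt by blast
  then obtain f where f: "\<And>n. f n \<in> G \<inter> S - {x}" "f \<longlonglongrightarrow> x" by (auto simp: islimpt_sequential)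
  have fG: "f n \<in> G" "f n \<noteq> x" for n using f(1)[of n] by auto
  have "(\<lambda>n. det (f n)) \<longlonglongrightarrow> det x" unfolding det_2 by (intro tendsto_intros f)
  then have "det x = 1" using det_one[OF fG(1)] by (simp add: LIMSEQ_const_iff)
  have "(\<lambda>n. adj2 (f n) ** x) \<longlonglongrightarrow> adj2 x ** x" by (intro tendsto_matrix_mult tendsto_adj2 f tendsto_const)
  then have "(\<lambda>n. adj2 (f n) ** x) \<longlonglongrightarrow> mat 1" by (simp add: mult_adj2 \<open>det x = 1\<close>)
  then have "\<forall>\<^sub>F n in sequentially. dist (adj2 (f n) ** x) (mat 1) < e" using e(1) by (rule tendstoD)
  then obtain n where n: "dist (mat 1) (adj2 (f n) ** x) < e" by (auto simp: eventually_sequentially dist_commute)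
  have lim: "(\<lambda>m. adj2 (f n) ** f m) \<longlonglongrightarrow> adj2 (f n) ** x" by (intro tendsto_matrix_mult f tendsto_const)
  have "\<forall>\<^sub>F m in sequentially. dist (adj2 (f n) ** f m) (adj2 (f n) ** x) < e - dist (mat 1) (adj2 (f n) ** x)"
    using n by (intro tendstoD[OF lim]) simp
  then have "\<forall>\<^sub>F m in sequentially. f m = f n"
  proof eventually_elim
    case (elim m)
    have "dist (mat 1) (adj2 (f n) ** f m) < e" using elim dist_triangle2[of "mat 1" "adj2 (f n) ** f m" "adj2 (f n) ** x"] by simp
    then have "adj2 (f n) ** f m = mat 1" using e(2) fG mult_mem adj_mem by blast
    then have "f n ** adj2 (f n) ** f m = f n" by (simp add: matrix_mul_assoc[symmetric])
    then show ?case by (simp add: mult_adj2 det_one[OF fG(1)])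
  qed
  then have "f \<longlonglongrightarrow> f n" by (rule tendsto_eventually)
  then have "f n = x" using f(2) LIMSEQ_unique by blast
  then show False using fG by blast
qed

lemma mat22_image_bounded:
  fixes a b c d :: "'f::{real_normed_field,euclidean_space} \<Rightarrow> 'f"
  assumes "continuous_on UNIV a" "continuous_on UNIV b" "continuous_on UNIV c" "continuous_on UNIV d"
  shows "bounded ((\<lambda>t. mat22 (a t) (b t) (c t) (d t)) ` cball 0 R)"
proof -
  have "continuous_on UNIV (\<lambda>t. mat22 (a t) (b t) (c t) (d t) $ i $ j)" for i j
    using exhaust_2[of i] exhaust_2[of j] assms by auto
  then have "continuous_on UNIV (\<lambda>t. \<chi> i. \<chi> j. mat22 (a t) (b t) (c t) (d t) $ i $ j)"
    by (intro continuous_on_vec_lambda) auto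
  then have c: "continuous_on UNIV (\<lambda>t. mat22 (a t) (b t) (c t) (d t))" by simp
  have "continuous_on (cball 0 R) (\<lambda>t. mat22 (a t) (b t) (c t) (d t))"
    by (rule continuous_on_subset[OF c]) simp
  then show ?thesis using compact_continuous_image compact_cball compact_imp_bounded by blast
qed

locale locally_finite_group = matrix_group G for G :: "('f::{real_normed_field,euclidean_space}^2^2) set" +
  assumes finite_bounded: "bounded S \<Longrightarrow> finite (G \<inter> S)"
begin

lemma conj_locally_finite:
  assumes P: "det P = 1"
  shows "locally_finite_group ((\<lambda>A. P ** A ** adj2 P) ` G)"
proof -
  have "finite ((\<lambda>A. P ** A ** adj2 P) ` G \<inter> S)" if S: "bounded S" for S
  proof -
    let ?c = "\<lambda>A. adj2 P ** A ** P"
    have "continuous_on (closure S) ?c"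
      unfolding continuous_on_def by (intro ballI tendsto_matrix_mult tendsto_const) (rule tendsto_ident_at)
    moreover have "compact (closure S)" using S by simp
    ultimately have "bounded (?c ` closure S)" using compact_continuous_image compact_imp_bounded by blast
    then have fin: "finite (G \<inter> ?c ` closure S)" by (rule finite_bounded)
    have "(\<lambda>A. P ** A ** adj2 P) ` G \<inter> S \<subseteq> (\<lambda>A. P ** A ** adj2 P) ` (G \<inter> ?c ` closure S)"
    proof
      fix B assume "B \<in> (\<lambda>A. P ** A ** adj2 P) ` G \<inter> S"
      then obtain A where A: "A \<in> G" "B = P ** A ** adj2 P" "B \<in> S" by auto
      have "?c B = (adj2 P ** P) ** A ** (adj2 P ** P)" unfolding A(2) by (simp add: matrix_mul_assoc)
      then have "A = ?c B" by (simp add: mult_adj2 P)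
      then show "B \<in> (\<lambda>A. P ** A ** adj2 P) ` (G \<inter> ?c ` closure S)" using A closure_subset by blast
    qed
    then show ?thesis using fin finite_surj by blast
  qed
  then show ?thesis using conj_group[OF P] by (simp add: locally_finite_group_def locally_finite_group_axioms_def)
qed

lemma countable_group: "countable G"
proof -
  have "G = (\<Union>n::nat. G \<inter> cball 0 (real n))" using real_arch_simple by (auto simp: dist_norm)
  moreover have "countable (\<Union>n::nat. G \<inter> cball 0 (real n))"
    by (intro countable_UN) (auto intro!: countable_finite finite_bounded)
  ultimately show ?thesis by simp
qed

text \<open>Conjugating by the diagonal element, or by its inverse, multiplies the off-diagonal
  entry by \<mu>^-2. A nonzero entry would give infinitely many group elements in a bounded set.
  Geometrically: an element fixing one end of the axis fixes the other.\<close>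

lemma no_triangular:
  assumes h: "mat22 \<mu> 0 0 (inverse \<mu>) \<in> G" and \<mu>: "norm \<mu> > 1"
  shows "mat22 p 0 r s \<in> G \<Longrightarrow> r = 0" "mat22 p r 0 s \<in> G \<Longrightarrow> r = 0"
proof -
  define \<nu> where "\<nu> = inverse \<mu> * inverse \<mu>"
  have \<mu>0: "\<mu> \<noteq> 0" using \<mu> by auto
  have "inverse (norm \<mu>) < 1" using \<mu> by (simp add: inverse_less_1_iff)
  then have "inverse (norm \<mu>) * inverse (norm \<mu>) < 1 * 1" by (intro mult_strict_mono) auto
  then have \<nu>: "\<nu> \<noteq> 0" "norm \<nu> < 1" using \<mu>0 by (auto simp: \<nu>_def norm_mult norm_inverse)
  have h': "mat22 (inverse \<mu>) 0 0 \<mu> \<in> G"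
  proof -
    have "adj2 (mat22 \<mu> 0 0 (inverse \<mu>)) = mat22 (inverse \<mu>) 0 0 \<mu>" by (simp add: adj2_def matrix2_simps)
    then show ?thesis using adj_mem[OF h] by simp
  qed
  have inj: "inj (\<lambda>j. r * \<nu> ^ j)" if "r \<noteq> 0" for r
  proof (rule injI)
    fix i j :: nat assume "r * \<nu> ^ i = r * \<nu> ^ j"
    then have "norm \<nu> ^ i = norm \<nu> ^ j" using that by (metis mult_left_cancel norm_power)
    then show "i = j" using \<nu> by (simp add: power_inject_exp')
  qed
  have bd: "r * \<nu> ^ j \<in> cball 0 (norm r)" for r j
    using \<nu> by (simp add: dist_norm norm_mult norm_power mult_left_le power_le_one)
  have low: "mat22 p 0 (r * \<nu> ^ j) s \<in> G" if "mat22 p 0 r s \<in> G" for p r s j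
  proof (induction j)
    case (Suc j)
    have "mat22 \<mu> 0 0 (inverse \<mu>) ** mat22 p 0 (r * \<nu> ^ j) s ** mat22 (inverse \<mu>) 0 0 \<mu> = mat22 p 0 (r * \<nu> ^ Suc j) s"
      using \<mu>0 by (simp add: mat22_mult \<nu>_def matrix2_eq_iff field_simps)
    then show ?case using Suc h h' mult_mem by metis
  qed (use that in simp)
  have up: "mat22 p (r * \<nu> ^ j) 0 s \<in> G" if "mat22 p r 0 s \<in> G" for p r s j
  proof (induction j)
    case (Suc j)
    have "mat22 (inverse \<mu>) 0 0 \<mu> ** mat22 p (r * \<nu> ^ j) 0 s ** mat22 \<mu> 0 0 (inverse \<mu>) = mat22 p (r * \<nu> ^ Suc j) 0 s"
      using \<mu>0 by (simp add: mat22_mult \<nu>_def matrix2_eq_iff field_simps)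
    then show ?case using Suc h h' mult_mem by metis
  qed (use that in simp)
  show "r = 0" if "mat22 p 0 r s \<in> G"
  proof (rule ccontr)
    assume r: "r \<noteq> 0"
    let ?m = "\<lambda>t. mat22 p 0 t s"
    have "finite (G \<inter> ?m ` cball 0 (norm r))" by (intro finite_bounded mat22_image_bounded continuous_intros)
    moreover have "range (\<lambda>j. ?m (r * \<nu> ^ j)) \<subseteq> G \<inter> ?m ` cball 0 (norm r)" using low[OF that] bd by blast
    ultimately have "finite (range (\<lambda>j. ?m (r * \<nu> ^ j)))" by (rule rev_finite_subset)
    moreover have "inj (\<lambda>j. ?m (r * \<nu> ^ j))" using inj[OF r] by (simp add: inj_def matrix2_eq_iff)
    ultimately show False using finite_imageD infinite_UNIV_nat by blast
  qed
  show "r = 0" if "mat22 p r 0 s \<in> G"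
  proof (rule ccontr)
    assume r: "r \<noteq> 0"
    let ?m = "\<lambda>t. mat22 p t 0 s"
    have "finite (G \<inter> ?m ` cball 0 (norm r))" by (intro finite_bounded mat22_image_bounded continuous_intros)
    moreover have "range (\<lambda>j. ?m (r * \<nu> ^ j)) \<subseteq> G \<inter> ?m ` cball 0 (norm r)" using up[OF that] bd by blast
    ultimately have "finite (range (\<lambda>j. ?m (r * \<nu> ^ j)))" by (rule rev_finite_subset)
    moreover have "inj (\<lambda>j. ?m (r * \<nu> ^ j))" using inj[OF r] by (simp add: inj_def matrix2_eq_iff)
    ultimately show False using finite_imageD infinite_UNIV_nat by blast
  qed
qed

text \<open>One zero entry forces a second one. A zero off the diagonal is settled by
  \<open>no_triangular\<close>; a zero on the diagonal is settled by looking at squares in the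
  group.\<close>

lemma diagonal_or_antidiagonal:
  assumes h: "mat22 \<mu> 0 0 (inverse \<mu>) \<in> G" and \<mu>: "norm \<mu> > 1"
    and all: "\<And>k. k \<in> G \<Longrightarrow> k$1$1 * k$1$2 * k$2$1 * k$2$2 = 0" and k: "k \<in> G"
  shows "(k$1$2 = 0 \<and> k$2$1 = 0) \<or> (k$1$1 = 0 \<and> k$2$2 = 0)"
proof -
  define p q r s where pqrs: "p = k$1$1" "q = k$1$2" "r = k$2$1" "s = k$2$2"
  have ke: "k = mat22 p q r s" by (simp add: pqrs matrix2_eq_iff)
  have det: "p * s - q * r = 1" using det_one[OF k] by (simp add: pqrs det_2)
  have \<mu>0: "\<mu> \<noteq> 0" using \<mu> by auto
  have \<mu>2: "\<mu>\<^sup>2 \<noteq> 1" using \<mu> by (metis norm_one norm_power one_less_power less_irrefl pos2)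
  have ne: "t\<^sup>2 \<noteq> 1 \<or> (t * inverse \<mu>)\<^sup>2 \<noteq> 1" "t\<^sup>2 \<noteq> 1 \<or> (\<mu> * t)\<^sup>2 \<noteq> 1" for t
    using \<mu>2 \<mu>0 by (auto simp: power_mult_distrib power_inverse field_simps)
  \<comment> \<open>If \<open>s\<close> were nonzero, the only entry of the square of
    \<open>k\<close> that can vanish is s^2 - 1. For the diagonal element times \<open>k\<close> it
    is (s/\<mu>)^2 - 1. Both cannot vanish, since \<mu>^2 is not 1.\<close>
  have "s = 0" if "p = 0"
  proof (rule ccontr)
    assume s: "s \<noteq> 0"
    have "- (q * r) = 1" using det that by simp
    then have qr: "q * r = -1" by (metis minus_minus)
    have "mat22 0 q r s ** mat22 0 q r s \<in> G" using k ke that mult_mem by metis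
    moreover have "mat22 0 q r s ** mat22 0 q r s = mat22 (-1) (q * s) (s * r) (s\<^sup>2 - 1)"
      using qr by (simp add: mat22_mult power2_eq_square) (simp add: mult.commute)
    ultimately have 1: "s\<^sup>2 = 1" using all qr s by fastforce
    have "mat22 \<mu> 0 0 (inverse \<mu>) ** mat22 0 q r s \<in> G" using k ke that mult_mem h by metis
    then have "mat22 0 (\<mu> * q) (inverse \<mu> * r) (inverse \<mu> * s) \<in> G" by (simp add: mat22_mult)
    moreover have "\<mu> * q * (inverse \<mu> * r) = -1" "inverse \<mu> * r * (\<mu> * q) = -1" using qr \<mu>0 by (simp_all add: field_simps)
    then have "mat22 0 (\<mu> * q) (inverse \<mu> * r) (inverse \<mu> * s) ** mat22 0 (\<mu> * q) (inverse \<mu> * r) (inverse \<mu> * s)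
      = mat22 (-1) (\<mu> * q * (inverse \<mu> * s)) (inverse \<mu> * s * (inverse \<mu> * r)) ((s * inverse \<mu>)\<^sup>2 - 1)"
      by (simp add: mat22_mult power2_eq_square mult.commute)
    ultimately have "mat22 (-1) (\<mu> * q * (inverse \<mu> * s)) (inverse \<mu> * s * (inverse \<mu> * r)) ((s * inverse \<mu>)\<^sup>2 - 1) \<in> G"
      using mult_mem by metis
    from all[OF this] have 2: "(s * inverse \<mu>)\<^sup>2 = 1" using qr s \<mu>0 by auto
    show False using ne(1)[of s] 1 2 by blast
  qed
  moreover have "p = 0" if "s = 0"
  proof (rule ccontr)
    assume p: "p \<noteq> 0"
    have "- (q * r) = 1" using det that by simp
    then have qr: "q * r = -1" by (metis minus_minus)
    have "mat22 p q r 0 ** mat22 p q r 0 \<in> G" using k ke that mult_mem by metis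
    moreover have "mat22 p q r 0 ** mat22 p q r 0 = mat22 (p\<^sup>2 - 1) (p * q) (r * p) (-1)"
      using qr by (simp add: mat22_mult power2_eq_square) (simp add: mult.commute)
    ultimately have 1: "p\<^sup>2 = 1" using all qr p by fastforce
    have "mat22 \<mu> 0 0 (inverse \<mu>) ** mat22 p q r 0 \<in> G" using k ke that mult_mem h by metis
    then have "mat22 (\<mu> * p) (\<mu> * q) (inverse \<mu> * r) 0 \<in> G" by (simp add: mat22_mult)
    moreover have "\<mu> * q * (inverse \<mu> * r) = -1" "inverse \<mu> * r * (\<mu> * q) = -1" using qr \<mu>0 by (simp_all add: field_simps)
    then have "mat22 (\<mu> * p) (\<mu> * q) (inverse \<mu> * r) 0 ** mat22 (\<mu> * p) (\<mu> * q) (inverse \<mu> * r) 0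
      = mat22 ((\<mu> * p)\<^sup>2 - 1) (\<mu> * p * (\<mu> * q)) (inverse \<mu> * r * (\<mu> * p)) (-1)"
      by (simp add: mat22_mult power2_eq_square)
    ultimately have "mat22 ((\<mu> * p)\<^sup>2 - 1) (\<mu> * p * (\<mu> * q)) (inverse \<mu> * r * (\<mu> * p)) (-1) \<in> G"
      using mult_mem by metis
    from all[OF this] have 2: "(\<mu> * p)\<^sup>2 = 1" using qr p \<mu>0 by auto
    show False using ne(2)[of p] 1 2 by blast
  qed
  moreover have "r = 0" if "q = 0" using no_triangular(1)[OF h \<mu>] k ke that by blast
  moreover have "q = 0" if "r = 0" using no_triangular(2)[OF h \<mu>] k ke that by blast
  moreover have "p = 0 \<or> q = 0 \<or> r = 0 \<or> s = 0" using all[OF k] pqrs by auto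
  ultimately show ?thesis unfolding pqrs[symmetric] by blast
qed

end

section \<open>Squared traces of hyperbolic elements\<close>

text \<open>In the frame \<open>P\<close> the axis has the ends 0 and infinity, which
  \<open>k'\<close> sends to the ratios of its columns. Four nonzero entries say that neither end is
  sent to either end.\<close>

definition nonelementary_at :: "('f::field^2^2) set \<Rightarrow> 'f^2^2 \<Rightarrow> bool" where
  "nonelementary_at G P \<longleftrightarrow> (\<exists>k\<in>G. let k' = adj2 P ** k ** P in k'$1$1 * k'$1$2 * k'$2$1 * k'$2$2 \<noteq> 0)"

text \<open>Conjugation by \<open>A\<close> has to carry the four basis elements into the algebra.
  It fixes \<open>h\<close>, a power of \<open>A\<close>, and it turns \<open>h'\<close>, the
  \<open>m\<close>-th power of \<open>B\<close>, into the \<open>m\<close>-th power of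
  \<open>A ** B ** adj2 A\<close>, which lies in the image because this is again an element of
  \<open>G\<close>.\<close>

lemma (in quaternion_rep) hyperbolic_trace_in_field:
  fixes G :: "('f::field_char_0^2^2) set"
  assumes G: "matrix_group G" and O: "is_order K a b \<O>" and m: "m > 0"
    and pow: "\<And>B. B \<in> G \<Longrightarrow> \<exists>y\<in>\<O>. mpow B m = \<rho> y \<or> mpow B m = - \<rho> y"
    and A: "A \<in> G" "A = P ** mat22 u 0 0 (inverse u) ** adj2 P" and P: "det P = 1"
    and u: "u \<noteq> 0" "u\<^sup>2 \<noteq> 1" "(u ^ m)\<^sup>2 \<noteq> 1" and ne: "nonelementary_at G P"
  shows "\<exists>x\<in>K. \<sigma> x = (trace A)\<^sup>2 \<and> algebraic_int x \<and> (\<forall>v\<in>embeddings K. ramified_at a b v \<longrightarrow> \<bar>v x\<bar> \<le> 4)"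
proof -
  interpret matrix_group G by fact
  have PP: "adj2 P ** P = mat 1" "P ** adj2 P = mat 1" using P by (simp_all add: mult_adj2)
  have rep: "\<exists>y\<in>qalg K. mpow B m = \<rho> y" if B: "B \<in> G" for B
  proof -
    obtain y where y: "y \<in> \<O>" "mpow B m = \<rho> y \<or> mpow B m = - \<rho> y" using pow[OF B] by blast
    then have yK: "y \<in> qalg K" using order_subset[OF O] by auto
    moreover have "- y \<in> qalg K" using yK by (simp add: mem_qalg uminus_mem)
    ultimately show ?thesis using y(2) rho_minus by metis
  qed
  obtain k where k: "k \<in> G" and k'0: "let k' = adj2 P ** k ** P in k'$1$1 * k'$1$2 * k'$2$1 * k'$2$2 \<noteq> 0"
    using ne by (auto simp: nonelementary_at_def)
  define k' where "k' = adj2 P ** k ** P"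
  have k'nz: "k'$1$1 \<noteq> 0" "k'$1$2 \<noteq> 0" "k'$2$1 \<noteq> 0" "k'$2$2 \<noteq> 0" using k'0 by (auto simp: k'_def Let_def)
  define \<mu> where "\<mu> = u ^ m"
  have \<mu>: "\<mu> \<noteq> 0" "\<mu>\<^sup>2 \<noteq> 1" using u by (simp_all add: \<mu>_def)
  define D where "D = mat22 \<mu> 0 0 (inverse \<mu>)"
  have conjP: "P ** X ** adj2 P ** (P ** Y ** adj2 P) = P ** (X ** Y) ** adj2 P" for X Y
  proof -
    have "P ** X ** adj2 P ** (P ** Y ** adj2 P) = P ** X ** (adj2 P ** P) ** Y ** adj2 P" by (simp add: matrix_mul_assoc)
    then show ?thesis by (simp add: PP matrix_mul_assoc)
  qed
  have kP: "k = P ** k' ** adj2 P" 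
  proof -
    have "P ** k' ** adj2 P = (P ** adj2 P) ** k ** (P ** adj2 P)" by (simp add: k'_def matrix_mul_assoc)
    then show ?thesis by (simp add: PP)
  qed
  have det': "det k' = 1" using det_one[OF k] P by (simp add: k'_def det_mul)
  have adjk: "adj2 k = P ** adj2 k' ** adj2 P"
  proof -
    have "k ** (P ** adj2 k' ** adj2 P) = mat 1" unfolding kP conjP by (simp add: mult_adj2 det' P)
    then have "adj2 k ** k ** (P ** adj2 k' ** adj2 P) = adj2 k" by (simp add: matrix_mul_assoc[symmetric])
    then show ?thesis by (simp add: mult_adj2 det_one[OF k])
  qed
  define h where "h = mpow A m"
  have hP: "h = P ** D ** adj2 P"
    unfolding h_def A(2) mpow_conj[OF P] mpow_diag by (simp add: D_def \<mu>_def power_inverse)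
  define B where "B = k ** A ** adj2 k"
  have BG: "B \<in> G" unfolding B_def using k A adj_mem mult_mem by blast
  define h' where "h' = mpow B m"
  have h': "h' = k ** h ** adj2 k" unfolding h'_def B_def h_def by (rule mpow_conj[OF det_one[OF k]])
  define n where "n = k' ** D ** adj2 k'"
  have h'P: "h' = P ** n ** adj2 P" unfolding h' hP kP adjk[unfolded kP] n_def conjP ..
  have \<mu>\<mu>: "\<mu> - inverse \<mu> \<noteq> 0" using \<mu> by (auto simp: power2_eq_square field_simps)
  \<comment> \<open>Each off-diagonal entry contains two entries of \<open>k'\<close>; this is why
    all four are required to be nonzero.\<close>
  have "n$1$2 = - (k'$1$1 * k'$1$2 * (\<mu> - inverse \<mu>))" "n$2$1 = k'$2$1 * k'$2$2 * (\<mu> - inverse \<mu>)"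
    by (simp_all add: n_def D_def matrix2_mult_nth adj2_nth algebra_simps)
  then have n: "n$1$2 \<noteq> 0" "n$2$1 \<noteq> 0" using k'nz \<mu>\<mu> by simp_all
  obtain y2 y3 where y: "y2 \<in> qalg K" "h = \<rho> y2" "y3 \<in> qalg K" "h' = \<rho> y3"
    using rep[OF A(1)] rep[OF BG] by (auto simp: h_def h'_def)
  define w where "w i = (if i = 1 then qone else if i = 2 then y2 else if i = 3 then y3 else qmult a b y2 y3)" for i :: 4
  have w: "w 1 = qone" "w 2 = y2" "w 3 = y3" "w 4 = qmult a b y2 y3" by (simp_all add: w_def)
  have wK: "w i \<in> qalg K" for i unfolding w_def using y qone_mem qalg_closed(2) by auto
  have rw: "\<rho> (w 1) = mat 1" "\<rho> (w 2) = h" "\<rho> (w 3) = h'" "\<rho> (w 4) = h ** h'"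
    using y by (simp_all add: w rho_one rho_mult)
  have indep: "\<forall>i. d i = 0" if "(\<Sum>i\<in>UNIV. mat (d i) ** \<rho> (w i)) = 0" for d
  proof -
    have eq: "mat (d 1) ** mat 1 + mat (d 2) ** h + mat (d 3) ** h' + mat (d 4) ** (h ** h') = 0"
      using that unfolding sum_4 rw .
    have cm: "adj2 P ** (mat t ** (P ** X ** adj2 P)) ** P = mat t ** X" for t X
    proof -
      have "adj2 P ** (mat t ** (P ** X ** adj2 P)) ** P = mat t ** ((adj2 P ** P) ** X ** (adj2 P ** P))"
        by (simp only: matrix_mul_assoc mat_mult_commute2[of "adj2 P" t])
      then show ?thesis by (simp add: PP)
    qed
    have hh: "h ** h' = P ** (D ** n) ** adj2 P" unfolding hP h'P conjP ..
    have one: "mat 1 = P ** mat 1 ** adj2 P" by (simp add: PP)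
    have "adj2 P ** (mat (d 1) ** mat 1 + mat (d 2) ** h + mat (d 3) ** h' + mat (d 4) ** (h ** h')) ** P
      = mat (d 1) ** mat 1 + mat (d 2) ** D + mat (d 3) ** n + mat (d 4) ** (D ** n)"
      unfolding matrix_add_ldistrib matrix2_add_mult hh unfolding hP h'P cm
      by (subst (1) one) (simp only: cm)
    then have "mat (d 1) ** mat 1 + mat (d 2) ** D + mat (d 3) ** n + mat (d 4) ** (D ** n) = 0"
      unfolding eq by (simp add: matrix2_simps)
    from linear_independent_conj[OF \<mu> n this[unfolded D_def]] show ?thesis unfolding forall_4 by simp
  qed
  have AA: "adj2 A ** A = mat 1" "A ** adj2 A = mat 1" using det_one[OF A(1)] by (simp_all add: mult_adj2)
  have conj: "\<exists>y\<in>qalg K. A ** \<rho> (w i) ** adj2 A = \<rho> y" for i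
  proof -
    have c2: "A ** h ** adj2 A = \<rho> y2"
      using mpow_conj[OF det_one[OF A(1)], of A m] y(2) unfolding h_def by (simp add: matrix_mul_assoc[symmetric] AA)
    have "A ** B ** adj2 A \<in> G" using A BG adj_mem mult_mem by blast
    from rep[OF this] obtain y3' where y3': "y3' \<in> qalg K" "A ** h' ** adj2 A = \<rho> y3'"
      unfolding mpow_conj[OF det_one[OF A(1)]] h'_def by blast
    have "A ** (h ** h') ** adj2 A = A ** h ** (adj2 A ** A) ** h' ** adj2 A" by (simp add: AA matrix_mul_assoc)
    also have "\<dots> = (A ** h ** adj2 A) ** (A ** h' ** adj2 A)" by (simp add: matrix_mul_assoc)
    also have "\<dots> = \<rho> (qmult a b y2 y3')" unfolding c2 y3'(2) using y y3' by (simp add: rho_mult)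
    finally have c4: "A ** (h ** h') ** adj2 A = \<rho> (qmult a b y2 y3')" .
    have c1: "A ** mat 1 ** adj2 A = \<rho> qone" by (simp add: AA rho_one)
    consider "i = 1" | "i = 2" | "i = 3" | "i = 4" using exhaust_4 by blast
    then show ?thesis
    proof cases
      case 1 then show ?thesis using c1 rw qone_mem by metis
    next
      case 2 then show ?thesis using c2 rw y by metis
    next
      case 3 then show ?thesis using y3' rw by metis
    next
      case 4 then show ?thesis using c4 rw y y3' qalg_closed(2) by metis
    qed
  qed
  obtain x where x: "x \<in> K" "\<sigma> x = (trace A)\<^sup>2" "\<forall>v\<in>embeddings K. ramified_at a b v \<longrightarrow> \<bar>v x\<bar> \<le> 4"
  proof -
    have "\<exists>x\<in>K. \<sigma> x = (trace A)\<^sup>2 \<and> (\<forall>v\<in>embeddings K. ramified_at a b v \<longrightarrow> \<bar>v x\<bar> \<le> 4)"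
      by (rule trace_sq_in_field[of A w]) (rule det_one[OF A(1)] wK indep conj, assumption?)+
    then show ?thesis using that by blast
  qed
  have trA: "trace A = u + inverse u"
  proof -
    have "trace A = trace (adj2 P ** (P ** mat22 u 0 0 (inverse u)))" unfolding A(2) by (rule trace_mul_sym)
    then show ?thesis by (simp add: matrix_mul_assoc PP) (simp add: trace2)
  qed
  obtain y where "y \<in> \<O>" "mpow A m = \<rho> y \<or> mpow A m = - \<rho> y" using pow[OF A(1)] by blast
  then have "algebraic_int ((trace A)\<^sup>2)"
    using trace_sq_algebraic_int[OF O _ _ m det_one[OF A(1)] trA u(1,2)] by blast
  then have "algebraic_int x" using algebraic_int_hom[OF x(1)] x(2) by simp
  then show ?thesis using x by blast
qed

section \<open>Moebius transformations\<close>

definition transl :: "'f::field \<Rightarrow> 'f^2^2" where "transl b = mat22 1 b 0 1"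

definition weyl :: "'f::field^2^2" where "weyl = mat22 0 (-1) 1 0"

lemma det_gens [simp]: "det (transl b) = 1" "det weyl = 1"
  by (simp_all add: transl_def weyl_def det_2)

text \<open>SL(2) is generated by the translations and \<open>weyl\<close>. Formulas for the action
  are thereby reduced to a translation and an inversion.\<close>

lemma SL2_induct [consumes 1, case_names one transl weyl]:
  fixes A :: "'f::field^2^2"
  assumes det: "det A = 1" and one: "P (mat 1)"
    and tr: "\<And>b B. det B = 1 \<Longrightarrow> P B \<Longrightarrow> P (transl b ** B)"
    and wy: "\<And>B. det B = 1 \<Longrightarrow> P B \<Longrightarrow> P (weyl ** B)"
  shows "P A"
proof -
  have nz: "P A" if det: "det A = 1" and c: "A$2$1 \<noteq> 0" for A
  proof -
    define x y where "x = (A$1$1 - 1) / A$2$1" and "y = (A$2$2 - 1) / A$2$1"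
    \<comment> \<open>The fourth power of \<open>weyl\<close> is 1, so its cube is its inverse. The
      word below is an upper, a lower and an upper unipotent matrix, the lower one being a conjugate
      of \<open>transl (- A$2$1)\<close> by \<open>weyl\<close>.\<close>
    let ?B = "weyl ** (weyl ** (weyl ** (transl y ** mat 1)))"
    have "P (transl x ** (weyl ** (transl (- A$2$1) ** ?B)))"
      by (intro tr wy one) (simp_all add: det_mul)
    moreover have "transl x ** (weyl ** (transl (- A$2$1) ** ?B)) = A"
    proof -
      have ad: "A$1$1 * A$2$2 - A$1$2 * A$2$1 = 1" using det by (simp add: det_2)
      have "transl x ** (weyl ** (transl (- A$2$1) ** ?B)) = mat22 (1 + x * A$2$1) (y * (1 + x * A$2$1) + x) (A$2$1) (A$2$1 * y + 1)"
        by (simp add: transl_def weyl_def mat22_mult algebra_simps)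
      also have "\<dots> = A"
      proof -
        have "1 + x * A$2$1 = A$1$1" "A$2$1 * y + 1 = A$2$2" using c by (simp_all add: x_def y_def)
        moreover have "y * A$1$1 + x = A$1$2"
        proof -
          have "y * A$1$1 + x = (A$1$1 * A$2$2 - 1) / A$2$1" using c by (simp add: x_def y_def field_simps)
          also have "A$1$1 * A$2$2 - 1 = A$1$2 * A$2$1" using ad by (simp add: algebra_simps)
          finally show ?thesis using c by simp
        qed
        ultimately show ?thesis by (simp add: matrix2_eq_iff)
      qed
      finally show ?thesis .
    qed
    ultimately show ?thesis by simp
  qed
  show ?thesis
  proof (cases "A$2$1 = 0")
    case False then show ?thesis using nz det by blast
  next
    case True
    \<comment> \<open>This swaps the rows up to sign and makes the lower left entry nonzero.\<close>
    let ?B = "adj2 weyl ** A"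
    have "det ?B = 1" using det by (simp add: det_mul)
    moreover have "?B$2$1 \<noteq> 0" using True det by (auto simp: matrix2_mult_nth adj2_nth weyl_def det_2)
    ultimately have "P ?B" by (rule nz)
    then have "P (weyl ** ?B)" using \<open>det ?B = 1\<close> by (intro wy)
    then show ?thesis by (simp add: matrix_mul_assoc mult_adj2)
  qed
qed

text \<open>The squared norm of the quaternion \<open>c q + d\<close> at the point
  \<open>q = z + t j\<close>.\<close>

definition denom3 :: "complex^2^2 \<Rightarrow> complex \<times> real \<Rightarrow> real" where
  "denom3 A p = (cmod (A$2$1 * fst p + A$2$2))\<^sup>2 + (cmod (A$2$1))\<^sup>2 * (snd p)\<^sup>2"

lemma denom3_pos:
  assumes "det A = 1" "p \<in> H3" shows "denom3 A p > 0"
proof (cases "A$2$1 = 0")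
  case True
  then have "A$2$2 \<noteq> 0" using assms(1) by (auto simp: det_2)
  then show ?thesis using True by (simp add: denom3_def)
next
  case False
  have "snd p > 0" using assms(2) by (auto simp: H3_def split: prod.splits)
  then show ?thesis using False by (simp add: denom3_def add_nonneg_pos)
qed

lemma moebius3_eq:
  "moebius3 A p = (((A$1$1 * fst p + A$1$2) * cnj (A$2$1 * fst p + A$2$2) + A$1$1 * cnj (A$2$1) * of_real ((snd p)\<^sup>2)) / of_real (denom3 A p),
    snd p / denom3 A p)"
  by (simp add: moebius3_def denom3_def Let_def)

lemma moebius3_H3: "det A = 1 \<Longrightarrow> p \<in> H3 \<Longrightarrow> moebius3 A p \<in> H3"
  using denom3_pos[of A p] by (auto simp: moebius3_eq H3_def split: prod.splits)

lemma moebius3_one: "moebius3 (mat 1) p = p"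
  by (simp add: moebius3_eq denom3_def mat2_nth)

lemma moebius3_uminus: "moebius3 (- A) p = moebius3 A p"
proof -
  have e: "- x * y + - z = - (x * y + z)" for x y z :: complex by simp
  have "denom3 (- A) p = denom3 A p" unfolding denom3_def vector_uminus_component e norm_minus_cancel ..
  then show ?thesis by (simp add: moebius3_eq algebra_simps)
qed

lemma moebius3_transl: "moebius3 (transl b) p = (fst p + b, snd p)"
  by (simp add: moebius3_eq denom3_def transl_def)

lemma moebius3_weyl:
  "moebius3 weyl p = (- cnj (fst p) / of_real ((cmod (fst p))\<^sup>2 + (snd p)\<^sup>2), snd p / ((cmod (fst p))\<^sup>2 + (snd p)\<^sup>2))"
  by (simp add: moebius3_eq denom3_def weyl_def)

lemma cmod_sq: "complex_of_real ((cmod z)\<^sup>2) = z * cnj z"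
  by (simp only: complex_norm_square)

lemma moebius3_transl_mult:
  assumes B: "det B = 1" and p: "p \<in> H3"
  shows "moebius3 (transl b ** B) p = moebius3 (transl b) (moebius3 B p)"
proof -
  define z t where "z = fst p" and "t = snd p"
  note N = denom3_pos[OF B p]
  have d: "denom3 (transl b ** B) p = denom3 B p"
    by (simp add: denom3_def transl_def matrix2_mult_nth)
  have "complex_of_real (denom3 B p) = (B$2$1 * z + B$2$2) * cnj (B$2$1 * z + B$2$2) + B$2$1 * cnj (B$2$1) * of_real (t\<^sup>2)"
    unfolding denom3_def of_real_add of_real_mult cmod_sq by (simp add: z_def t_def)
  then have num: "((transl b ** B)$1$1 * z + (transl b ** B)$1$2) * cnj (B$2$1 * z + B$2$2) + (transl b ** B)$1$1 * cnj (B$2$1) * of_real (t\<^sup>2)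
    = ((B$1$1 * z + B$1$2) * cnj (B$2$1 * z + B$2$2) + B$1$1 * cnj (B$2$1) * of_real (t\<^sup>2)) + b * of_real (denom3 B p)"
    by (simp add: transl_def matrix2_mult_nth algebra_simps)
  have low: "(transl b ** B)$2$1 = B$2$1" "(transl b ** B)$2$2 = B$2$2" by (simp_all add: transl_def matrix2_mult_nth)
  show ?thesis
    using N unfolding moebius3_transl moebius3_eq[of "transl b ** B"] d moebius3_eq[of B] low num[unfolded z_def t_def]
    by (simp add: add_divide_distrib)
qed

text \<open>Lagrange's identity for the vectors \<open>(X, a t)\<close> and \<open>(w, c t)\<close>:
  squared inner product plus squared determinant is the product of the squared lengths.\<close>

lemma lagrange_identity_complex:
  fixes X w a c :: complex and t :: real
  shows "(cmod (X * cnj w + a * cnj c * of_real (t\<^sup>2)))\<^sup>2 + t\<^sup>2 * (cmod (a * w - c * X))\<^sup>2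
    = ((cmod X)\<^sup>2 + (cmod a)\<^sup>2 * t\<^sup>2) * ((cmod w)\<^sup>2 + (cmod c)\<^sup>2 * t\<^sup>2)"
proof -
  have "complex_of_real ((cmod (X * cnj w + a * cnj c * of_real (t\<^sup>2)))\<^sup>2 + t\<^sup>2 * (cmod (a * w - c * X))\<^sup>2)
    = complex_of_real (((cmod X)\<^sup>2 + (cmod a)\<^sup>2 * t\<^sup>2) * ((cmod w)\<^sup>2 + (cmod c)\<^sup>2 * t\<^sup>2))"
    unfolding of_real_add of_real_mult cmod_sq by (simp add: algebra_simps power2_eq_square)
  then show ?thesis by (simp only: of_real_eq_iff)
qed

text \<open>The determinant in Lagrange's identity is governed by \<open>det B = 1\<close>, so the
  squared Euclidean length of the image of \<open>p\<close> under \<open>B\<close> is the quotient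
  of the two denominators. That quotient is what \<open>weyl\<close> divides by.\<close>

lemma moebius3_weyl_mult:
  assumes B: "det B = 1" and p: "p \<in> H3"
  shows "moebius3 (weyl ** B) p = moebius3 weyl (moebius3 B p)"
proof -
  define a b c d z t where "a = B$1$1" "b = B$1$2" "c = B$2$1" "d = B$2$2" "z = fst p" "t = snd p"
  note defs = this
  define X w where "X = a * z + b" and "w = c * z + d"
  define Q where "Q = X * cnj w + a * cnj c * of_real (t\<^sup>2)"
  have N: "denom3 B p > 0" "denom3 (weyl ** B) p > 0"
    using B p by (auto intro!: denom3_pos simp: det_mul)
  have dB: "denom3 B p = (cmod w)\<^sup>2 + (cmod c)\<^sup>2 * t\<^sup>2" by (simp add: denom3_def w_def defs)
  have dW: "denom3 (weyl ** B) p = (cmod X)\<^sup>2 + (cmod a)\<^sup>2 * t\<^sup>2"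
    by (simp add: denom3_def X_def defs weyl_def matrix2_mult_nth)
  have "a * w - c * X = 1"
    using B by (simp add: X_def w_def det_2 defs algebra_simps)
  then have L: "(cmod Q)\<^sup>2 + t\<^sup>2 = denom3 (weyl ** B) p * denom3 B p"
    using lagrange_identity_complex[of X w a c t] by (simp add: dB dW Q_def)
  have mB: "moebius3 B p = (Q / of_real (denom3 B p), t / denom3 B p)"
    by (simp add: moebius3_eq Q_def X_def w_def defs)
  have n: "(cmod (Q / of_real (denom3 B p)))\<^sup>2 + (t / denom3 B p)\<^sup>2 = denom3 (weyl ** B) p / denom3 B p"
  proof -
    have "(cmod (Q / of_real (denom3 B p)))\<^sup>2 + (t / denom3 B p)\<^sup>2 = ((cmod Q)\<^sup>2 + t\<^sup>2) / (denom3 B p)\<^sup>2"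
      using N by (simp add: norm_divide power_divide add_divide_distrib)
    then show ?thesis unfolding L using N by (simp add: power2_eq_square)
  qed
  have mW: "moebius3 (weyl ** B) p = (- cnj Q / of_real (denom3 (weyl ** B) p), t / denom3 (weyl ** B) p)"
    unfolding moebius3_eq[of "weyl ** B"]
    by (simp add: Q_def X_def w_def defs weyl_def matrix2_mult_nth algebra_simps)
  show ?thesis
    unfolding mW mB moebius3_weyl fst_conv snd_conv n using N by (simp add: field_simps)
qed

lemma moebius3_mult:
  assumes "det A = 1" "det B = 1" "p \<in> H3"
  shows "moebius3 (A ** B) p = moebius3 A (moebius3 B p)"
  using assms
proof (induction A arbitrary: B p rule: SL2_induct)
  case one then show ?case by (simp add: moebius3_one)
next
  case (transl b A)
  have "moebius3 (transl b ** A ** B) p = moebius3 (transl b) (moebius3 (A ** B) p)"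
    using transl by (simp add: matrix_mul_assoc[symmetric] moebius3_transl_mult det_mul)
  then show ?case using transl by (simp add: moebius3_transl_mult moebius3_H3)
next
  case (weyl A)
  have "moebius3 (weyl ** A ** B) p = moebius3 weyl (moebius3 (A ** B) p)"
    using weyl by (simp add: matrix_mul_assoc[symmetric] moebius3_weyl_mult det_mul)
  then show ?case using weyl by (simp add: moebius3_weyl_mult moebius3_H3)
qed

section \<open>Invariance of the distance\<close>

text \<open>The hyperbolic cosine of the distance, minus 1. As \<open>arcosh\<close> is injective
  from 1 on, preserving distances on \<open>H3\<close> means preserving this expression.\<close>

definition disp3 :: "complex \<times> real \<Rightarrow> complex \<times> real \<Rightarrow> real" where
  "disp3 p q = ((cmod (fst p - fst q))\<^sup>2 + (snd p - snd q)\<^sup>2) / (2 * snd p * snd q)"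

lemma dist_H3_eq: "dist_H3 p q = arcosh (1 + disp3 p q)"
  by (simp add: dist_H3_def disp3_def)

lemma H3_iff: "p \<in> H3 \<longleftrightarrow> snd p > 0" by (auto simp: H3_def split: prod.splits)

lemma disp3_nonneg: "p \<in> H3 \<Longrightarrow> q \<in> H3 \<Longrightarrow> disp3 p q \<ge> 0" by (simp add: disp3_def H3_iff)

lemma arcosh_inj: "x \<ge> 1 \<Longrightarrow> y \<ge> 1 \<Longrightarrow> arcosh x = arcosh y \<longleftrightarrow> x = (y::real)"
  by (metis cosh_arcosh_real)

lemma dist_H3_eq_iff:
  "p \<in> H3 \<Longrightarrow> q \<in> H3 \<Longrightarrow> p' \<in> H3 \<Longrightarrow> q' \<in> H3 \<Longrightarrow> dist_H3 p q = dist_H3 p' q' \<longleftrightarrow> disp3 p q = disp3 p' q'"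
  using disp3_nonneg by (simp add: dist_H3_eq arcosh_inj)

text \<open>Inversion divides squared Euclidean distances by \<open>n * n'\<close> and the two
  heights by \<open>n\<close> and \<open>n'\<close>, so the quotient is unchanged.\<close>

lemma disp3_weyl:
  assumes "p \<in> H3" "q \<in> H3"
  shows "disp3 (moebius3 weyl p) (moebius3 weyl q) = disp3 p q"
proof -
  obtain x y t where p: "p = (Complex x y, t)" by (metis complex.exhaust surj_pair)
  obtain x' y' t' where q: "q = (Complex x' y', t')" by (metis complex.exhaust surj_pair)
  have t: "t > 0" "t' > 0" using assms by (auto simp: p q H3_iff)
  define n n' where "n = x\<^sup>2 + y\<^sup>2 + t\<^sup>2" and "n' = x'\<^sup>2 + y'\<^sup>2 + t'\<^sup>2"
  have n: "n > 0" "n' > 0" using t by (auto simp: n_def n'_def intro: add_nonneg_pos)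
  have m: "moebius3 weyl p = (Complex (- x / n) (y / n), t / n)" "moebius3 weyl q = (Complex (- x' / n') (y' / n'), t' / n')"
    by (simp_all add: p q moebius3_weyl n_def n'_def cmod_power2 complex_eq_iff)
  have "((- x / n - - x' / n')\<^sup>2 + (y / n - y' / n')\<^sup>2 + (t / n - t' / n')\<^sup>2) * (n\<^sup>2 * n'\<^sup>2)
     = (x * n' - x' * n)\<^sup>2 + (y * n' - y' * n)\<^sup>2 + (t * n' - t' * n)\<^sup>2"
    using n by (simp add: field_simps power2_eq_square)
  also have "\<dots> = n * n'\<^sup>2 + n' * n\<^sup>2 - 2 * n * n' * (x * x' + y * y' + t * t')"
    unfolding n_def n'_def by (simp add: algebra_simps power2_eq_square)
  also have "\<dots> = n * n' * ((x - x')\<^sup>2 + (y - y')\<^sup>2 + (t - t')\<^sup>2)"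
    unfolding n_def n'_def by (simp add: algebra_simps power2_eq_square)
  finally have "((- x / n - - x' / n')\<^sup>2 + (y / n - y' / n')\<^sup>2 + (t / n - t' / n')\<^sup>2)
      = n * n' * ((x - x')\<^sup>2 + (y - y')\<^sup>2 + (t - t')\<^sup>2) / (n\<^sup>2 * n'\<^sup>2)"
    using n by (subst nonzero_eq_divide_eq) auto
  also have "\<dots> = ((x - x')\<^sup>2 + (y - y')\<^sup>2 + (t - t')\<^sup>2) / (n * n')"
    using n by (simp add: power2_eq_square)
  finally have e: "((- x / n - - x' / n')\<^sup>2 + (y / n - y' / n')\<^sup>2 + (t / n - t' / n')\<^sup>2) = ((x - x')\<^sup>2 + (y - y')\<^sup>2 + (t - t')\<^sup>2) / (n * n')" .
  have "disp3 (moebius3 weyl p) (moebius3 weyl q) = ((- x / n - - x' / n')\<^sup>2 + (y / n - y' / n')\<^sup>2 + (t / n - t' / n')\<^sup>2) / (2 * (t / n) * (t' / n'))"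
    unfolding m disp3_def by (simp add: cmod_power2)
  also have "\<dots> = disp3 p q"
    unfolding e using n t by (simp add: disp3_def p q cmod_power2)
  finally show ?thesis .
qed

lemma disp3_moebius3:
  assumes "det A = 1" "p \<in> H3" "q \<in> H3"
  shows "disp3 (moebius3 A p) (moebius3 A q) = disp3 p q"
  using assms
proof (induction A rule: SL2_induct)
  case one then show ?case by (simp add: moebius3_one)
next
  case (transl b B)
  have "disp3 (moebius3 (transl b) r) (moebius3 (transl b) s) = disp3 r s" for r s
    by (simp add: moebius3_transl disp3_def)
  then show ?case using transl by (simp add: moebius3_transl_mult)
next
  case (weyl B)
  then show ?case by (simp add: moebius3_weyl_mult disp3_weyl moebius3_H3)
qed

text \<open>The action on the plane is inherited from the space through this embedding.\<close>

definition emb :: "complex \<Rightarrow> complex \<times> real" where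
  "emb z = (of_real (Re z), Im z)"

definition cmat :: "real^2^2 \<Rightarrow> complex^2^2" where
  "cmat A = mat22 (of_real (A$1$1)) (of_real (A$1$2)) (of_real (A$2$1)) (of_real (A$2$2))"

lemma emb_inj: "emb z = emb w \<longleftrightarrow> z = w" by (auto simp: emb_def complex_eq_iff)

lemma emb_H3: "emb z \<in> H3 \<longleftrightarrow> z \<in> H2" by (simp add: emb_def H3_iff H2_def)

lemma cmat_simps: "det (cmat A) = of_real (det A)" "cmat (A ** B) = cmat A ** cmat B" "cmat (mat 1) = mat 1" "cmat (- A) = - cmat A"
  by (simp_all add: cmat_def matrix2_simps)

lemma moebius3_emb:
  assumes A: "det A = 1" and z: "z \<in> H2"
  shows "moebius3 (cmat A) (emb z) = emb (moebius2 A z)"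
proof -
  define a b c d x y where "a = A$1$1" "b = A$1$2" "c = A$2$1" "d = A$2$2" "x = Re z" "y = Im z"
  note defs = this
  have zc: "z = Complex x y" by (simp add: defs)
  have det: "a * d - b * c = 1" using A by (simp add: det_2 defs)
  define N where "N = (c * x + d)\<^sup>2 + (c * y)\<^sup>2"
  have dN: "denom3 (cmat A) (emb z) = N"
  proof -
    have "complex_of_real c * complex_of_real x + complex_of_real d = complex_of_real (c * x + d)" by simp
    then have "denom3 (cmat A) (emb z) = (c * x + d)\<^sup>2 + c\<^sup>2 * y\<^sup>2"
      unfolding denom3_def by (simp add: cmat_def emb_def defs) (metis norm_of_real of_real_add of_real_mult power2_abs)
    then show ?thesis by (simp add: N_def power_mult_distrib)
  qed
  have N0: "N > 0" using denom3_pos[of "cmat A" "emb z"] A z dN by (simp add: cmat_simps emb_H3)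
  have "moebius3 (cmat A) (emb z) = (of_real (((a * x + b) * (c * x + d) + a * c * y\<^sup>2) / N), y / N)"
    unfolding moebius3_eq dN by (simp add: cmat_def emb_def defs)
  moreover have "moebius2 A z = Complex (((a * x + b) * (c * x + d) + a * c * y\<^sup>2) / N) (y / N)"
  proof -
    have "of_real p * z + of_real q = Complex (p * x + q) (p * y)" for p q by (simp add: complex_eq_iff defs)
    then have "moebius2 A z = Complex (a * x + b) (a * y) / Complex (c * x + d) (c * y)"
      unfolding moebius2_def by (simp only: defs)
    also have "\<dots> = Complex (((a * x + b) * (c * x + d) + a * c * y\<^sup>2) / N) ((a * d - b * c) * y / N)"
      by (simp add: complex_eq_iff Re_divide Im_divide N_def) (simp add: algebra_simps power2_eq_square)
    finally show ?thesis by (simp add: det)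
  qed
  ultimately show ?thesis by (simp add: emb_def)
qed

lemma moebius2_H2: "det A = 1 \<Longrightarrow> z \<in> H2 \<Longrightarrow> moebius2 A z \<in> H2"
  using moebius3_H3[of "cmat A" "emb z"] by (simp add: moebius3_emb emb_H3 cmat_simps)

lemma moebius2_one: "moebius2 (mat 1) z = z" by (simp add: moebius2_def mat2_nth)

lemma moebius2_uminus: "moebius2 (- A) z = moebius2 A z"
proof -
  have "of_real (- A$1$1) * z + of_real (- A$1$2) = - (of_real (A$1$1) * z + of_real (A$1$2))"
    "of_real (- A$2$1) * z + of_real (- A$2$2) = - (of_real (A$2$1) * z + of_real (A$2$2))" by simp_all
  then show ?thesis unfolding moebius2_def vector_uminus_component by (simp only: minus_divide_divide)
qed

lemma moebius2_mult:
  assumes "det A = 1" "det B = 1" "z \<in> H2"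
  shows "moebius2 (A ** B) z = moebius2 A (moebius2 B z)"
proof -
  have "emb (moebius2 (A ** B) z) = emb (moebius2 A (moebius2 B z))"
    using assms moebius3_mult[of "cmat A" "cmat B" "emb z"]
    by (simp add: moebius3_emb[symmetric] moebius2_H2 det_mul cmat_simps emb_H3)
  then show ?thesis by (simp add: emb_inj)
qed

lemma dist_H2_emb: "dist_H2 z w = dist_H3 (emb z) (emb w)"
proof -
  have "cmod (complex_of_real (Re z) - complex_of_real (Re w)) = \<bar>Re z - Re w\<bar>"
    by (metis norm_of_real of_real_diff)
  then show ?thesis by (simp add: dist_H2_def dist_H3_def emb_def cmod_power2)
qed

text \<open>The preserved heights 1 and 2 over 0 force \<open>c = 0\<close>; the horizontal motion
  at height 1 then gives \<open>b = 0\<close> and \<open>a = d\<close>. Testing on the plane alone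
  also suits orientation-reversing isometries, because complex conjugation fixes it
  pointwise.\<close>

lemma moebius3_fixes_plane:
  assumes A: "det A = 1" and fx: "\<And>z. z \<in> H2 \<Longrightarrow> moebius3 A (emb z) = emb z"
  shows "A = mat 1 \<or> A = - mat 1"
proof -
  define a b c d where "a = A$1$1" "b = A$1$2" "c = A$2$1" "d = A$2$2"
  note defs = this
  have H: "Complex x t \<in> H2" if "t > 0" for x t using that by (simp add: H2_def)
  have N: "denom3 A (of_real x, t) = 1" if "t > 0" for x t
  proof -
    have "moebius3 A (of_real x, t) = (of_real x, t)" using fx[OF H[OF that, of x]] by (simp add: emb_def)
    then have "t / denom3 A (of_real x, t) = t" by (simp add: moebius3_eq)
    then show ?thesis using that by (metis div_by_0 divide_eq_eq less_irrefl mult_cancel_left2 mult.commute)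
  qed
  have "(cmod d)\<^sup>2 + (cmod c)\<^sup>2 * 1 = 1" "(cmod d)\<^sup>2 + (cmod c)\<^sup>2 * 4 = 1"
    using N[of 1 0] N[of 2 0] by (simp_all add: denom3_def defs)
  then have "(cmod c)\<^sup>2 = 0" and d1: "(cmod d)\<^sup>2 = 1" by linarith+
  then have c: "c = 0" by simp
  have m: "moebius3 A (of_real x, 1) = ((a * of_real x + b) * cnj d, 1)" for x
    using N[of 1 x] c by (simp add: moebius3_eq defs)
  have z: "(a * of_real x + b) * cnj d = of_real x" for x
    using fx[OF H[of 1 x]] m[of x] by (simp add: emb_def)
  have dd: "d * cnj d = 1" using cmod_sq[of d] d1 by simp
  have "b * cnj d = 0" using z[of 0] by simp
  then have b: "b = 0" using dd by auto
  have "a * cnj d = 1" using z[of 1] b by simp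
  then have "a = d" using dd by (metis mult.commute mult.left_commute mult.right_neutral)
  moreover have "a * d = 1" using A c by (simp add: det_2 defs)
  ultimately have "(a - 1) * (a + 1) = 0" by (simp add: algebra_simps)
  then have "a = 1 \<or> a = - 1" by (auto simp: eq_neg_iff_add_eq_0)
  then show ?thesis using \<open>a = d\<close> b c by (auto simp: matrix2_eq_iff mat2_nth defs)
qed

lemma moebius3_eq_imp:
  assumes AB: "det A = 1" "det B = 1" and eq: "\<And>z. z \<in> H2 \<Longrightarrow> moebius3 A (emb z) = moebius3 B (emb z)"
  shows "A = B \<or> A = - B"
proof -
  have dB: "det (adj2 B) = 1" using AB by simp
  have "adj2 B ** A = mat 1 \<or> adj2 B ** A = - mat 1"
  proof (rule moebius3_fixes_plane)
    fix z assume z: "z \<in> H2"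
    then have "moebius3 (adj2 B ** A) (emb z) = moebius3 (adj2 B) (moebius3 B (emb z))"
      using AB dB by (simp add: moebius3_mult emb_H3 eq)
    also have "\<dots> = moebius3 (adj2 B ** B) (emb z)" using AB dB z by (simp add: moebius3_mult emb_H3)
    finally show "moebius3 (adj2 B ** A) (emb z) = emb z" using AB by (simp add: mult_adj2 moebius3_one)
  qed (use AB in \<open>simp add: det_mul\<close>)
  moreover have "A = B ** (adj2 B ** A)" using AB by (simp add: matrix_mul_assoc mult_adj2)
  ultimately show ?thesis by (metis matrix_mul_rid neg_mult2(2))
qed

lemma moebius2_eq_imp:
  assumes AB: "det A = 1" "det B = 1" and eq: "\<And>z. z \<in> H2 \<Longrightarrow> moebius2 A z = moebius2 B z"
  shows "A = B \<or> A = - B"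
proof -
  have "cmat A = cmat B \<or> cmat A = - cmat B"
    by (rule moebius3_eq_imp) (use AB eq in \<open>auto simp: cmat_simps moebius3_emb\<close>)
  then show ?thesis by (auto simp: matrix2_eq_iff cmat_def)
qed

section \<open>Invariance of the hyperbolic volume\<close>

lemma nn_integral_lborel_affine:
  fixes t :: "'a::euclidean_space"
  assumes [measurable]: "f \<in> borel_measurable borel" and c: "c \<noteq> 0"
  shows "(\<integral>\<^sup>+x. f x \<partial>lborel) = ennreal (\<bar>c\<bar> ^ DIM('a)) * (\<integral>\<^sup>+x. f (t + c *\<^sub>R x) \<partial>lborel)"
  by (subst lborel_affine[OF c, of t])
     (simp add: nn_integral_density nn_integral_distr nn_integral_cmult)

lemma nn_integral_lborel_reflect:
  fixes e :: "'a::euclidean_space"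
  assumes [measurable]: "f \<in> borel_measurable borel" and e: "e \<in> Basis"
  shows "(\<integral>\<^sup>+x. f (x - (2 * (x \<bullet> e)) *\<^sub>R e) \<partial>lborel) = (\<integral>\<^sup>+x. f x \<partial>lborel)"
proof -
  let ?c = "\<lambda>j. if j = e then -1 else 1 :: real"
  let ?T = "\<lambda>x. 0 + (\<Sum>j\<in>Basis. (?c j * (x \<bullet> j)) *\<^sub>R j)"
  have T: "?T x = x - (2 * (x \<bullet> e)) *\<^sub>R e" for x
    using e by (intro euclidean_eqI[of "?T x"]) (auto simp: inner_diff_left inner_Basis)
  have "lborel = density (distr lborel borel ?T) (\<lambda>_. \<Prod>j\<in>Basis. \<bar>?c j\<bar>)"
    by (rule lborel_affine_euclidean) auto
  also have "(\<Prod>j\<in>(Basis::'a set). \<bar>?c j\<bar>) = 1" by (rule prod.neutral) auto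
  finally have "lborel = distr lborel borel (\<lambda>x. x - (2 * (x \<bullet> e)) *\<^sub>R e)"
    unfolding T by (simp add: density_1)
  then have "(\<integral>\<^sup>+x. f x \<partial>lborel) = (\<integral>\<^sup>+x. f x \<partial>distr lborel borel (\<lambda>x. x - (2 * (x \<bullet> e)) *\<^sub>R e))" by simp
  also have "\<dots> = (\<integral>\<^sup>+x. f (x - (2 * (x \<bullet> e)) *\<^sub>R e) \<partial>lborel)" by (simp add: nn_integral_distr)
  finally show ?thesis ..
qed

text \<open>Averaging over the dilations turns the inversion into the substitution \<open>\<tau> \<mapsto> c - \<tau>\<close> on the real line,
  so no Jacobian is needed.\<close>

lemma nn_integral_inversion:
  fixes \<phi> f :: "'a::euclidean_space \<Rightarrow> ennreal"
  assumes [measurable]: "\<phi> \<in> borel_measurable borel" "f \<in> borel_measurable borel"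
    and \<phi>0: "\<phi> 0 = 0" and hom: "\<And>s x. s > 0 \<Longrightarrow> ennreal (s ^ DIM('a)) * \<phi> (s *\<^sub>R x) = \<phi> x"
  shows "(\<integral>\<^sup>+x. \<phi> x * f ((1 / (norm x)\<^sup>2) *\<^sub>R x) \<partial>lborel) = (\<integral>\<^sup>+x. \<phi> x * f x \<partial>lborel)"
proof -
  \<comment> \<open>A weight of integral 1 on the logarithmic scale; inserting this integral as a
    factor introduces the dilation parameter \<open>\<tau>\<close>.\<close>
  define \<kappa> :: "real \<Rightarrow> ennreal" where "\<kappa> = indicator {0..<1}"
  have [measurable]: "\<kappa> \<in> borel_measurable borel" unfolding \<kappa>_def by simp
  have dil: "(\<integral>\<^sup>+x. \<phi> x * g x \<partial>lborel) = (\<integral>\<^sup>+x. \<phi> x * g (s *\<^sub>R x) \<partial>lborel)"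
    if [measurable]: "g \<in> borel_measurable borel" and s: "s > 0" for g s
  proof -
    have "(\<integral>\<^sup>+x. \<phi> x * g x \<partial>lborel) = ennreal (\<bar>s\<bar> ^ DIM('a)) * (\<integral>\<^sup>+x. \<phi> (0 + s *\<^sub>R x) * g (0 + s *\<^sub>R x) \<partial>lborel)"
      using s by (intro nn_integral_lborel_affine) auto
    also have "\<dots> = (\<integral>\<^sup>+x. ennreal (s ^ DIM('a)) * \<phi> (s *\<^sub>R x) * g (s *\<^sub>R x) \<partial>lborel)"
      using s by (simp add: nn_integral_cmult mult.assoc)
    finally show ?thesis using s by (simp add: hom)
  qed
  have one: "(\<integral>\<^sup>+\<tau>. \<kappa> (\<tau> + c) \<partial>lborel) = 1" for c
  proof -
    have "(\<integral>\<^sup>+\<tau>. \<kappa> \<tau> \<partial>lborel) = (\<integral>\<^sup>+\<tau>. \<kappa> (c + 1 * \<tau>) \<partial>lborel)"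
      using nn_integral_real_affine[of \<kappa> 1 c] by simp
    moreover have "(\<integral>\<^sup>+\<tau>. \<kappa> \<tau> \<partial>lborel) = 1" unfolding \<kappa>_def by simp
    ultimately show ?thesis by (simp add: add.commute)
  qed
  \<comment> \<open>Insert the factor, exchange the integrals and substitute exp(-\<tau>) y for
    \<open>x\<close>. Homogeneity of \<open>\<phi>\<close> absorbs the scaling and leaves an inner
    integral along the ray through \<open>y\<close>.\<close>
  have avg: "(\<integral>\<^sup>+x. \<phi> x * g x \<partial>lborel) = (\<integral>\<^sup>+y. \<phi> y * \<kappa> (ln (norm y)) * (\<integral>\<^sup>+\<tau>. g (exp (- \<tau>) *\<^sub>R y) \<partial>lborel) \<partial>lborel)"
    if [measurable]: "g \<in> borel_measurable borel" for g
  proof -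
    have "(\<integral>\<^sup>+x. \<phi> x * g x \<partial>lborel) = (\<integral>\<^sup>+x. \<phi> x * g x * (\<integral>\<^sup>+\<tau>. \<kappa> (\<tau> + ln (norm x)) \<partial>lborel) \<partial>lborel)"
      by (simp add: one)
    also have "\<dots> = (\<integral>\<^sup>+x. \<integral>\<^sup>+\<tau>. \<phi> x * g x * \<kappa> (\<tau> + ln (norm x)) \<partial>lborel \<partial>lborel)"
      by (simp add: nn_integral_cmult)
    also have "\<dots> = (\<integral>\<^sup>+\<tau>. \<integral>\<^sup>+x. \<phi> x * g x * \<kappa> (\<tau> + ln (norm x)) \<partial>lborel \<partial>lborel)"
      by (rule lborel_pair.Fubini') measurable
    also have "\<dots> = (\<integral>\<^sup>+\<tau>. \<integral>\<^sup>+y. \<phi> y * \<kappa> (ln (norm y)) * g (exp (- \<tau>) *\<^sub>R y) \<partial>lborel \<partial>lborel)"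
    proof (rule nn_integral_cong)
      fix \<tau> :: real
      have "(\<integral>\<^sup>+x. \<phi> x * (g x * \<kappa> (\<tau> + ln (norm x))) \<partial>lborel)
        = (\<integral>\<^sup>+x. \<phi> x * (g (exp (- \<tau>) *\<^sub>R x) * \<kappa> (\<tau> + ln (norm (exp (- \<tau>) *\<^sub>R x)))) \<partial>lborel)"
        by (rule dil) auto
      also have "\<dots> = (\<integral>\<^sup>+y. \<phi> y * \<kappa> (ln (norm y)) * g (exp (- \<tau>) *\<^sub>R y) \<partial>lborel)"
      proof (rule nn_integral_cong)
        fix y :: 'a
        show "\<phi> y * (g (exp (- \<tau>) *\<^sub>R y) * \<kappa> (\<tau> + ln (norm (exp (- \<tau>) *\<^sub>R y)))) = \<phi> y * \<kappa> (ln (norm y)) * g (exp (- \<tau>) *\<^sub>R y)"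
        proof (cases "y = 0")
          case False
          then have "\<tau> + ln (norm (exp (- \<tau>) *\<^sub>R y)) = ln (norm y)" by (simp add: ln_mult)
          then show ?thesis by (simp add: mult_ac)
        qed (simp add: \<phi>0)
      qed
      finally show "(\<integral>\<^sup>+x. \<phi> x * g x * \<kappa> (\<tau> + ln (norm x)) \<partial>lborel) = (\<integral>\<^sup>+y. \<phi> y * \<kappa> (ln (norm y)) * g (exp (- \<tau>) *\<^sub>R y) \<partial>lborel)"
        by (simp add: mult.assoc)
    qed
    also have "\<dots> = (\<integral>\<^sup>+y. \<integral>\<^sup>+\<tau>. \<phi> y * \<kappa> (ln (norm y)) * g (exp (- \<tau>) *\<^sub>R y) \<partial>lborel \<partial>lborel)"
      by (rule lborel_pair.Fubini') measurable
    also have "\<dots> = (\<integral>\<^sup>+y. \<phi> y * \<kappa> (ln (norm y)) * (\<integral>\<^sup>+\<tau>. g (exp (- \<tau>) *\<^sub>R y) \<partial>lborel) \<partial>lborel)"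
      by (simp add: nn_integral_cmult)
    finally show ?thesis .
  qed
  have [measurable]: "(\<lambda>x::'a. (1 / (norm x)\<^sup>2) *\<^sub>R x) \<in> borel_measurable borel" by measurable
  have "(\<integral>\<^sup>+\<tau>. f ((1 / (norm (exp (- \<tau>) *\<^sub>R y))\<^sup>2) *\<^sub>R (exp (- \<tau>) *\<^sub>R y)) \<partial>lborel) = (\<integral>\<^sup>+\<tau>. f (exp (- \<tau>) *\<^sub>R y) \<partial>lborel)" for y
  proof (cases "y = 0")
    case False
    \<comment> \<open>On the ray through \<open>y\<close> the inversion replaces \<tau> by 2 ln |y|
      - \<tau>.\<close>
    have "(1 / (norm (exp (- \<tau>) *\<^sub>R y))\<^sup>2) *\<^sub>R (exp (- \<tau>) *\<^sub>R y) = exp (- (2 * ln (norm y) + - 1 * \<tau>)) *\<^sub>R y" for \<tau>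
    proof -
      have "exp (- (2 * ln (norm y) + - 1 * \<tau>)) = exp \<tau> / (exp (ln (norm y)))\<^sup>2"
        by (simp add: exp_diff exp_double[symmetric] mult.commute)
      also have "\<dots> = exp \<tau> / (norm y)\<^sup>2" using False by simp
      also have "\<dots> = (1 / (norm (exp (- \<tau>) *\<^sub>R y))\<^sup>2) * exp (- \<tau>)"
        by (simp add: exp_minus power2_eq_square field_simps)
      finally show ?thesis by simp
    qed
    then have "(\<integral>\<^sup>+\<tau>. f ((1 / (norm (exp (- \<tau>) *\<^sub>R y))\<^sup>2) *\<^sub>R (exp (- \<tau>) *\<^sub>R y)) \<partial>lborel)
      = (\<integral>\<^sup>+\<tau>. f (exp (- (2 * ln (norm y) + - 1 * \<tau>)) *\<^sub>R y) \<partial>lborel)" by (simp only:)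
    also have "\<dots> = (\<integral>\<^sup>+\<tau>. f (exp (- \<tau>) *\<^sub>R y) \<partial>lborel)"
      by (subst nn_integral_real_affine[of "\<lambda>\<tau>. f (exp (- \<tau>) *\<^sub>R y)" "-1" "2 * ln (norm y)"]) auto
    finally show ?thesis .
  qed simp
  then show ?thesis by (simp add: avg[of f] avg[of "\<lambda>x. f ((1 / (norm x)\<^sup>2) *\<^sub>R x)"])
qed

lemma borel_measurable_fst_snd [measurable (raw)]:
  fixes f :: "'c \<Rightarrow> 'a::second_countable_topology \<times> 'b::second_countable_topology"
  assumes "f \<in> borel_measurable M"
  shows "(\<lambda>x. fst (f x)) \<in> borel_measurable M" "(\<lambda>x. snd (f x)) \<in> borel_measurable M"
  by (rule measurable_compose[OF assms], intro borel_measurable_continuous_onI continuous_intros)+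

lemma H3_borel [measurable]: "H3 \<in> sets borel"
proof -
  have "H3 = {p. snd p > 0}" by (auto simp: H3_def)
  moreover have "open {p :: complex \<times> real. snd p > 0}" by (intro open_Collect_less continuous_intros)
  ultimately show ?thesis by simp
qed

lemma H2_borel [measurable]: "H2 \<in> sets borel"
  unfolding H2_def by (intro borel_open open_halfspace_Im_gt)

lemma moebius3_measurable [measurable]: "moebius3 A \<in> borel \<rightarrow>\<^sub>M borel"
proof -
  have eq: "moebius3 A = (\<lambda>p. (((A$1$1 * fst p + A$1$2) * cnj (A$2$1 * fst p + A$2$2) + A$1$1 * cnj (A$2$1) * of_real ((snd p)\<^sup>2)) / of_real (denom3 A p),
    snd p / denom3 A p))"
    by (rule ext) (rule moebius3_eq)
  have [measurable]: "denom3 A \<in> borel_measurable borel" unfolding denom3_def by measurable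
  have [measurable]: "cnj \<in> borel_measurable borel" by (intro borel_measurable_continuous_onI continuous_intros)
  show ?thesis unfolding eq by measurable
qed

lemma moebius2_measurable [measurable]: "moebius2 A \<in> borel \<rightarrow>\<^sub>M borel"
  unfolding moebius2_def by measurable

lemma nn_integral_vol_H3:
  assumes [measurable]: "f \<in> borel_measurable borel"
  shows "(\<integral>\<^sup>+p. f p \<partial>vol_H3) = (\<integral>\<^sup>+p. indicator H3 p * ennreal (1 / (snd p) ^ 3) * f p \<partial>lborel)"
  unfolding vol_H3_def by (subst nn_integral_density) (auto simp: mult_ac)

lemma nn_integral_vol_H2:
  assumes [measurable]: "f \<in> borel_measurable borel"
  shows "(\<integral>\<^sup>+z. f z \<partial>vol_H2) = (\<integral>\<^sup>+z. indicator H2 z * ennreal (1 / (Im z)\<^sup>2) * f z \<partial>lborel)"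
  unfolding vol_H2_def by (subst nn_integral_density) (auto simp: mult_ac)

lemma DIM_H3: "DIM(complex \<times> real) = 3" by simp

lemma vol_H3_transl:
  assumes [measurable]: "f \<in> borel_measurable borel"
  shows "(\<integral>\<^sup>+p. f (moebius3 (transl b) p) \<partial>vol_H3) = (\<integral>\<^sup>+p. f p \<partial>vol_H3)"
proof -
  let ?\<phi> = "\<lambda>p. indicator H3 p * ennreal (1 / (snd p) ^ 3)"
  have "(\<integral>\<^sup>+p. ?\<phi> p * f p \<partial>lborel) = ennreal (\<bar>1\<bar> ^ DIM(complex \<times> real)) * (\<integral>\<^sup>+p. ?\<phi> ((b, 0) + 1 *\<^sub>R p) * f ((b, 0) + 1 *\<^sub>R p) \<partial>lborel)"
    by (rule nn_integral_lborel_affine) auto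
  also have "\<dots> = (\<integral>\<^sup>+p. ?\<phi> p * f (moebius3 (transl b) p) \<partial>lborel)"
    by (simp, intro nn_integral_cong) (auto simp: moebius3_transl H3_def indicator_def add.commute)
  finally show ?thesis by (simp add: nn_integral_vol_H3)
qed

text \<open>\<open>weyl\<close> is the inversion in the unit sphere followed by the reflection that
  negates the real part. The density t^-3 is homogeneous of degree minus the dimension, as the
  inversion lemma demands.\<close>

lemma vol_H3_weyl:
  assumes [measurable]: "f \<in> borel_measurable borel"
  shows "(\<integral>\<^sup>+p. f (moebius3 weyl p) \<partial>vol_H3) = (\<integral>\<^sup>+p. f p \<partial>vol_H3)"
proof -
  let ?\<phi> = "\<lambda>p :: complex \<times> real. indicator H3 p * ennreal (1 / (snd p) ^ 3)"
  let ?e = "(1, 0) :: complex \<times> real"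
  define R where "R p = p - (2 * (p \<bullet> ?e)) *\<^sub>R ?e" for p
  have R: "R p = (- cnj (fst p), snd p)" for p
    by (rule prod_eqI) (auto simp: R_def complex_eq_iff inner_prod_def inner_complex_def)
  have [measurable]: "R \<in> borel \<rightarrow>\<^sub>M borel" unfolding R_def by measurable
  have e: "?e \<in> Basis" by (simp add: Basis_prod_def Basis_complex_def)
  have w: "moebius3 weyl p = R ((1 / (norm p)\<^sup>2) *\<^sub>R p)" for p
    by (auto simp: moebius3_weyl R norm_prod_def complex_eq_iff scaleR_prod_def)
  have hom: "ennreal (s ^ DIM(complex \<times> real)) * ?\<phi> (s *\<^sub>R x) = ?\<phi> x" if "s > 0" for s x
  proof (cases "x \<in> H3")
    case True
    then have "s *\<^sub>R x \<in> H3" using that by (simp add: H3_iff)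
    then show ?thesis using True that unfolding DIM_H3
      by (simp add: H3_iff ennreal_mult[symmetric] power_mult_distrib)
  next
    case False
    then have "s *\<^sub>R x \<notin> H3" using that by (simp add: H3_iff zero_less_mult_iff)
    then show ?thesis using False by simp
  qed
  have "(\<integral>\<^sup>+p. ?\<phi> p * f (R ((1 / (norm p)\<^sup>2) *\<^sub>R p)) \<partial>lborel) = (\<integral>\<^sup>+p. ?\<phi> p * f (R p) \<partial>lborel)"
    by (rule nn_integral_inversion[of ?\<phi> "\<lambda>p. f (R p)"]) (use hom in \<open>auto simp: H3_def\<close>)
  also have "\<dots> = (\<integral>\<^sup>+p. ?\<phi> (R p) * f (R p) \<partial>lborel)"
    by (intro nn_integral_cong) (auto simp: R H3_def indicator_def)
  also have "\<dots> = (\<integral>\<^sup>+p. ?\<phi> p * f p \<partial>lborel)"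
    unfolding R_def using e by (intro nn_integral_lborel_reflect[of "\<lambda>p. ?\<phi> p * f p"]) auto
  finally show ?thesis by (simp add: nn_integral_vol_H3 w)
qed

lemma vol_H2_transl:
  assumes [measurable]: "f \<in> borel_measurable borel"
  shows "(\<integral>\<^sup>+z. f (moebius2 (transl b) z) \<partial>vol_H2) = (\<integral>\<^sup>+z. f z \<partial>vol_H2)"
proof -
  let ?\<phi> = "\<lambda>z. indicator H2 z * ennreal (1 / (Im z)\<^sup>2)"
  have "(\<integral>\<^sup>+z. ?\<phi> z * f z \<partial>lborel) = ennreal (\<bar>1\<bar> ^ DIM(complex)) * (\<integral>\<^sup>+z. ?\<phi> (of_real b + 1 *\<^sub>R z) * f (of_real b + 1 *\<^sub>R z) \<partial>lborel)"
    by (rule nn_integral_lborel_affine) auto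
  also have "\<dots> = (\<integral>\<^sup>+z. ?\<phi> z * f (moebius2 (transl b) z) \<partial>lborel)"
    by (simp, intro nn_integral_cong) (auto simp: moebius2_def transl_def H2_def indicator_def add.commute)
  finally show ?thesis by (simp add: nn_integral_vol_H2)
qed

lemma vol_H2_weyl:
  assumes [measurable]: "f \<in> borel_measurable borel"
  shows "(\<integral>\<^sup>+z. f (moebius2 weyl z) \<partial>vol_H2) = (\<integral>\<^sup>+z. f z \<partial>vol_H2)"
proof -
  let ?\<phi> = "\<lambda>z. indicator H2 z * ennreal (1 / (Im z)\<^sup>2)"
  define R where "R z = z - (2 * (z \<bullet> 1)) *\<^sub>R 1" for z :: complex
  have R: "R z = - cnj z" for z by (auto simp: R_def complex_eq_iff inner_complex_def)
  have [measurable]: "R \<in> borel \<rightarrow>\<^sub>M borel" unfolding R_def by measurable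
  have w: "moebius2 weyl z = R ((1 / (norm z)\<^sup>2) *\<^sub>R z)" for z
  proof -
    have "- (1 / z) = R ((1 / (norm z)\<^sup>2) *\<^sub>R z)"
      unfolding R by (simp add: complex_div_cnj[of 1 z] scaleR_conv_of_real)
    then show ?thesis by (simp add: moebius2_def weyl_def)
  qed
  have hom: "ennreal (s ^ DIM(complex)) * ?\<phi> (s *\<^sub>R x) = ?\<phi> x" if "s > 0" for s x
  proof (cases "x \<in> H2")
    case True
    then have "s *\<^sub>R x \<in> H2" using that by (simp add: H2_def)
    then show ?thesis using True that
      by (simp add: H2_def ennreal_mult[symmetric] power_mult_distrib)
  next
    case False
    then have "s *\<^sub>R x \<notin> H2" using that by (simp add: H2_def zero_less_mult_iff)
    then show ?thesis using False by simp
  qed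
  have "(\<integral>\<^sup>+z. ?\<phi> z * f (R ((1 / (norm z)\<^sup>2) *\<^sub>R z)) \<partial>lborel) = (\<integral>\<^sup>+z. ?\<phi> z * f (R z) \<partial>lborel)"
    by (rule nn_integral_inversion[of ?\<phi> "\<lambda>p. f (R p)"]) (use hom in \<open>auto simp: H2_def\<close>)
  also have "\<dots> = (\<integral>\<^sup>+z. ?\<phi> (R z) * f (R z) \<partial>lborel)"
    by (intro nn_integral_cong) (auto simp: R H2_def indicator_def)
  also have "\<dots> = (\<integral>\<^sup>+z. ?\<phi> z * f z \<partial>lborel)"
    unfolding R_def by (intro nn_integral_lborel_reflect[of "\<lambda>p. ?\<phi> p * f p"]) (auto simp: Basis_complex_def)
  finally show ?thesis by (simp add: nn_integral_vol_H2 w)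
qed

lemma AE_vol_H3: "AE p in vol_H3. p \<in> H3" and AE_vol_H2: "AE z in vol_H2. z \<in> H2"
proof -
  show "AE p in vol_H3. p \<in> H3" unfolding vol_H3_def by (subst AE_density) (measurable, auto simp: indicator_def)
  show "AE z in vol_H2. z \<in> H2" unfolding vol_H2_def by (subst AE_density) (measurable, auto simp: indicator_def)
qed

lemma sets_vol [simp]: "sets vol_H3 = sets borel" "sets vol_H2 = sets borel"
  by (simp_all add: vol_H3_def vol_H2_def)

lemma vol_H3_moebius3:
  assumes "det A = 1" "f \<in> borel_measurable borel"
  shows "(\<integral>\<^sup>+p. f (moebius3 A p) \<partial>vol_H3) = (\<integral>\<^sup>+p. f p \<partial>vol_H3)"
  using assms
proof (induction A arbitrary: f rule: SL2_induct)
  case one then show ?case by (simp add: moebius3_one)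
next
  case (transl b B)
  have "(\<integral>\<^sup>+p. f (moebius3 (transl b ** B) p) \<partial>vol_H3) = (\<integral>\<^sup>+p. f (moebius3 (transl b) (moebius3 B p)) \<partial>vol_H3)"
    using AE_vol_H3 transl by (intro nn_integral_cong_AE) (auto simp: moebius3_transl_mult)
  also have "\<dots> = (\<integral>\<^sup>+p. f (moebius3 (transl b) p) \<partial>vol_H3)"
    by (rule transl.IH) (use transl.prems in measurable)
  finally show ?case using transl.prems by (simp add: vol_H3_transl)
next
  case (weyl B)
  have "(\<integral>\<^sup>+p. f (moebius3 (weyl ** B) p) \<partial>vol_H3) = (\<integral>\<^sup>+p. f (moebius3 weyl (moebius3 B p)) \<partial>vol_H3)"
    using AE_vol_H3 weyl by (intro nn_integral_cong_AE) (auto simp: moebius3_weyl_mult)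
  also have "\<dots> = (\<integral>\<^sup>+p. f (moebius3 weyl p) \<partial>vol_H3)"
    by (rule weyl.IH) (use weyl.prems in measurable)
  finally show ?case using weyl.prems by (simp add: vol_H3_weyl)
qed

lemma vol_H2_moebius2:
  assumes "det A = 1" "f \<in> borel_measurable borel"
  shows "(\<integral>\<^sup>+p. f (moebius2 A p) \<partial>vol_H2) = (\<integral>\<^sup>+p. f p \<partial>vol_H2)"
  using assms
proof (induction A arbitrary: f rule: SL2_induct)
  case one then show ?case by (simp add: moebius2_one)
next
  case (transl b B)
  have "(\<integral>\<^sup>+p. f (moebius2 (transl b ** B) p) \<partial>vol_H2) = (\<integral>\<^sup>+p. f (moebius2 (transl b) (moebius2 B p)) \<partial>vol_H2)"
    using AE_vol_H2 transl by (intro nn_integral_cong_AE) (auto simp: moebius2_mult)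
  also have "\<dots> = (\<integral>\<^sup>+p. f (moebius2 (transl b) p) \<partial>vol_H2)"
    by (rule transl.IH) (use transl.prems in measurable)
  finally show ?case using transl.prems by (simp add: vol_H2_transl)
next
  case (weyl B)
  have "(\<integral>\<^sup>+p. f (moebius2 (weyl ** B) p) \<partial>vol_H2) = (\<integral>\<^sup>+p. f (moebius2 weyl (moebius2 B p)) \<partial>vol_H2)"
    using AE_vol_H2 weyl by (intro nn_integral_cong_AE) (auto simp: moebius2_mult)
  also have "\<dots> = (\<integral>\<^sup>+p. f (moebius2 weyl p) \<partial>vol_H2)"
    by (rule weyl.IH) (use weyl.prems in measurable)
  finally show ?case using weyl.prems by (simp add: vol_H2_weyl)
qed

section \<open>Groups of finite covolume are not elementary\<close>

text \<open>Plane and space are treated at once. \<open>P0\<close> is a test set for elementary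
  groups: it has infinite volume, yet the axis-preserving matrices that bring some point of it back
  into it form a bounded set.\<close>

locale invariant_action =
  fixes X :: "'p::euclidean_space set" and vol :: "'p measure" and mo :: "'f::{real_normed_field,euclidean_space}^2^2 \<Rightarrow> 'p \<Rightarrow> 'p"
    and P0 :: "'p set"
  assumes mo_one: "mo (mat 1) x = x" and mo_uminus: "mo (- A) x = mo A x"
    and mo_mult: "det A = 1 \<Longrightarrow> det B = 1 \<Longrightarrow> x \<in> X \<Longrightarrow> mo (A ** B) x = mo A (mo B x)"
    and mo_measurable [measurable]: "mo A \<in> borel \<rightarrow>\<^sub>M borel"
    and sets_vol [simp, measurable_cong]: "sets vol = sets borel" and AE_vol: "AE x in vol. x \<in> X"
    and vol_invariant: "det A = 1 \<Longrightarrow> f \<in> borel_measurable borel \<Longrightarrow> (\<integral>\<^sup>+x. f (mo A x) \<partial>vol) = (\<integral>\<^sup>+x. f x \<partial>vol)"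
    and P0: "P0 \<in> sets borel" "P0 \<subseteq> X" "emeasure vol P0 = \<infinity>"
    and P0_bounded: "bounded {A. det A = 1 \<and> ((A$1$2 = 0 \<and> A$2$1 = 0) \<or> (A$1$1 = 0 \<and> A$2$2 = 0)) \<and> (\<exists>x\<in>P0. mo A x \<in> P0)}"
begin

lemma mo_adj: "det A = 1 \<Longrightarrow> x \<in> X \<Longrightarrow> mo (adj2 A) (mo A x) = x"
  using mo_mult[of "adj2 A" A x] by (simp add: mult_adj2 mo_one)

text \<open>The infinite integral of \<open>f\<close> is unfolded over the translates of
  \<open>F\<close>. It is at most the integral over \<open>F\<close> of the number of
  \<open>A\<close> that bring a point into the set where \<open>f\<close> is 1. Any two such
  \<open>A\<close> differ by a return element of \<open>P0\<close>, so this number is at most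
  \<open>m\<close>.\<close>

lemma packing:
  assumes G: "matrix_group G" "countable G" and Q: "det Q = 1"
    and fin: "finite {C. \<exists>A\<in>G. C = Q ** A ** adj2 Q \<and> (\<exists>x\<in>P0. mo C x \<in> P0)}"
    and F: "F \<in> sets borel" "emeasure vol F < \<infinity>" "X = (\<Union>A\<in>G. mo A ` F)" "F \<subseteq> X"
  shows False
proof -
  interpret matrix_group G by fact
  define S where "S = {C. \<exists>A\<in>G. C = Q ** A ** adj2 Q \<and> (\<exists>x\<in>P0. mo C x \<in> P0)}"
  define m where "m = card S"
  note [measurable] = P0(1) F(1)
  have QQ: "adj2 Q ** Q = mat 1" "Q ** adj2 Q = mat 1" using Q by (simp_all add: mult_adj2)
  define f :: "'p \<Rightarrow> ennreal" where "f x = indicator P0 (mo Q x)" for x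
  have fm[measurable]: "f \<in> borel_measurable borel" unfolding f_def by measurable
  have inf: "(\<integral>\<^sup>+x. f x \<partial>vol) = \<infinity>"
    unfolding f_def using vol_invariant[OF Q, of "indicator P0"] P0 by simp
  have bound: "(\<integral>\<^sup>+A. f (mo A y) \<partial>count_space G) \<le> of_nat m" if y: "y \<in> X" for y
  proof -
    define T where "T = {A \<in> G. mo Q (mo A y) \<in> P0}"
    have T: "finite T \<and> card T \<le> m"
    proof (cases "T = {}")
      case False
      then obtain A where A: "A \<in> G" "mo Q (mo A y) \<in> P0" by (auto simp: T_def)
      \<comment> \<open>With one visit \<open>A\<close> fixed, dividing the others by it and passing
        to the frame \<open>Q\<close> turns visits into return elements injectively.\<close>
      let ?h = "\<lambda>B. Q ** (B ** adj2 A) ** adj2 Q"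
      have inj: "inj_on ?h T"
      proof (rule inj_onI)
        fix B B' assume "?h B = ?h B'"
        then have "adj2 Q ** ?h B ** (Q ** A) = adj2 Q ** ?h B' ** (Q ** A)" by simp
        moreover have "adj2 Q ** ?h B ** (Q ** A) = B" for B
        proof -
          have "adj2 Q ** ?h B ** (Q ** A) = (adj2 Q ** Q) ** B ** adj2 A ** (adj2 Q ** Q) ** A" by (simp add: matrix_mul_assoc)
          then show ?thesis by (simp add: QQ matrix_mul_assoc[symmetric] mult_adj2 det_one[OF A(1)] Q)
        qed
        ultimately show "B = B'" by simp
      qed
      have "?h ` T \<subseteq> S"
      proof
        fix C assume "C \<in> ?h ` T"
        then obtain B where B: "B \<in> G" "mo Q (mo B y) \<in> P0" "C = ?h B" by (auto simp: T_def)
        note d = det_one[OF A(1)] det_one[OF B(1)]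
        have e1: "mo (Q ** A) y = mo Q (mo A y)" "mo (Q ** B) y = mo Q (mo B y)" using d Q y by (simp_all add: mo_mult)
        have "C ** (Q ** A) = Q ** B ** (adj2 A ** (adj2 Q ** Q) ** A)" unfolding B(3) by (simp add: matrix_mul_assoc)
        also have "\<dots> = Q ** B ** (adj2 A ** A)" by (simp only: QQ matrix_mul_rid)
        finally have "C ** (Q ** A) = Q ** B" by (simp add: mult_adj2 d)
        moreover have "det C = 1" "det (Q ** A) = 1" unfolding B(3) using d Q by (simp_all add: det_mul)
        ultimately have "mo C (mo (Q ** A) y) = mo (Q ** B) y" using y by (metis mo_mult)
        then have "\<exists>x\<in>P0. mo C x \<in> P0" using A(2) B(2) e1
          by (intro bexI[of _ "mo Q (mo A y)"]) simp_all
        then show "C \<in> S" unfolding S_def using B(1,3) A(1) adj_mem mult_mem by blast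
      qed
      moreover have "finite S" using fin unfolding S_def .
      ultimately have "finite (?h ` T)" "card (?h ` T) \<le> m" unfolding m_def by (auto intro: finite_subset card_mono)
      then show ?thesis using inj by (simp add: card_image finite_image_iff)
    qed simp
    have "(\<integral>\<^sup>+A. f (mo A y) \<partial>count_space G) = (\<integral>\<^sup>+A. indicator T A \<partial>count_space G)"
      by (intro nn_integral_cong) (auto simp: f_def T_def indicator_def)
    also have "\<dots> = emeasure (count_space G) T" by (rule nn_integral_indicator) (auto simp: T_def)
    also have "\<dots> = of_nat (card T)" using T by (intro emeasure_count_space_finite) (auto simp: T_def)
    also have "\<dots> \<le> of_nat m" using T by simp
    finally show ?thesis .
  qed
  have "(\<integral>\<^sup>+x. f x \<partial>vol) \<le> (\<integral>\<^sup>+x. (\<integral>\<^sup>+A. f x * indicator F (mo (adj2 A) x) \<partial>count_space G) \<partial>vol)"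
  proof (intro nn_integral_mono_AE, use AE_vol in eventually_elim)
    fix x assume "x \<in> X"
    \<comment> \<open>A single translate of \<open>F\<close> containing \<open>x\<close> already
      contributes \<open>f x\<close> to the sum over the group.\<close>
    then obtain A y where A: "A \<in> G" "y \<in> F" "x = mo A y" using F(3) by blast
    have "mo (adj2 A) x = y" unfolding A(3) using A F(4) det_one by (intro mo_adj) auto
    then have "f x = (\<integral>\<^sup>+B. f x * indicator F (mo (adj2 B) x) * indicator {A} B \<partial>count_space G)"
      using A by (subst nn_integral_indicator_singleton) auto
    also have "\<dots> \<le> (\<integral>\<^sup>+A. f x * indicator F (mo (adj2 A) x) \<partial>count_space G)"
      by (intro nn_integral_mono) (auto simp: indicator_def)
    finally show "f x \<le> (\<integral>\<^sup>+A. f x * indicator F (mo (adj2 A) x) \<partial>count_space G)" .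
  qed
  also have "\<dots> = (\<integral>\<^sup>+A. (\<integral>\<^sup>+x. f x * indicator F (mo (adj2 A) x) \<partial>vol) \<partial>count_space G)"
    by (rule nn_integral_count_space_nn_integral) (use G in auto)
  also have "\<dots> = (\<integral>\<^sup>+A. (\<integral>\<^sup>+x. f (mo A x) * indicator F x \<partial>vol) \<partial>count_space G)"
  proof (rule nn_integral_cong)
    fix A assume "A \<in> space (count_space G)"
    then have d: "det A = 1" using det_one by simp
    have "(\<integral>\<^sup>+x. f x * indicator F (mo (adj2 A) x) \<partial>vol) = (\<integral>\<^sup>+x. f (mo A x) * indicator F (mo (adj2 A) (mo A x)) \<partial>vol)"
      by (rule vol_invariant[OF d, of "\<lambda>x. f x * indicator F (mo (adj2 A) x)", symmetric]) measurable
    also have "\<dots> = (\<integral>\<^sup>+x. f (mo A x) * indicator F x \<partial>vol)"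
      using AE_vol by (intro nn_integral_cong_AE) (auto simp: mo_adj d)
    finally show "(\<integral>\<^sup>+x. f x * indicator F (mo (adj2 A) x) \<partial>vol) = (\<integral>\<^sup>+x. f (mo A x) * indicator F x \<partial>vol)" .
  qed
  also have "\<dots> = (\<integral>\<^sup>+x. (\<integral>\<^sup>+A. f (mo A x) * indicator F x \<partial>count_space G) \<partial>vol)"
    by (rule nn_integral_count_space_nn_integral[symmetric]) (use G in auto)
  also have "\<dots> \<le> (\<integral>\<^sup>+x. of_nat m * indicator F x \<partial>vol)"
  proof (intro nn_integral_mono)
    fix x
    show "(\<integral>\<^sup>+A. f (mo A x) * indicator F x \<partial>count_space G) \<le> of_nat m * indicator F x"
      using bound[of x] F(4) by (cases "x \<in> F") auto
  qed
  also have "\<dots> = of_nat m * emeasure vol F" by (rule nn_integral_cmult_indicator) simp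
  also have "\<dots> < \<infinity>" using F(2) by (simp add: ennreal_mult_less_top less_top of_nat_less_top)
  finally show False using inf by simp
qed

lemma finite_covolume_nonelementary:
  assumes \<Gamma>: "subgroup \<Gamma> PSL2" and disc: "discrete (\<Union>\<Gamma>)"
    and cov: "finite_covolume X vol (\<lambda>\<gamma>. mo (SOME A. A \<in> \<gamma>)) \<Gamma>"
    and A: "A \<in> \<Union>\<Gamma>" "A = P ** mat22 u 0 0 (inverse u) ** adj2 P" and P: "det P = 1" and u: "norm u > 1"
  shows "nonelementary_at (\<Union>\<Gamma>) P"
proof (rule ccontr)
  assume ne: "\<not> nonelementary_at (\<Union>\<Gamma>) P"
  let ?G = "\<Union>\<Gamma>" and ?Q = "adj2 P"
  note lifts = subgroup_PSL2_lifts[OF \<Gamma>]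
  interpret matrix_group ?G by (rule lifts(1))
  interpret G: locally_finite_group ?G
    by unfold_locales (rule discrete_finite_bounded[OF lifts(1) disc])
  have Q: "det ?Q = 1" using P by simp
  have QQ: "adj2 ?Q = P" by (simp add: matrix2_eq_iff adj2_nth)
  let ?G' = "(\<lambda>A. ?Q ** A ** P) ` ?G"
  interpret G': locally_finite_group ?G' using G.conj_locally_finite[OF Q] unfolding QQ .
  have PP: "?Q ** P = mat 1" using P by (simp add: mult_adj2)
  have "?Q ** A ** P = (?Q ** P) ** mat22 u 0 0 (inverse u) ** (?Q ** P)" unfolding A(2) by (simp add: matrix_mul_assoc)
  then have h: "mat22 u 0 0 (inverse u) \<in> ?G'" using A(1) by (intro image_eqI[of _ _ A]) (simp_all add: PP)
  have all: "k$1$1 * k$1$2 * k$2$1 * k$2$2 = 0" if "k \<in> ?G'" for k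
    using ne that unfolding nonelementary_at_def Let_def by blast
  have diag: "(k$1$2 = 0 \<and> k$2$1 = 0) \<or> (k$1$1 = 0 \<and> k$2$2 = 0)" if "k \<in> ?G'" for k
    using G'.diagonal_or_antidiagonal[OF h u all that] by blast
  \<comment> \<open>The returning elements are diagonal or antidiagonal, hence bounded by the choice
    of \<open>P0\<close>, and discreteness leaves finitely many.\<close>
  have fin: "finite {C. \<exists>A\<in>?G. C = ?Q ** A ** adj2 ?Q \<and> (\<exists>x\<in>P0. mo C x \<in> P0)}"
    by (rule finite_subset[OF _ G'.finite_bounded[OF P0_bounded]]) (use diag G'.det_one in \<open>auto simp: QQ\<close>)
  obtain F where F: "fundamental_domain X vol (\<lambda>\<gamma>. mo (SOME A. A \<in> \<gamma>)) \<Gamma> F" "emeasure vol F < \<infinity>"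
    using cov by (auto simp: finite_covolume_def)
  have act: "mo (SOME A. A \<in> \<gamma>) = mo A" if "\<gamma> \<in> \<Gamma>" "A \<in> \<gamma>" for \<gamma> A
  proof -
    have "(SOME A. A \<in> \<gamma>) \<in> \<gamma>" using that(2) by (rule someI)
    then show ?thesis using lifts(3)[OF that] mo_uminus by (auto simp: psl_proj_eq)
  qed
  have "X = (\<Union>A\<in>?G. mo A ` F)"
  proof -
    have "X = (\<Union>\<gamma>\<in>\<Gamma>. mo (SOME A. A \<in> \<gamma>) ` F)" using F(1) by (simp add: fundamental_domain_def)
    also have "\<dots> = (\<Union>A\<in>?G. mo A ` F)"
    proof (intro equalityI subsetI)
      fix x assume "x \<in> (\<Union>\<gamma>\<in>\<Gamma>. mo (SOME A. A \<in> \<gamma>) ` F)"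
      then obtain \<gamma> where \<gamma>: "\<gamma> \<in> \<Gamma>" "x \<in> mo (SOME A. A \<in> \<gamma>) ` F" by blast
      obtain A where "A \<in> \<gamma>" using lifts(4)[OF \<gamma>(1)] by (auto simp: psl_proj_eq)
      then have "A \<in> ?G" "x \<in> mo A ` F" using \<gamma> act[OF \<gamma>(1)] by auto
      then show "x \<in> (\<Union>A\<in>?G. mo A ` F)" by blast
    next
      fix x assume "x \<in> (\<Union>A\<in>?G. mo A ` F)"
      then obtain A \<gamma> where "\<gamma> \<in> \<Gamma>" "A \<in> \<gamma>" "x \<in> mo A ` F" by blast
      then show "x \<in> (\<Union>\<gamma>\<in>\<Gamma>. mo (SOME A. A \<in> \<gamma>) ` F)" using act by (intro UN_I[of \<gamma>]) auto
    qed
    finally show ?thesis .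
  qed
  then show False
    using packing[OF lifts(1) G.countable_group Q fin, of F] F by (auto simp: fundamental_domain_def)
qed

end

section \<open>A region of infinite volume beside the axis\<close>

lemma norm_matrix2_le:
  fixes A :: "'f::real_normed_field^2^2"
  shows "norm A \<le> norm (A$1$1) + norm (A$1$2) + norm (A$2$1) + norm (A$2$2)"
proof -
  have r: "norm v \<le> norm (v$1) + norm (v$2)" for v :: "'b::real_normed_vector^2"
    using L2_set_le_sum[of UNIV "\<lambda>i. norm (v$i)"] by (simp add: norm_vec_def sum_2)
  show ?thesis using r[of A] r[of "A$1"] r[of "A$2"] by simp
qed

lemma emeasure_infinite:
  assumes "\<And>n::nat. of_nat n \<le> x" shows "x = (\<infinity>::ennreal)"
proof (rule ccontr)
  assume "x \<noteq> \<infinity>"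
  then obtain n where "x < of_nat n" using ennreal_Ex_less_of_nat[of x] by (auto simp: less_top)
  then show False using assms[of n] by simp
qed

text \<open>A box reaching down to the boundary plane over a square that stays away from 0. Its
  volume is infinite near height 0, while a strong dilation along the axis from 0 to infinity moves
  it off itself.\<close>

definition cusp3 :: "(complex \<times> real) set" where
  "cusp3 = {p. 1 \<le> Re (fst p) \<and> Re (fst p) \<le> 2 \<and> 0 \<le> Im (fst p) \<and> Im (fst p) \<le> 1 \<and> 0 < snd p \<and> snd p \<le> 1}"

definition cusp2 :: "complex set" where
  "cusp2 = {z. 1 \<le> Re z \<and> Re z \<le> 2 \<and> 0 < Im z \<and> Im z \<le> 1}"

lemma cusp3_borel [measurable]: "cusp3 \<in> sets borel"
proof -
  have [measurable]: "Re \<in> borel_measurable borel" "Im \<in> borel_measurable borel"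
    by (intro borel_measurable_continuous_onI continuous_intros)+
  have "cusp3 = {p \<in> space borel. 1 \<le> Re (fst p) \<and> Re (fst p) \<le> 2 \<and> 0 \<le> Im (fst p) \<and> Im (fst p) \<le> 1 \<and> 0 < snd p \<and> snd p \<le> 1}"
    by (simp add: cusp3_def)
  also have "\<dots> \<in> sets borel" by measurable
  finally show ?thesis .
qed

lemma cusp2_borel [measurable]: "cusp2 \<in> sets borel"
proof -
  have [measurable]: "Re \<in> borel_measurable borel" "Im \<in> borel_measurable borel"
    by (intro borel_measurable_continuous_onI continuous_intros)+
  have "cusp2 = {z \<in> space borel. 1 \<le> Re z \<and> Re z \<le> 2 \<and> 0 < Im z \<and> Im z \<le> 1}"
    by (simp add: cusp2_def)
  also have "\<dots> \<in> sets borel" by measurable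
  finally show ?thesis .
qed

lemma vol_cusp3: "emeasure vol_H3 cusp3 = \<infinity>"
proof (rule emeasure_infinite)
  fix n :: nat
  \<comment> \<open>The slab between the heights \<epsilon> and 2 \<epsilon> alone has volume at
    least \<epsilon> / (2 \<epsilon>)^3 = (n + 1)^2 / 2.\<close>
  define \<epsilon> :: real where "\<epsilon> = 1 / (2 * (real n + 1))"
  have \<epsilon>: "\<epsilon> > 0" "2 * \<epsilon> \<le> 1" by (auto simp: \<epsilon>_def field_simps)
  let ?B = "cbox (Complex 1 0, \<epsilon>) (Complex 2 1, 2 * \<epsilon>)"
  have Basis: "(Basis :: (complex \<times> real) set) = {(1,0), (\<i>,0), (0,1)}"
    by (auto simp: Basis_prod_def Basis_complex_def)
  have eB: "emeasure lborel ?B = ennreal \<epsilon>"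
    using \<epsilon> by (subst emeasure_lborel_cbox) (auto simp: Basis inner_complex_def)
  have mem: "p \<in> ?B \<longleftrightarrow> 1 \<le> Re (fst p) \<and> Re (fst p) \<le> 2 \<and> 0 \<le> Im (fst p) \<and> Im (fst p) \<le> 1 \<and> \<epsilon> \<le> snd p \<and> snd p \<le> 2 * \<epsilon>" for p
    by (cases p) (auto simp: mem_box Basis inner_complex_def)
  have c: "ennreal (1 / (2 * \<epsilon>) ^ 3) * indicator ?B p \<le> indicator H3 p * ennreal (1 / (snd p) ^ 3) * indicator cusp3 p" for p
  proof (cases "p \<in> ?B")
    case True
    then have p: "\<epsilon> \<le> snd p" "snd p \<le> 2 * \<epsilon>" "p \<in> cusp3" "p \<in> H3" using \<epsilon> by (auto simp: mem cusp3_def H3_iff)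
    have "1 / (2 * \<epsilon>) ^ 3 \<le> 1 / (snd p) ^ 3" using p \<epsilon> by (intro divide_left_mono power_mono mult_pos_pos zero_less_power) auto
    then show ?thesis using p True by (simp add: ennreal_leI)
  qed simp
  have "real n \<le> 1 / (2 * \<epsilon>) ^ 3 * \<epsilon>"
  proof -
    have "1 / (2 * \<epsilon>) ^ 3 * \<epsilon> = (real n + 1)\<^sup>2 / 2"
      by (simp add: \<epsilon>_def field_simps power2_eq_square power3_eq_cube)
    moreover have "2 * real n \<le> (real n + 1)\<^sup>2" by (simp add: power2_eq_square algebra_simps)
    ultimately show ?thesis by simp
  qed
  then have "ennreal (real n) \<le> ennreal (1 / (2 * \<epsilon>) ^ 3 * \<epsilon>)" by (rule ennreal_leI)
  also have "\<dots> = ennreal (1 / (2 * \<epsilon>) ^ 3) * emeasure lborel ?B" using \<epsilon> by (simp add: eB ennreal_mult[symmetric])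
  also have "\<dots> = (\<integral>\<^sup>+p. ennreal (1 / (2 * \<epsilon>) ^ 3) * indicator ?B p \<partial>lborel)"
    by (simp add: nn_integral_cmult_indicator)
  also have "\<dots> \<le> (\<integral>\<^sup>+p. indicator H3 p * ennreal (1 / (snd p) ^ 3) * indicator cusp3 p \<partial>lborel)"
    by (intro nn_integral_mono c)
  also have "\<dots> = (\<integral>\<^sup>+p. indicator cusp3 p \<partial>vol_H3)" by (rule nn_integral_vol_H3[symmetric]) measurable
  also have "\<dots> = emeasure vol_H3 cusp3" by simp
  finally show "of_nat n \<le> emeasure vol_H3 cusp3" by (simp add: ennreal_of_nat_eq_real_of_nat)
qed

lemma vol_cusp2: "emeasure vol_H2 cusp2 = \<infinity>"
proof (rule emeasure_infinite)
  fix n :: nat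
  \<comment> \<open>In the plane the slab contributes at least \<epsilon> / (2 \<epsilon>)^2 = n +
    1.\<close>
  define \<epsilon> :: real where "\<epsilon> = 1 / (4 * (real n + 1))"
  have \<epsilon>: "\<epsilon> > 0" "2 * \<epsilon> \<le> 1" by (auto simp: \<epsilon>_def field_simps)
  let ?B = "cbox (Complex 1 \<epsilon>) (Complex 2 (2 * \<epsilon>))"
  have eB: "emeasure lborel ?B = ennreal \<epsilon>"
    using \<epsilon> by (subst emeasure_lborel_cbox) (auto simp: Basis_complex_def inner_complex_def)
  have mem: "z \<in> ?B \<longleftrightarrow> 1 \<le> Re z \<and> Re z \<le> 2 \<and> \<epsilon> \<le> Im z \<and> Im z \<le> 2 * \<epsilon>" for z
    by (auto simp: mem_box Basis_complex_def inner_complex_def)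
  have c: "ennreal (1 / (2 * \<epsilon>)\<^sup>2) * indicator ?B z \<le> indicator H2 z * ennreal (1 / (Im z)\<^sup>2) * indicator cusp2 z" for z
  proof (cases "z \<in> ?B")
    case True
    then have p: "\<epsilon> \<le> Im z" "Im z \<le> 2 * \<epsilon>" "z \<in> cusp2" "z \<in> H2" using \<epsilon> by (auto simp: mem cusp2_def H2_def)
    have "1 / (2 * \<epsilon>)\<^sup>2 \<le> 1 / (Im z)\<^sup>2" using p \<epsilon> by (intro divide_left_mono power_mono mult_pos_pos zero_less_power) auto
    then show ?thesis using p True by (simp add: ennreal_leI)
  qed simp
  have "real n \<le> 1 / (2 * \<epsilon>)\<^sup>2 * \<epsilon>"
    by (simp add: \<epsilon>_def field_simps power2_eq_square)
  then have "ennreal (real n) \<le> ennreal (1 / (2 * \<epsilon>)\<^sup>2 * \<epsilon>)" by (rule ennreal_leI)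
  also have "\<dots> = ennreal (1 / (2 * \<epsilon>)\<^sup>2) * emeasure lborel ?B" using \<epsilon> by (simp add: eB ennreal_mult[symmetric])
  also have "\<dots> = (\<integral>\<^sup>+z. ennreal (1 / (2 * \<epsilon>)\<^sup>2) * indicator ?B z \<partial>lborel)"
    by (simp add: nn_integral_cmult_indicator)
  also have "\<dots> \<le> (\<integral>\<^sup>+z. indicator H2 z * ennreal (1 / (Im z)\<^sup>2) * indicator cusp2 z \<partial>lborel)"
    by (intro nn_integral_mono c)
  also have "\<dots> = (\<integral>\<^sup>+z. indicator cusp2 z \<partial>vol_H2)" by (rule nn_integral_vol_H2[symmetric]) measurable
  also have "\<dots> = emeasure vol_H2 cusp2" by simp
  finally show "of_nat n \<le> emeasure vol_H2 cusp2" by (simp add: ennreal_of_nat_eq_real_of_nat)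
qed

text \<open>A diagonal matrix multiplies |z| by the squared norm of its first entry; an antidiagonal
  one scales after an inversion. As |z| lies between 1 and 3 before and after, the scaling is
  bounded. The bound 6 is generous: the largest estimate for a squared entry is 10 * 3.\<close>

lemma cusp3_return_bounded:
  assumes A: "det A = 1" and dg: "(A$1$2 = 0 \<and> A$2$1 = 0) \<or> (A$1$1 = 0 \<and> A$2$2 = 0)"
    and p: "p \<in> cusp3" "moebius3 A p \<in> cusp3"
  shows "norm (A$i$j) \<le> 6"
proof -
  have nz: "1 \<le> cmod (fst p) \<and> cmod (fst p) \<le> 3" if "p \<in> cusp3" for p
  proof
    show "1 \<le> cmod (fst p)" using that complex_Re_le_cmod[of "fst p"] by (simp add: cusp3_def)
    have "cmod (fst p) \<le> \<bar>Re (fst p)\<bar> + \<bar>Im (fst p)\<bar>" by (rule cmod_le)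
    then show "cmod (fst p) \<le> 3" using that by (auto simp: cusp3_def)
  qed
  define z t where "z = fst p" and "t = snd p"
  have z: "1 \<le> cmod z" "cmod z \<le> 3" and t: "0 < t" "t \<le> 1" using nz[OF p(1)] p(1) by (auto simp: z_def t_def cusp3_def)
  note z' = nz[OF p(2)]
  from dg have "norm (A$1$1) \<le> 6 \<and> norm (A$1$2) \<le> 6 \<and> norm (A$2$1) \<le> 6 \<and> norm (A$2$2) \<le> 6"
  proof
    assume d: "A$1$2 = 0 \<and> A$2$1 = 0"
    then have ad: "cmod (A$1$1) * cmod (A$2$2) = 1" 
    proof -
      have "A$1$1 * A$2$2 = 1" using A d by (simp add: det_2)
      then have "cmod (A$1$1 * A$2$2) = 1" by (simp only: norm_one)
      then show ?thesis by (simp add: norm_mult)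
    qed
    then have nz0: "cmod (A$1$1) \<noteq> 0" "cmod (A$2$2) \<noteq> 0" by auto
    have "cmod (fst (moebius3 A p)) = cmod (A$1$1) * cmod z * cmod (A$2$2) / (cmod (A$2$2))\<^sup>2"
      using d by (simp add: moebius3_eq denom3_def norm_mult norm_divide z_def norm_power)
    then have f: "cmod (A$2$2) * cmod (fst (moebius3 A p)) = cmod (A$1$1) * cmod z"
      using nz0 by (simp add: power2_eq_square)
    have "(cmod (A$2$2))\<^sup>2 \<le> cmod (A$2$2) * (cmod (A$2$2) * cmod (fst (moebius3 A p)))"
      using z' by (simp add: power2_eq_square mult_left_mono mult_le_cancel_left1)
    also have "\<dots> = (cmod (A$1$1) * cmod (A$2$2)) * cmod z" unfolding f by (simp add: mult_ac)
    also have "\<dots> = cmod z" unfolding ad by simp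
    also have "\<dots> \<le> 6\<^sup>2" using z by simp
    finally have 1: "cmod (A$2$2) \<le> 6" by (rule power2_le_imp_le) simp
    have "(cmod (A$1$1))\<^sup>2 \<le> cmod (A$1$1) * (cmod (A$1$1) * cmod z)"
      using z by (simp add: power2_eq_square mult_left_mono mult_le_cancel_left1)
    also have "\<dots> = cmod (fst (moebius3 A p))" unfolding f[symmetric] using ad by (simp add: mult.assoc[symmetric])
    also have "\<dots> \<le> 6\<^sup>2" using z' by simp
    finally have "cmod (A$1$1) \<le> 6" by (rule power2_le_imp_le) simp
    then show ?thesis using 1 d by simp
  next
    assume d: "A$1$1 = 0 \<and> A$2$2 = 0"
    then have bc: "cmod (A$1$2) * cmod (A$2$1) = 1"
    proof -
      have "- (A$1$2 * A$2$1) = 1" using A d by (simp add: det_2)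
      then have "cmod (- (A$1$2 * A$2$1)) = 1" by (simp only: norm_one)
      then show ?thesis by (simp add: norm_mult)
    qed
    then have nz0: "cmod (A$1$2) \<noteq> 0" "cmod (A$2$1) \<noteq> 0" by auto
    define r where "r = (cmod z)\<^sup>2 + t\<^sup>2"
    have r: "r > 0" "cmod z \<le> r" "r \<le> 10"
    proof -
      have "cmod z \<le> (cmod z)\<^sup>2" using z by (simp add: power2_eq_square mult_le_cancel_left1)
      moreover have "(cmod z)\<^sup>2 \<le> 9" using power_mono[of "cmod z" 3 2] z by simp
      moreover have "t\<^sup>2 \<le> 1" using power_mono[of t 1 2] t by simp
      moreover have "t\<^sup>2 \<ge> 0" by simp
      ultimately show "cmod z \<le> r" "r \<le> 10" "r > 0" unfolding r_def using z by linarith+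
    qed
    have "denom3 A p = (cmod (A$2$1))\<^sup>2 * r"
      using d by (simp add: denom3_def r_def norm_mult power_mult_distrib z_def t_def algebra_simps)
    then have "cmod (fst (moebius3 A p)) = cmod (A$1$2) * (cmod (A$2$1) * cmod z) / ((cmod (A$2$1))\<^sup>2 * r)"
      using d r by (simp add: moebius3_eq norm_mult norm_divide z_def norm_power abs_mult)
    then have f: "cmod (A$2$1) * r * cmod (fst (moebius3 A p)) = cmod (A$1$2) * cmod z"
      using nz0 r by (simp add: power2_eq_square)
    have "(cmod (A$2$1))\<^sup>2 * cmod z \<le> (cmod (A$2$1))\<^sup>2 * (r * cmod (fst (moebius3 A p)))"
      using z' r by (intro mult_left_mono) (auto intro: order_trans[OF r(2)] simp: mult_le_cancel_left1)
    also have "\<dots> = cmod (A$2$1) * (cmod (A$2$1) * r * cmod (fst (moebius3 A p)))" by (simp add: power2_eq_square)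
    also have "\<dots> = (cmod (A$1$2) * cmod (A$2$1)) * cmod z" unfolding f by (simp add: mult_ac)
    also have "\<dots> = cmod z" unfolding bc by simp
    finally have "(cmod (A$2$1))\<^sup>2 * cmod z \<le> 1 * cmod z" by simp
    then have "(cmod (A$2$1))\<^sup>2 \<le> 1" by (rule mult_right_le_imp_le) (use z in linarith)
    then have "(cmod (A$2$1))\<^sup>2 \<le> 6\<^sup>2" by simp
    then have 1: "cmod (A$2$1) \<le> 6" by (rule power2_le_imp_le) simp
    have "(cmod (A$1$2))\<^sup>2 \<le> cmod (A$1$2) * (cmod (A$1$2) * cmod z)"
      using z by (simp add: power2_eq_square mult_left_mono mult_le_cancel_left1)
    also have "\<dots> = (cmod (A$1$2) * cmod (A$2$1)) * (r * cmod (fst (moebius3 A p)))" unfolding f[symmetric] by (simp add: mult_ac)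
    also have "\<dots> = r * cmod (fst (moebius3 A p))" unfolding bc by simp
    also have "\<dots> \<le> 10 * 3" using z' r by (intro mult_mono) auto
    finally have "(cmod (A$1$2))\<^sup>2 \<le> 6\<^sup>2" by simp
    then have "cmod (A$1$2) \<le> 6" by (rule power2_le_imp_le) simp
    then show ?thesis using 1 d by simp
  qed
  then show ?thesis using exhaust_2[of i] exhaust_2[of j] by auto
qed

interpretation H3: invariant_action H3 vol_H3 moebius3 cusp3
proof
  show "bounded {A. det A = 1 \<and> ((A$1$2 = 0 \<and> A$2$1 = 0) \<or> (A$1$1 = 0 \<and> A$2$2 = 0)) \<and> (\<exists>x\<in>cusp3. moebius3 A x \<in> cusp3)}"
    unfolding bounded_iff
  \<comment> \<open>Four entries of norm at most 6.\<close>
  proof (intro exI[of _ 24] ballI)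
    fix A :: "complex^2^2" assume "A \<in> {A. det A = 1 \<and> ((A$1$2 = 0 \<and> A$2$1 = 0) \<or> (A$1$1 = 0 \<and> A$2$2 = 0)) \<and> (\<exists>x\<in>cusp3. moebius3 A x \<in> cusp3)}"
    then have "norm (A$i$j) \<le> 6" for i j using cusp3_return_bounded by blast
    then show "norm A \<le> 24" using norm_matrix2_le[of A] by (smt (verit))
  qed
  show "cusp3 \<subseteq> H3" by (auto simp: cusp3_def H3_iff)
qed (auto simp: moebius3_H3 moebius3_one moebius3_uminus moebius3_mult AE_vol_H3 vol_H3_moebius3 vol_cusp3)

interpretation H2: invariant_action H2 vol_H2 moebius2 cusp2
proof
  show "bounded {A. det A = 1 \<and> ((A$1$2 = 0 \<and> A$2$1 = 0) \<or> (A$1$1 = 0 \<and> A$2$2 = 0)) \<and> (\<exists>x\<in>cusp2. moebius2 A x \<in> cusp2)}"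
    unfolding bounded_iff
  proof (intro exI[of _ 24] ballI)
    fix A :: "real^2^2" assume "A \<in> {A. det A = 1 \<and> ((A$1$2 = 0 \<and> A$2$1 = 0) \<or> (A$1$1 = 0 \<and> A$2$2 = 0)) \<and> (\<exists>x\<in>cusp2. moebius2 A x \<in> cusp2)}"
    then obtain x where A: "det A = 1" "(A$1$2 = 0 \<and> A$2$1 = 0) \<or> (A$1$1 = 0 \<and> A$2$2 = 0)" "x \<in> cusp2" "moebius2 A x \<in> cusp2" by blast
    have emb: "emb z \<in> cusp3" if "z \<in> cusp2" for z using that by (simp add: emb_def cusp2_def cusp3_def)
    have "x \<in> H2" using A(3) by (simp add: cusp2_def H2_def)
    then have "moebius3 (cmat A) (emb x) \<in> cusp3" using moebius3_emb[OF A(1)] emb[OF A(4)] by simp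
    then have "norm (cmat A $i$j) \<le> 6" for i j
      using A emb by (intro cusp3_return_bounded[of _ "emb x"]) (auto simp: cmat_simps, auto simp: cmat_def)
    from this[of 1 1] this[of 1 2] this[of 2 1] this[of 2 2]
    show "norm A \<le> 24" using norm_matrix2_le[of A] by (simp add: cmat_def)
  qed
  show "cusp2 \<subseteq> H2" by (auto simp: cusp2_def H2_def)
qed (auto simp: moebius2_H2 moebius2_one moebius2_uminus moebius2_mult AE_vol_H2 vol_H2_moebius2 vol_cusp2)

section \<open>Isometries of hyperbolic space\<close>

lemma cmat_mat22: "cmat (mat22 a b c d) = mat22 (of_real a) (of_real b) (of_real c) (of_real d)"
  by (simp add: cmat_def)

lemma moebius3_to_base:
  assumes "t > 0"
  shows "moebius3 (mat22 (of_real (1 / sqrt t)) (- z / of_real (sqrt t)) 0 (of_real (sqrt t))) (z, t) = (0, 1)"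
  using assms by (simp add: moebius3_eq denom3_def)

text \<open>The stabiliser of \<open>(0, 1)\<close> is transitive on the points at distance \<open>ln 2\<close>.\<close>

lemma moebius3_rotation:
  fixes z :: complex and t :: real
  assumes t: "0 < t" "t < 2" and z: "(cmod z)\<^sup>2 = (2 - t) * (t - 1 / 2)"
  defines "b \<equiv> sqrt ((2 - t) / (3 * t))"
  defines "\<alpha> \<equiv> - of_real (2 / (3 * b * t)) * z"
  defines "U \<equiv> mat22 \<alpha> (of_real b) (- of_real b) (cnj \<alpha>)"
  shows "det U = 1" "moebius3 U (0, 1) = (0, 1)" "moebius3 U (0, 2) = (z, t)"
proof -
  \<comment> \<open>The parameters solve three conditions: |\<alpha>|^2 + b^2 = 1 for the
    determinant, |\<alpha>|^2 + 4 b^2 = 2 / t for the height of the image of (0, 2), and - 3 b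
    \<alpha> = (2 / t) z for its horizontal part.\<close>
  have b2: "b\<^sup>2 = (2 - t) / (3 * t)" using t by (simp add: b_def)
  have b0: "b > 0" using t by (simp add: b_def)
  have "(cmod \<alpha>)\<^sup>2 = (2 / (3 * b * t))\<^sup>2 * (cmod z)\<^sup>2"
    by (simp only: \<alpha>_def norm_mult norm_minus_cancel norm_of_real power_mult_distrib power2_abs)
  also have "(2 / (3 * b * t))\<^sup>2 = 4 / (9 * b\<^sup>2 * t\<^sup>2)" by (simp add: power_divide power_mult_distrib)
  also have "\<dots> = 4 / (3 * (2 - t) * t)" unfolding b2 using t by (simp add: power2_eq_square field_simps)
  also have "\<dots> * (cmod z)\<^sup>2 = (4 * t - 2) / (3 * t)" unfolding z using t by (simp add: field_simps)
  finally have a2: "(cmod \<alpha>)\<^sup>2 = (4 * t - 2) / (3 * t)" .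
  have ab: "(cmod \<alpha>)\<^sup>2 + b\<^sup>2 = 1" unfolding a2 b2 using t by (simp add: field_simps)
  have "det U = complex_of_real ((cmod \<alpha>)\<^sup>2 + b\<^sup>2)"
    by (simp only: U_def det_2 mat22_nth of_real_add cmod_sq) (simp add: power2_eq_square)
  then show "det U = 1" by (simp only: ab of_real_1)
  have d1: "denom3 U (0, 1) = 1" using ab by (simp add: denom3_def U_def)
  show "moebius3 U (0, 1) = (0, 1)" unfolding moebius3_eq d1 by (simp add: U_def)
  have d2: "denom3 U (0, 2) = 2 / t"
  proof -
    have "denom3 U (0, 2) = (cmod \<alpha>)\<^sup>2 + b\<^sup>2 * 4" by (simp add: denom3_def U_def)
    also have "\<dots> = 2 / t" unfolding a2 b2 using t by (simp add: field_simps)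
    finally show ?thesis .
  qed
  have "(U$1$1 * 0 + U$1$2) * cnj (U$2$1 * 0 + U$2$2) + U$1$1 * cnj (U$2$1) * of_real (2\<^sup>2) = - (3 * of_real b * \<alpha>)"
    by (simp add: U_def algebra_simps)
  also have "\<dots> = of_real (2 / t) * z" using b0 t by (simp add: \<alpha>_def field_simps)
  finally have e: "(U$1$1 * 0 + U$1$2) * cnj (U$2$1 * 0 + U$2$2) + U$1$1 * cnj (U$2$1) * of_real (2\<^sup>2) = of_real (2 / t) * z" .
  show "moebius3 U (0, 2) = (z, t)"
    unfolding moebius3_eq fst_conv snd_conv d2 e using t by simp
qed

text \<open>After clearing denominators, the difference of the two equations no longer contains |z|
  and |z'|; it forces equal heights, and either equation then gives the rest.\<close>

lemma disp3_axis_points: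
  assumes "t > 0" "t' > 0" "disp3 (0, 1) (z, t) = disp3 (0, 1) (z', t')" "disp3 (0, 2) (z, t) = disp3 (0, 2) (z', t')"
  shows "t = t'" "cmod z = cmod z'"
proof -
  define r r' where "r = (cmod z)\<^sup>2" and "r' = (cmod z')\<^sup>2"
  have e1: "(r + (1 - t)\<^sup>2) * t' = (r' + (1 - t')\<^sup>2) * t" using assms by (simp add: disp3_def r_def r'_def field_simps)
  have e2: "(r + (2 - t)\<^sup>2) * t' = (r' + (2 - t')\<^sup>2) * t" using assms by (simp add: disp3_def r_def r'_def field_simps)
  have "((r + (2 - t)\<^sup>2) - (r + (1 - t)\<^sup>2)) * t' = ((r' + (2 - t')\<^sup>2) - (r' + (1 - t')\<^sup>2)) * t"
    using e1 e2 by (simp only: left_diff_distrib)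
  moreover have "((r + (2 - t)\<^sup>2) - (r + (1 - t)\<^sup>2)) = 3 - 2 * t" "((r' + (2 - t')\<^sup>2) - (r' + (1 - t')\<^sup>2)) = 3 - 2 * t'"
    by (simp_all add: power2_eq_square algebra_simps)
  ultimately have "(3 - 2 * t) * t' = (3 - 2 * t') * t" by simp
  then show t: "t = t'" by (simp add: algebra_simps)
  then have "r = r'" using e1 assms(1) by simp
  then show "cmod z = cmod z'" by (simp add: r_def r'_def)
qed

lemma disp3_same_height:
  "t > 0 \<Longrightarrow> s > 0 \<Longrightarrow> disp3 (w, s) (z, t) = disp3 (w', s) (z', t) \<longleftrightarrow> cmod (w - z) = cmod (w' - z')"
  by (simp add: disp3_def)

definition cnj3 :: "complex \<times> real \<Rightarrow> complex \<times> real" where "cnj3 p = (cnj (fst p), snd p)"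

definition isometry3 :: "(complex \<times> real \<Rightarrow> complex \<times> real) \<Rightarrow> bool" where
  "isometry3 f \<longleftrightarrow> (\<forall>p\<in>H3. f p \<in> H3) \<and> (\<forall>p\<in>H3. \<forall>q\<in>H3. disp3 (f p) (f q) = disp3 p q)"

lemma isometry3_moebius3: "isometry3 f \<Longrightarrow> det A = 1 \<Longrightarrow> isometry3 (\<lambda>p. moebius3 A (f p))"
  by (auto simp: isometry3_def moebius3_H3 disp3_moebius3)

lemma isometry3_cnj3: "isometry3 f \<Longrightarrow> isometry3 (\<lambda>p. cnj3 (f p))"
proof -
  assume f: "isometry3 f"
  have "disp3 (cnj3 p) (cnj3 q) = disp3 p q" for p q
    unfolding disp3_def cnj3_def fst_conv snd_conv complex_cnj_diff[symmetric] complex_mod_cnj ..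
  moreover have "cnj3 p \<in> H3 \<longleftrightarrow> p \<in> H3" for p by (simp add: cnj3_def H3_iff)
  ultimately show ?thesis using f by (simp add: isometry3_def)
qed

lemma isometry3_axis:
  assumes f: "isometry3 f" and fixed: "f (0, 1) = (0, 1)" "f (0, 2) = (0, 2)" and t: "t > 0"
  obtains z' where "f (z, t) = (z', t)" "cmod z' = cmod z"
proof -
  have H: "(0, 1) \<in> H3" "(0, 2) \<in> H3" "(z, t) \<in> H3" using t by (simp_all add: H3_iff)
  obtain z' t' where ft: "f (z, t) = (z', t')" by (metis surj_pair)
  have "t' > 0" using f H(3) ft by (metis isometry3_def H3_iff snd_conv)
  moreover have "disp3 (0, 1) (z, t) = disp3 (0, 1) (z', t')" "disp3 (0, 2) (z, t) = disp3 (0, 2) (z', t')"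
    using f H fixed ft by (metis isometry3_def)+
  ultimately have "t = t'" "cmod z = cmod z'" using disp3_axis_points[OF t] by blast+
  then show ?thesis using ft that by simp
qed

lemma cmod_eq_imp_eq:
  assumes "cmod z = cmod w" "cmod (1 - z) = cmod (1 - w)" "cmod (\<i> - z) = cmod (\<i> - w)"
  shows "z = w"
proof -
  have "(Re z)\<^sup>2 + (Im z)\<^sup>2 = (Re w)\<^sup>2 + (Im w)\<^sup>2" using assms(1) cmod_power2 by metis
  moreover have "(1 - Re z)\<^sup>2 + (Im z)\<^sup>2 = (1 - Re w)\<^sup>2 + (Im w)\<^sup>2"
    using cmod_power2[of "1 - z"] cmod_power2[of "1 - w"] assms(2) by simp
  moreover have "(Re z)\<^sup>2 + (1 - Im z)\<^sup>2 = (Re w)\<^sup>2 + (1 - Im w)\<^sup>2"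
    using cmod_power2[of "\<i> - z"] cmod_power2[of "\<i> - w"] assms(3) by simp
  ultimately have "Re z = Re w" "Im z = Im w" by (simp_all add: power2_eq_square algebra_simps)
  then show ?thesis by (simp add: complex_eq_iff)
qed

text \<open>Fixing the two points of the axis preserves height and distance from the axis; the
  points over 1 and \<open>\<i>\<close> then determine the horizontal position.\<close>

lemma isometry3_fixing_frame:
  assumes f: "isometry3 f" and fixed: "f (0, 1) = (0, 1)" "f (0, 2) = (0, 2)" "f (1, 1) = (1, 1)" "f (\<i>, 1) = (\<i>, 1)"
    and p: "p \<in> H3"
  shows "f p = p"
proof -
  obtain z t where zt: "p = (z, t)" "t > 0" using p by (metis H3_iff snd_conv surj_pair)
  obtain z' where z': "f (z, t) = (z', t)" "cmod z' = cmod z" using isometry3_axis[OF f fixed(1,2) zt(2)] by blast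
  have H: "(1, 1) \<in> H3" "(\<i>, 1) \<in> H3" by (simp_all add: H3_iff)
  have "disp3 (1, 1) (z', t) = disp3 (1, 1) (z, t)" "disp3 (\<i>, 1) (z', t) = disp3 (\<i>, 1) (z, t)"
    using f H p fixed z' zt by (metis isometry3_def)+
  then have "z' = z" using z'(2) zt(2) by (intro cmod_eq_imp_eq) (simp_all add: disp3_same_height)
  then show ?thesis using z' zt by simp
qed

text \<open>An upper triangular matrix takes \<open>p\<close> to (0, 1), and a rotation about that
  point finishes. The value 1/4 is \<open>disp3\<close> of (0, 1) and (0, 2). The last clause makes
  the normalisation usable in the plane, where the matrix must be real.\<close>

lemma moebius3_base_pair:
  assumes p: "p \<in> H3" and q: "q \<in> H3" and d: "disp3 p q = 1 / 4"
  shows "\<exists>A. det A = 1 \<and> moebius3 A p = (0, 1) \<and> moebius3 A q = (0, 2) \<and>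
     (Im (fst p) = 0 \<longrightarrow> Im (fst q) = 0 \<longrightarrow> (\<exists>A'. A = cmat A'))"
proof -
  obtain z t where pz: "p = (z, t)" "t > 0" using p by (metis H3_iff snd_conv surj_pair)
  define B where "B = mat22 (of_real (1 / sqrt t)) (- z / of_real (sqrt t)) 0 (of_real (sqrt t))"
  have B: "det B = 1" "moebius3 B p = (0, 1)" using pz moebius3_to_base[OF pz(2)] by (auto simp: B_def det_2)
  have Breal: "B = cmat (mat22 (1 / sqrt t) (- Re z / sqrt t) 0 (sqrt t))" if "Im z = 0"
    using that by (simp add: B_def cmat_mat22 complex_is_Real_iff[symmetric])
  obtain w s where ws: "moebius3 B q = (w, s)" "s > 0" using moebius3_H3[OF B(1) q] by (metis H3_iff snd_conv surj_pair)
  have "disp3 (0, 1) (w, s) = 1 / 4" using disp3_moebius3[OF B(1) p q] B d ws by simp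
  then have "(cmod w)\<^sup>2 + (1 - s)\<^sup>2 = s / 2" using ws(2) by (simp add: disp3_def field_simps)
  then have w2: "(cmod w)\<^sup>2 = (2 - s) * (s - 1 / 2)" by (simp add: power2_eq_square field_simps)
  have "s \<le> 2"
  proof (rule ccontr)
    assume "\<not> s \<le> 2"
    then have "(2 - s) * (s - 1 / 2) < 0" by (intro mult_neg_pos) auto
    then show False using w2 by (metis not_less zero_le_power2)
  qed
  \<comment> \<open>At \<open>s = 2\<close> the rotation parameter \<open>b\<close>, which occurs in
    a denominator, would be 0; there \<open>w = 0\<close> and \<open>B\<close> already
    suffices.\<close>
  then consider "s = 2" | "s < 2" by linarith
  then show ?thesis
  proof cases
    case 1
    then have "w = 0" using w2 by simp
    then show ?thesis using B Breal ws 1 pz by (intro exI[of _ B]) auto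
  next
    case 2
    define b where "b = sqrt ((2 - s) / (3 * s))"
    define \<alpha> where "\<alpha> = - of_real (2 / (3 * b * s)) * w"
    define U where "U = mat22 \<alpha> (of_real b) (- of_real b) (cnj \<alpha>)"
    have U: "det U = 1" "moebius3 U (0, 1) = (0, 1)" "moebius3 U (0, 2) = (w, s)"
      using moebius3_rotation[OF ws(2) 2 w2] unfolding U_def \<alpha>_def b_def by blast+
    have H: "(0, 1) \<in> H3" "(0, 2) \<in> H3" by (simp_all add: H3_iff)
    have inv: "moebius3 (adj2 U) (moebius3 U r) = r" if "r \<in> H3" for r
      using moebius3_mult[of "adj2 U" U r] U(1) that by (simp add: mult_adj2 moebius3_one)
    have "moebius3 (adj2 U ** B) p = (0, 1)" "moebius3 (adj2 U ** B) q = (0, 2)"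
      using inv[OF H(1)] inv[OF H(2)] U B ws p q by (simp_all add: moebius3_mult)
    moreover have "\<exists>A'. adj2 U ** B = cmat A'" if real: "Im z = 0" "Im (fst q) = 0"
    proof -
      have "w = of_real (Re w)"
      proof -
        obtain y r where "q = (y, r)" by (metis surj_pair)
        then have "q = emb (Complex (Re y) r)" using real(2) by (simp add: emb_def complex_eq_iff)
        moreover have "Complex (Re y) r \<in> H2" using q calculation by (simp add: emb_H3)
        ultimately have "moebius3 B q = emb (moebius2 (mat22 (1 / sqrt t) (- Re z / sqrt t) 0 (sqrt t)) (Complex (Re y) r))"
          unfolding Breal[OF real(1)] using pz(2) by (simp add: moebius3_emb det_2)
        then show ?thesis using ws(1) by (simp add: emb_def)
      qed
      then have "\<alpha> = of_real (- (2 / (3 * b * s)) * Re w)" unfolding \<alpha>_def by (metis of_real_minus of_real_mult)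
      then have "adj2 U = cmat (mat22 (- (2 / (3 * b * s)) * Re w) (- b) b (- (2 / (3 * b * s)) * Re w))"
        by (simp add: U_def cmat_mat22 matrix2_eq_iff adj2_nth)
      then show ?thesis unfolding Breal[OF real(1)] by (metis cmat_simps(2))
    qed
    ultimately show ?thesis using U(1) B(1) pz by (intro exI[of _ "adj2 U ** B"]) (auto simp: det_mul)
  qed
qed

lemma moebius3_left_inverse:
  assumes "det A = 1" "p \<in> H3" "moebius3 A p = q" shows "p = moebius3 (adj2 A) q"
  using moebius3_mult[of "adj2 A" A p] assms by (simp add: mult_adj2 moebius3_one)

lemma disp3_base: "disp3 (0, 1) (0, 2) = 1 / 4" by (simp add: disp3_def)

text \<open>Composition with Moebius maps makes \<open>f\<close> fix the points (0, 1), (0, 2) and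
  (1, 1). The point over \<open>\<i>\<close> can then only stay or move to the one over
  \<open>- \<i>\<close>, which decides between the identity and complex conjugation.\<close>

theorem isometry3_classification:
  assumes f: "isometry3 f"
  shows "\<exists>A. det A = 1 \<and> ((\<forall>p\<in>H3. f p = moebius3 A p) \<or> (\<forall>p\<in>H3. f p = moebius3 A (cnj3 p)))"
proof -
  have H: "(0, 1) \<in> H3" "(0, 2) \<in> H3" "(1, 1) \<in> H3" "(\<i>, 1) \<in> H3" by (simp_all add: H3_iff)
  have fH: "f p \<in> H3" if "p \<in> H3" for p using f that by (simp add: isometry3_def)
  have "disp3 (f (0, 1)) (f (0, 2)) = 1 / 4" using f H disp3_base by (simp add: isometry3_def)
  then obtain A1 where A1: "det A1 = 1" "moebius3 A1 (f (0, 1)) = (0, 1)" "moebius3 A1 (f (0, 2)) = (0, 2)"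
    using moebius3_base_pair[OF fH[OF H(1)] fH[OF H(2)]] by blast
  define g where "g p = moebius3 A1 (f p)" for p
  have g: "isometry3 g" unfolding g_def by (rule isometry3_moebius3[OF f A1(1)])
  obtain \<omega> where \<omega>: "g (1, 1) = (\<omega>, 1)" "cmod \<omega> = 1"
    using isometry3_axis[OF g, of 1 1] A1 by (auto simp: g_def)
  \<comment> \<open>The diagonal matrix \<open>D\<close> multiplies \<open>z\<close> by \<alpha>^2,
    so a square root of \<open>cnj \<omega>\<close> turns \<open>\<omega>\<close> back to 1.\<close>
  define \<alpha> where "\<alpha> = csqrt (cnj \<omega>)"
  have \<alpha>: "\<alpha>\<^sup>2 = cnj \<omega>" by (simp add: \<alpha>_def)
  have "(cmod \<alpha>)\<^sup>2 = 1" using \<alpha> \<omega>(2) by (metis complex_mod_cnj norm_power)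
  then have \<alpha>1: "cmod \<alpha> = 1" by (metis norm_ge_zero one_power2 power2_eq_iff_nonneg zero_le_one)
  define D where "D = mat22 \<alpha> 0 0 (cnj \<alpha>)"
  have Dp: "moebius3 D (z, t) = (cnj \<omega> * z, t)" for z t
    using \<alpha>1 \<alpha> by (simp add: moebius3_eq denom3_def D_def power2_eq_square mult_ac)
  have detD: "det D = 1" using cmod_sq[of \<alpha>] \<alpha>1 by (simp add: D_def det_2)
  define h where "h p = moebius3 D (g p)" for p
  have h: "isometry3 h" unfolding h_def by (rule isometry3_moebius3[OF g detD])
  have "\<omega> * cnj \<omega> = 1" using cmod_sq[of \<omega>] \<omega>(2) by simp
  then have fixed: "h (0, 1) = (0, 1)" "h (0, 2) = (0, 2)" "h (1, 1) = (1, 1)"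
    using A1 \<omega> by (simp_all add: h_def Dp g_def mult.commute)
  obtain w where w: "h (\<i>, 1) = (w, 1)" "cmod w = 1" using isometry3_axis[OF h fixed(1,2), of 1 \<i>] by auto
  have "disp3 (1, 1) (w, 1) = disp3 (1, 1) (\<i>, 1)" using h H fixed w by (metis isometry3_def)
  then have "cmod (1 - w) = cmod (1 - \<i>)" by (simp add: disp3_same_height)
  then have "(1 - Re w)\<^sup>2 + (Im w)\<^sup>2 = 2" using cmod_power2[of "1 - w"] cmod_power2[of "1 - \<i>"] by simp
  moreover have w1: "(Re w)\<^sup>2 + (Im w)\<^sup>2 = 1" using cmod_power2[of w] w(2) by simp
  ultimately have Re: "Re w = 0" by (simp add: power2_eq_square algebra_simps)
  then have "(Im w)\<^sup>2 = 1" using w1 by simp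
  then have wi: "w = \<i> \<or> w = - \<i>" using Re by (auto simp: power2_eq_1_iff complex_eq_iff)
  define A where "A = adj2 (D ** A1)"
  have detA: "det A = 1" using detD A1 by (simp add: A_def det_mul)
  have hf: "f p = moebius3 A (h p)" if "p \<in> H3" for p
    unfolding A_def h_def g_def
    using detD A1(1) fH[OF that] by (intro moebius3_left_inverse) (simp_all add: det_mul moebius3_mult)
  from wi show ?thesis
  proof
    assume "w = \<i>"
    then have "h p = p" if "p \<in> H3" for p using isometry3_fixing_frame[OF h fixed _ that] w by simp
    then show ?thesis using hf detA by auto
  next
    assume "w = - \<i>"
    then have "cnj3 (h p) = p" if "p \<in> H3" for p
      using isometry3_fixing_frame[OF isometry3_cnj3[OF h] _ _ _ _ that] fixed w by (simp add: cnj3_def)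
    then have "h p = cnj3 p" if "p \<in> H3" for p using that by (metis cnj3_def complex_cnj_cnj fst_conv prod.collapse snd_conv)
    then show ?thesis using hf detA by auto
  qed
qed

section \<open>Isometries of the plane\<close>

definition refl2 :: "complex \<Rightarrow> complex" where "refl2 z = - cnj z"

definition isometry2 :: "(complex \<Rightarrow> complex) \<Rightarrow> bool" where
  "isometry2 f \<longleftrightarrow> (\<forall>p\<in>H2. f p \<in> H2) \<and> (\<forall>p\<in>H2. \<forall>q\<in>H2. disp3 (emb (f p)) (emb (f q)) = disp3 (emb p) (emb q))"

lemma isometry2_fixing_frame:
  assumes f: "isometry2 f" and fixed: "f \<i> = \<i>" "f (2 * \<i>) = 2 * \<i>" "f (1 + \<i>) = 1 + \<i>" and z: "z \<in> H2"
  shows "f z = z"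
proof -
  have H: "\<i> \<in> H2" "2 * \<i> \<in> H2" "1 + \<i> \<in> H2" by (simp_all add: H2_def)
  have e: "emb \<i> = (0, 1)" "emb (2 * \<i>) = (0, 2)" "emb (1 + \<i>) = (1, 1)" by (simp_all add: emb_def)
  have fz: "f z \<in> H2" using f z by (simp add: isometry2_def)
  have d: "disp3 (emb w) (emb (f z)) = disp3 (emb w) (emb z)" if "w \<in> H2" "f w = w" for w
    using f z that by (metis isometry2_def)
  have pos: "Im z > 0" "Im (f z) > 0" using z fz by (simp_all add: H2_def)
  have "disp3 (0, 1) (of_real (Re (f z)), Im (f z)) = disp3 (0, 1) (of_real (Re z), Im z)"
    "disp3 (0, 2) (of_real (Re (f z)), Im (f z)) = disp3 (0, 2) (of_real (Re z), Im z)"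
    using d[OF H(1) fixed(1)] d[OF H(2) fixed(2)] unfolding e by (simp_all add: emb_def)
  from disp3_axis_points[OF pos(2,1) this] have 1: "Im (f z) = Im z" "\<bar>Re (f z)\<bar> = \<bar>Re z\<bar>" by simp_all
  have "disp3 (1, 1) (of_real (Re (f z)), Im z) = disp3 (1, 1) (of_real (Re z), Im z)"
    using d[OF H(3) fixed(3)] 1 unfolding e by (simp add: emb_def)
  then have "cmod (1 - of_real (Re (f z))) = cmod (1 - of_real (Re z))" using pos by (simp add: disp3_same_height)
  then have "\<bar>1 - Re (f z)\<bar> = \<bar>1 - Re z\<bar>" by (metis norm_of_real of_real_1 of_real_diff)
  then have "Re (f z) = Re z" using 1(2) by linarith
  then show ?thesis using 1 by (simp add: complex_eq_iff)
qed

text \<open>The argument in space is repeated with the points \<open>\<i>\<close>,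
  \<open>2 * \<i>\<close> and \<open>1 + \<i>\<close>; the normalising matrix is the real one that
  \<open>moebius3_base_pair\<close> supplies for points of the embedded plane.\<close>

theorem isometry2_classification:
  assumes f: "isometry2 f"
  shows "\<exists>A. det A = 1 \<and> ((\<forall>z\<in>H2. f z = moebius2 A z) \<or> (\<forall>z\<in>H2. f z = moebius2 A (refl2 z)))"
proof -
  have H: "\<i> \<in> H2" "2 * \<i> \<in> H2" "1 + \<i> \<in> H2" by (simp_all add: H2_def)
  have e: "emb \<i> = (0, 1)" "emb (2 * \<i>) = (0, 2)" "emb (1 + \<i>) = (1, 1)" by (simp_all add: emb_def)
  have fH: "f z \<in> H2" if "z \<in> H2" for z using f that by (simp add: isometry2_def)
  have "disp3 (emb (f \<i>)) (emb (f (2 * \<i>))) = 1 / 4" using f H disp3_base e by (metis isometry2_def)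
  then obtain A1' where A1': "det A1' = 1" "moebius3 A1' (emb (f \<i>)) = (0, 1)" "moebius3 A1' (emb (f (2 * \<i>))) = (0, 2)" "\<exists>A. A1' = cmat A"
    using moebius3_base_pair[of "emb (f \<i>)" "emb (f (2 * \<i>))"] fH H by (auto simp: emb_H3) (auto simp: emb_def)
  then obtain A1 where A1: "A1' = cmat A1" by blast
  have detA1: "det A1 = 1" using A1'(1) A1 by (metis cmat_simps(1) of_real_eq_1_iff)
  define g where "g z = moebius2 A1 (f z)" for z
  have gH: "g z \<in> H2" if "z \<in> H2" for z using fH[OF that] detA1 by (simp add: g_def moebius2_H2)
  have ge: "emb (g z) = moebius3 A1' (emb (f z))" if "z \<in> H2" for z
    using fH[OF that] detA1 by (simp add: g_def A1 moebius3_emb)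
  have g: "isometry2 g"
    using f gH fH A1'(1) unfolding isometry2_def by (simp add: ge disp3_moebius3 emb_H3)
  have fixed: "g \<i> = \<i>" "g (2 * \<i>) = 2 * \<i>"
    using A1' ge H e emb_inj by metis+
  have "\<bar>Re (g (1 + \<i>))\<bar> = 1 \<and> Im (g (1 + \<i>)) = 1"
  proof -
    let ?w = "g (1 + \<i>)"
    have "disp3 (emb v) (emb ?w) = disp3 (emb v) (1, 1)" if "v \<in> H2" "g v = v" for v
      using g that H e by (metis isometry2_def)
    then have "disp3 (0, 1) (of_real (Re ?w), Im ?w) = disp3 (0, 1) (1, 1)" "disp3 (0, 2) (of_real (Re ?w), Im ?w) = disp3 (0, 2) (1, 1)"
      using H fixed e by (metis emb_def)+
    moreover have "Im ?w > 0" using gH[OF H(3)] by (simp add: H2_def)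
    ultimately show ?thesis using disp3_axis_points[of "Im ?w" 1] by fastforce
  qed
  then have "g (1 + \<i>) = 1 + \<i> \<or> g (1 + \<i>) = - 1 + \<i>" by (auto simp: complex_eq_iff)
  then have "(\<forall>z\<in>H2. g z = z) \<or> (\<forall>z\<in>H2. g z = refl2 z)"
  proof
    assume "g (1 + \<i>) = 1 + \<i>"
    then show ?thesis using isometry2_fixing_frame[OF g fixed] by blast
  next
    assume w: "g (1 + \<i>) = - 1 + \<i>"
    have "isometry2 (\<lambda>z. refl2 (g z))"
    proof -
      have "disp3 (emb (refl2 z)) (emb (refl2 w)) = disp3 (emb z) (emb w)" for z w
      proof -
        have "cmod (- complex_of_real (Re z) + complex_of_real (Re w)) = cmod (complex_of_real (Re z) - complex_of_real (Re w))"
          by (metis norm_minus_commute uminus_add_conv_diff)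
        then show ?thesis by (simp add: disp3_def emb_def refl2_def)
      qed
      then show ?thesis using g by (auto simp: isometry2_def refl2_def H2_def)
    qed
    moreover have "refl2 (g \<i>) = \<i>" "refl2 (g (2 * \<i>)) = 2 * \<i>" "refl2 (g (1 + \<i>)) = 1 + \<i>"
      using fixed w by (simp_all add: refl2_def)
    ultimately have "refl2 (g z) = z" if "z \<in> H2" for z using isometry2_fixing_frame that by blast
    then have "g z = refl2 z" if "z \<in> H2" for z using that by (metis complex_cnj_cnj complex_cnj_minus minus_minus refl2_def)
    then show ?thesis by blast
  qed
  moreover have "f z = moebius2 (adj2 A1) (g z)" if "z \<in> H2" for z
    using moebius2_mult[of "adj2 A1" A1 "f z"] detA1 fH[OF that] by (simp add: g_def mult_adj2 moebius2_one)
  ultimately show ?thesis using detA1 by (intro exI[of _ "adj2 A1"]) auto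
qed

section \<open>Commensurability\<close>

text \<open>Among the cosets of the first powers of \<open>h\<close> two coincide, so some power of
  \<open>h\<close> with exponent at most the index \<open>n\<close> lies in \<open>H'\<close>. This
  exponent varies with \<open>h\<close>, as \<open>H'\<close> may fail to be normal, but it always
  divides \<open>n!\<close>.\<close>

lemma finite_index_exponent:
  assumes G: "group G" and H: "subgroup H G" and fi: "finite_index G H' H"
  shows "\<exists>m>0. \<forall>h\<in>H. h [^]\<^bsub>G\<^esub> (m::nat) \<in> H'"
proof -
  let ?L = "G\<lparr>carrier := H\<rparr>"
  interpret G: group G by fact
  interpret L: group ?L by (rule G.subgroup_imp_group[OF H])
  have H': "subgroup H' ?L" and fin: "finite (rcosets\<^bsub>?L\<^esub> H')" using fi by (auto simp: finite_index_def)
  interpret H': subgroup H' ?L by fact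
  define n where "n = card (rcosets\<^bsub>?L\<^esub> H')"
  have "h [^]\<^bsub>G\<^esub> (fact n :: nat) \<in> H'" if h: "h \<in> H" for h
  proof -
    have hL: "h \<in> carrier ?L" using h by simp
    let ?c = "\<lambda>k::nat. H' #>\<^bsub>?L\<^esub> (h [^]\<^bsub>?L\<^esub> k)"
    have "?c ` {..n} \<subseteq> rcosets\<^bsub>?L\<^esub> H'" using L.rcosetsI[OF H'.subset] L.nat_pow_closed[OF hL] by blast
    then have "card (?c ` {..n}) \<le> n" unfolding n_def using fin card_mono by blast
    then have "\<not> inj_on ?c {..n}" using pigeonhole[of ?c "{..n}"] by simp
    then obtain i j where ij: "i < j" "j \<le> n" "?c i = ?c j"
      by (auto simp: inj_on_def) (metis linorder_neqE_nat)
    have "h [^]\<^bsub>?L\<^esub> j \<in> ?c j" using L.rcos_self[OF L.nat_pow_closed[OF hL] H'] .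
    then have "h [^]\<^bsub>?L\<^esub> j \<in> ?c i" using ij(3) by simp
    then have "h [^]\<^bsub>?L\<^esub> j \<otimes>\<^bsub>?L\<^esub> inv\<^bsub>?L\<^esub> (h [^]\<^bsub>?L\<^esub> i) \<in> H'"
      using H'.rcos_module_imp[OF L.group_axioms L.nat_pow_closed[OF hL]] by blast
    moreover have "h [^]\<^bsub>?L\<^esub> j = h [^]\<^bsub>?L\<^esub> (j - i) \<otimes>\<^bsub>?L\<^esub> h [^]\<^bsub>?L\<^esub> i"
      using L.nat_pow_mult[OF hL, of "j - i" i] ij by simp
    ultimately have "h [^]\<^bsub>?L\<^esub> (j - i) \<in> H'"
      using L.inv_solve_right' L.nat_pow_closed[OF hL] by (metis L.inv_closed L.m_assoc L.r_inv L.r_one)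
    then have k: "(h [^]\<^bsub>?L\<^esub> (j - i)) [^]\<^bsub>?L\<^esub> q \<in> H'" for q :: nat
    proof (induction q)
      case 0 then show ?case using H'.one_closed by simp
    next
      case (Suc q) then show ?case using H'.m_closed[OF Suc.IH[OF Suc.prems] Suc.prems] by simp
    qed
    have "(j - i) dvd fact n" using ij by (intro dvd_fact) auto
    then obtain q where "fact n = (j - i) * q" by (auto elim: dvdE)
    then have "h [^]\<^bsub>?L\<^esub> (fact n :: nat) \<in> H'" using k[of q] L.nat_pow_pow[OF hL, of "j - i" q] by simp
    then show ?thesis using G.nat_pow_consistent[of h "fact n" H] by simp
  qed
  then show ?thesis by (intro exI[of _ "fact n"]) simp
qed

lemma finite_index_subset: "finite_index G H' H \<Longrightarrow> H' \<subseteq> H"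
  using subgroup.subset by (fastforce simp: finite_index_def)

text \<open>Unlike commensurability with an arithmetic group, this one-sided condition visibly passes to
  commensurable groups, and it is all that the estimate of translation lengths uses.\<close>

definition power_arithmetic ::
    "complex set \<Rightarrow> complex \<Rightarrow> complex \<Rightarrow> (complex \<Rightarrow> 'f::field) \<Rightarrow> ('f^2^2) set \<Rightarrow> bool" where
  "power_arithmetic K a b \<sigma> G \<longleftrightarrow>
     (\<exists>\<O> \<rho> m. is_order K a b \<O> \<and> matrix_embedding K a b \<sigma> \<rho> \<and> m > 0 \<and>
        (\<forall>B\<in>G. \<exists>y\<in>\<O>. mpow B m = \<rho> y \<or> mpow B m = - \<rho> y))"

text \<open>An orientation-reversing isometry acts on matrices by complex conjugation in space and
  by a sign change off the diagonal in the plane. The map \<open>\<eta>\<close> records the effect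
  on scalars and so on the embedding of the field.\<close>

definition matrix_automorphism :: "('f::field^2^2 \<Rightarrow> 'f^2^2) \<Rightarrow> ('f \<Rightarrow> 'f) \<Rightarrow> bool" where
  "matrix_automorphism \<tau> \<eta> \<longleftrightarrow> inj \<tau> \<and> (\<forall>X Y. \<tau> (X + Y) = \<tau> X + \<tau> Y \<and> \<tau> (X ** Y) = \<tau> X ** \<tau> Y) \<and>
     (\<forall>c. \<tau> (mat c) = mat (\<eta> c)) \<and> (\<forall>X. \<tau> (- X) = - \<tau> X)"

lemma matrix_automorphism_mpow:
  assumes "matrix_automorphism \<tau> \<eta>" "\<eta> 1 = 1" shows "\<tau> (mpow B n) = mpow (\<tau> B) n"
  using assms by (induction n) (simp_all add: mpow_Suc matrix_automorphism_def)

lemma matrix_embedding_conj: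
  assumes emb: "matrix_embedding K a b \<sigma> \<rho>" and \<tau>: "matrix_automorphism \<tau> \<eta>" and P: "det P = 1"
    and \<sigma>': "\<And>c. c \<in> K \<Longrightarrow> \<sigma>' c = \<eta> (\<sigma> c)"
  shows "matrix_embedding K a b \<sigma>' (\<lambda>x. P ** \<tau> (\<rho> x) ** adj2 P)"
proof -
  have PP: "adj2 P ** P = mat 1" "P ** adj2 P = mat 1" using P by (simp_all add: mult_adj2)
  have inj: "X = Y" if "P ** X ** adj2 P = P ** Y ** adj2 P" for X Y
  proof -
    have "adj2 P ** (P ** Z ** adj2 P) ** P = Z" for Z
    proof -
      have "adj2 P ** (P ** Z ** adj2 P) ** P = (adj2 P ** P) ** Z ** (adj2 P ** P)" by (simp add: matrix_mul_assoc)
      then show ?thesis by (simp add: PP)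
    qed
    then show ?thesis using that by metis
  qed
  have mult: "P ** (X ** Y) ** adj2 P = (P ** X ** adj2 P) ** (P ** Y ** adj2 P)" for X Y
  proof -
    have "(P ** X ** adj2 P) ** (P ** Y ** adj2 P) = P ** X ** (adj2 P ** P) ** Y ** adj2 P" by (simp add: matrix_mul_assoc)
    then show ?thesis by (simp add: PP matrix_mul_assoc)
  qed
  have sc: "P ** mat c ** adj2 P = mat c" for c
    by (simp only: mat_mult_commute2[of P c] matrix_mul_assoc[symmetric] PP matrix_mul_rid)
  show ?thesis
    unfolding matrix_embedding_def
  proof (intro conjI ballI)
    show "inj_on (\<lambda>x. P ** \<tau> (\<rho> x) ** adj2 P) (qalg K)"
    proof (rule inj_onI)
      fix x y assume xy: "x \<in> qalg K" "y \<in> qalg K" and e: "P ** \<tau> (\<rho> x) ** adj2 P = P ** \<tau> (\<rho> y) ** adj2 P"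
      have "\<tau> (\<rho> x) = \<tau> (\<rho> y)" by (rule inj[OF e])
      then have "\<rho> x = \<rho> y" using \<tau> by (simp add: matrix_automorphism_def inj_eq)
      then show "x = y" using emb xy by (auto simp: matrix_embedding_def inj_on_def)
    qed
  next
    fix x y assume "x \<in> qalg K" "y \<in> qalg K"
    then have "\<tau> (\<rho> (x + y)) = \<tau> (\<rho> x) + \<tau> (\<rho> y)" "\<tau> (\<rho> (qmult a b x y)) = \<tau> (\<rho> x) ** \<tau> (\<rho> y)"
      using emb \<tau> by (auto simp: matrix_embedding_def matrix_automorphism_def)
    then show "P ** \<tau> (\<rho> (x + y)) ** adj2 P = P ** \<tau> (\<rho> x) ** adj2 P + P ** \<tau> (\<rho> y) ** adj2 P"
      "P ** \<tau> (\<rho> (qmult a b x y)) ** adj2 P = P ** \<tau> (\<rho> x) ** adj2 P ** (P ** \<tau> (\<rho> y) ** adj2 P)"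
      by (simp_all add: mult matrix_add_ldistrib matrix2_add_mult)
  next
    fix c assume "c \<in> K"
    then have "\<rho> (c *s qone) = mat (\<sigma> c)" using emb by (simp add: matrix_embedding_def)
    then show "P ** \<tau> (\<rho> (c *s qone)) ** adj2 P = mat (\<sigma>' c)"
      using \<tau> \<sigma>'[OF \<open>c \<in> K\<close>] by (simp add: matrix_automorphism_def sc)
  qed
qed

lemma matrix_automorphism_id: "matrix_automorphism (\<lambda>X. X) (\<lambda>c. c)"
  by (simp add: matrix_automorphism_def)

text \<open>Exponents multiply: \<open>n\<close> leads from \<open>D\<close> to a transform of an
  element of \<open>G\<close>, and \<open>m\<close> from there into the order. The transform is
  absorbed into the embedding of the algebra.\<close>

lemma power_arithmetic_transfer:
  assumes ar: "power_arithmetic K a b \<sigma> G" and \<tau>: "matrix_automorphism \<tau> \<eta>" "\<eta> 1 = 1"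
    and P: "det P = 1" and \<sigma>': "\<And>c. c \<in> K \<Longrightarrow> \<sigma>' c = \<eta> (\<sigma> c)" and n: "n > 0"
    and rel: "\<And>D. D \<in> G' \<Longrightarrow> \<exists>B\<in>G. mpow D n = P ** \<tau> B ** adj2 P \<or> mpow D n = - (P ** \<tau> B ** adj2 P)"
  shows "power_arithmetic K a b \<sigma>' G'"
proof -
  obtain \<O> \<rho> m where ar: "is_order K a b \<O>" "matrix_embedding K a b \<sigma> \<rho>" "m > 0"
    "\<And>B. B \<in> G \<Longrightarrow> \<exists>y\<in>\<O>. mpow B m = \<rho> y \<or> mpow B m = - \<rho> y"
    using ar by (auto simp: power_arithmetic_def)
  have "\<exists>y\<in>\<O>. mpow D (n * m) = P ** \<tau> (\<rho> y) ** adj2 P \<or> mpow D (n * m) = - (P ** \<tau> (\<rho> y) ** adj2 P)" if D: "D \<in> G'" for D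
  proof -
    obtain B where B: "B \<in> G" "mpow D n = P ** \<tau> B ** adj2 P \<or> mpow D n = - (P ** \<tau> B ** adj2 P)" using rel[OF D] by blast
    obtain y where y: "y \<in> \<O>" "mpow B m = \<rho> y \<or> mpow B m = - \<rho> y" using ar(4)[OF B(1)] by blast
    have "mpow (P ** \<tau> B ** adj2 P) m = P ** \<tau> (mpow B m) ** adj2 P"
      by (simp add: mpow_conj[OF P] matrix_automorphism_mpow[OF \<tau>])
    moreover have "P ** \<tau> (mpow B m) ** adj2 P = P ** \<tau> (\<rho> y) ** adj2 P \<or> P ** \<tau> (mpow B m) ** adj2 P = - (P ** \<tau> (\<rho> y) ** adj2 P)"
      using y(2) \<tau>(1) by (auto simp: matrix_automorphism_def neg_mult2)
    moreover have "mpow D (n * m) = mpow (P ** \<tau> B ** adj2 P) m \<or> mpow D (n * m) = - mpow (P ** \<tau> B ** adj2 P) m"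
      using B(2) mpow_uminus[of "P ** \<tau> B ** adj2 P" m] by (auto simp: mpow_mult)
    ultimately show ?thesis using y(1) by (metis minus_minus)
  qed
  then show ?thesis
    unfolding power_arithmetic_def using ar(1,3) n matrix_embedding_conj[OF ar(2) \<tau>(1) P \<sigma>']
    by (intro exI[of _ \<O>] exI[of _ "\<lambda>x. P ** \<tau> (\<rho> x) ** adj2 P"] exI[of _ "n * m"]) auto
qed

text \<open>Finite index gives one exponent that carries the conjugate of \<open>\<Gamma>\<close>
  into the arithmetic group. Conjugating back is absorbed into the embedding, so that the conclusion
  concerns \<open>\<Gamma>\<close> itself.\<close>

lemma arithmetic_via_power_arithmetic:
  fixes \<Gamma> :: "('f::field_char_0^2^2) set set"
  assumes \<Gamma>: "subgroup \<Gamma> PSL2" and ar: "arithmetic_via K a b \<sigma> \<Gamma>"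
  shows "power_arithmetic K a b \<sigma> (\<Union>\<Gamma>)"
proof -
  interpret PSL: group "PSL2 :: ('f^2^2) set monoid" by (rule group_PSL2)
  note lifts = subgroup_PSL2_lifts[OF \<Gamma>]
  interpret \<Gamma>: matrix_group "\<Union>\<Gamma>" by (rule lifts(1))
  obtain \<O> \<rho> g where ar: "maximal_order K a b \<O>" "matrix_embedding K a b \<sigma> \<rho>" "g \<in> carrier PSL2"
    "commensurable_subgroups PSL2 (conj_subgroup PSL2 g \<Gamma>) (psl_proj ` \<rho> ` norm_one a b \<O>)"
    using ar by (auto simp: arithmetic_via_def)
  have O: "is_order K a b \<O>" using ar(1) by (simp add: maximal_order_def)
  obtain P where P: "det P = 1" "g = psl_proj P" using ar(3) by (auto simp: carrier_PSL2)
  let ?H = "conj_subgroup PSL2 g \<Gamma>" and ?\<Lambda> = "psl_proj ` \<rho> ` norm_one a b \<O>"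
  have H: "subgroup ?H PSL2"
  proof (rule PSL.subgroupI)
    have sub: "\<Gamma> \<subseteq> carrier PSL2" using \<Gamma> subgroup.subset by blast
    show "?H \<subseteq> carrier PSL2" unfolding conj_subgroup_def using sub ar(3) by auto
    show "?H \<noteq> {}" unfolding conj_subgroup_def using subgroup.one_closed[OF \<Gamma>] by blast
    fix x assume "x \<in> ?H"
    then obtain h where h: "h \<in> \<Gamma>" "x = g \<otimes>\<^bsub>PSL2\<^esub> h \<otimes>\<^bsub>PSL2\<^esub> inv\<^bsub>PSL2\<^esub> g" by (auto simp: conj_subgroup_def)
    have hc: "h \<in> carrier PSL2" using h sub by auto
    have "inv\<^bsub>PSL2\<^esub> x = g \<otimes>\<^bsub>PSL2\<^esub> inv\<^bsub>PSL2\<^esub> h \<otimes>\<^bsub>PSL2\<^esub> inv\<^bsub>PSL2\<^esub> g"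
      unfolding h(2) using hc ar(3) by (simp add: PSL.inv_mult_group PSL.m_assoc)
    then show "inv\<^bsub>PSL2\<^esub> x \<in> ?H" unfolding conj_subgroup_def using subgroup.m_inv_closed[OF \<Gamma> h(1)] by blast
    fix y assume "y \<in> ?H"
    then obtain k where k: "k \<in> \<Gamma>" "y = g \<otimes>\<^bsub>PSL2\<^esub> k \<otimes>\<^bsub>PSL2\<^esub> inv\<^bsub>PSL2\<^esub> g" by (auto simp: conj_subgroup_def)
    have kc: "k \<in> carrier PSL2" using k sub by auto
    have "x \<otimes>\<^bsub>PSL2\<^esub> y = g \<otimes>\<^bsub>PSL2\<^esub> (h \<otimes>\<^bsub>PSL2\<^esub> k) \<otimes>\<^bsub>PSL2\<^esub> inv\<^bsub>PSL2\<^esub> g"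
      unfolding h(2) k(2) using hc kc ar(3)
      by (simp add: PSL.m_assoc) (simp add: PSL.m_assoc[symmetric])
    then show "x \<otimes>\<^bsub>PSL2\<^esub> y \<in> ?H" unfolding conj_subgroup_def using subgroup.m_closed[OF \<Gamma> h(1) k(1)] by blast
  qed
  have "finite_index PSL2 (?H \<inter> ?\<Lambda>) ?H" using ar(4) by (simp add: commensurable_subgroups_def)
  from finite_index_exponent[OF group_PSL2 H this] obtain m :: nat
    where m: "m > 0" "\<And>h. h \<in> ?H \<Longrightarrow> h [^]\<^bsub>PSL2\<^esub> m \<in> ?\<Lambda>" by blast
  have PP: "adj2 P ** P = mat 1" using P(1) by (simp add: mult_adj2)
  have QQ: "adj2 (adj2 P) = P" by (simp add: matrix2_eq_iff adj2_nth)
  have "\<exists>y\<in>\<O>. mpow B m = adj2 P ** \<rho> y ** adj2 (adj2 P) \<or> mpow B m = - (adj2 P ** \<rho> y ** adj2 (adj2 P))" if B: "B \<in> \<Union>\<Gamma>" for B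
  proof -
    have dB: "det B = 1" using \<Gamma>.det_one[OF B] .
    have "psl_proj B \<in> \<Gamma>" using B lifts(2) by blast
    then have "g \<otimes>\<^bsub>PSL2\<^esub> psl_proj B \<otimes>\<^bsub>PSL2\<^esub> inv\<^bsub>PSL2\<^esub> g \<in> ?H" by (auto simp: conj_subgroup_def)
    moreover have "g \<otimes>\<^bsub>PSL2\<^esub> psl_proj B \<otimes>\<^bsub>PSL2\<^esub> inv\<^bsub>PSL2\<^esub> g = psl_proj (P ** B ** adj2 P)"
      unfolding P(2) using P(1) dB by (simp add: psl_proj_inv psl_proj_mult det_mul)
    ultimately have "psl_proj (mpow (P ** B ** adj2 P) m) \<in> ?\<Lambda>"
      using m(2) P(1) dB by (simp add: psl_proj_pow[symmetric] det_mul)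
    then obtain y where y: "y \<in> norm_one a b \<O>" "psl_proj (P ** mpow B m ** adj2 P) = psl_proj (\<rho> y)"
      unfolding mpow_conj[OF P(1)] by blast
    have "adj2 P ** (P ** mpow B m ** adj2 P) ** P = (adj2 P ** P) ** mpow B m ** (adj2 P ** P)" by (simp add: matrix_mul_assoc)
    then have "mpow B m = adj2 P ** (P ** mpow B m ** adj2 P) ** P" by (simp add: PP)
    moreover have "P ** mpow B m ** adj2 P = \<rho> y \<or> P ** mpow B m ** adj2 P = - \<rho> y" using y(2) by (simp add: psl_proj_eq_iff)
    ultimately have "mpow B m = adj2 P ** \<rho> y ** P \<or> mpow B m = - (adj2 P ** \<rho> y ** P)" by (metis neg_mult2)
    then show ?thesis using y(1) unfolding QQ by (auto simp: norm_one_def)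
  qed
  moreover have "matrix_embedding K a b \<sigma> (\<lambda>x. adj2 P ** \<rho> x ** adj2 (adj2 P))"
    using matrix_embedding_conj[OF ar(2) matrix_automorphism_id, of "adj2 P" \<sigma>] P(1) by simp
  ultimately show ?thesis unfolding power_arithmetic_def using O m(1) by blast
qed

text \<open>A fixed power carries \<open>\<Delta>\<close> into \<open>\<Delta>'\<close>, and
  \<open>rel\<close> matches \<open>\<Delta>'\<close> with elements of \<open>\<Gamma>'\<close>,
  which lie in \<open>\<Gamma>\<close>.\<close>

lemma power_arithmetic_commensurable:
  fixes \<Gamma> \<Delta> :: "('f::field_char_0^2^2) set set"
  assumes ar: "power_arithmetic K a b \<sigma> (\<Union>\<Gamma>)" and \<Gamma>: "subgroup \<Gamma> PSL2" and \<Delta>: "subgroup \<Delta> PSL2"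
    and fi: "finite_index PSL2 \<Gamma>' \<Gamma>" "finite_index PSL2 \<Delta>' \<Delta>"
    and \<tau>: "matrix_automorphism \<tau> \<eta>" "\<eta> 1 = 1" and P: "det P = 1" and \<sigma>': "\<And>c. c \<in> K \<Longrightarrow> \<sigma>' c = \<eta> (\<sigma> c)"
    and rel: "\<And>D. det D = 1 \<Longrightarrow> psl_proj D \<in> \<Delta>' \<Longrightarrow> \<exists>B. psl_proj B \<in> \<Gamma>' \<and> (D = P ** \<tau> B ** adj2 P \<or> D = - (P ** \<tau> B ** adj2 P))"
  shows "power_arithmetic K a b \<sigma>' (\<Union>\<Delta>)"
proof -
  interpret \<Delta>: matrix_group "\<Union>\<Delta>" by (rule subgroup_PSL2_lifts(1)[OF \<Delta>])
  obtain n :: nat where n: "n > 0" "\<And>h. h \<in> \<Delta> \<Longrightarrow> h [^]\<^bsub>PSL2\<^esub> n \<in> \<Delta>'"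
    using finite_index_exponent[OF group_PSL2 \<Delta> fi(2)] by blast
  show ?thesis
  proof (rule power_arithmetic_transfer[OF ar \<tau> P \<sigma>' n(1)])
    fix D assume D: "D \<in> \<Union>\<Delta>"
    then have dD: "det D = 1" by (rule \<Delta>.det_one)
    have "psl_proj D \<in> \<Delta>" using D subgroup_PSL2_lifts(2)[OF \<Delta>] by blast
    then have "psl_proj (mpow D n) \<in> \<Delta>'" using n(2) dD by (simp add: psl_proj_pow[symmetric])
    then obtain B where B: "psl_proj B \<in> \<Gamma>'" "mpow D n = P ** \<tau> B ** adj2 P \<or> mpow D n = - (P ** \<tau> B ** adj2 P)"
      using rel[OF det_mpow[OF dD]] by blast
    have "B \<in> \<Union>\<Gamma>" using B(1) finite_index_subset[OF fi(1)] by (auto simp: psl_proj_eq)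
    then show "\<exists>B\<in>\<Union>\<Gamma>. mpow D n = P ** \<tau> B ** adj2 P \<or> mpow D n = - (P ** \<tau> B ** adj2 P)" using B(2) by blast
  qed
qed

section \<open>Commensurable quotients\<close>

lemma act3_eq: "act3 (psl_proj A) p = moebius3 A p"
proof -
  have "(SOME B. B \<in> psl_proj A) \<in> psl_proj A" by (rule someI[of _ A]) (simp add: psl_proj_eq)
  then show ?thesis by (auto simp: act3_def psl_proj_eq moebius3_uminus)
qed

lemma act2_eq: "act2 (psl_proj A) p = moebius2 A p"
proof -
  have "(SOME B. B \<in> psl_proj A) \<in> psl_proj A" by (rule someI[of _ A]) (simp add: psl_proj_eq)
  then show ?thesis by (auto simp: act2_def psl_proj_eq moebius2_uminus)
qed

definition cnj_mat :: "complex^2^2 \<Rightarrow> complex^2^2" where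
  "cnj_mat A = mat22 (cnj (A$1$1)) (cnj (A$1$2)) (cnj (A$2$1)) (cnj (A$2$2))"

text \<open>Conjugation by the diagonal matrix with entries 1 and -1, which is the effect of
  \<open>refl2\<close> on Moebius maps.\<close>

definition refl_mat :: "real^2^2 \<Rightarrow> real^2^2" where
  "refl_mat A = mat22 (A$1$1) (- A$1$2) (- A$2$1) (A$2$2)"

lemma matrix_automorphism_cnj: "matrix_automorphism cnj_mat cnj"
  by (auto simp: matrix_automorphism_def cnj_mat_def matrix2_simps inj_def)

lemma matrix_automorphism_refl: "matrix_automorphism refl_mat (\<lambda>c. c)"
  by (auto simp: matrix_automorphism_def refl_mat_def matrix2_simps inj_def)

lemma det_cnj_mat: "det (cnj_mat A) = cnj (det A)" by (simp add: cnj_mat_def det_2)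
lemma det_refl_mat: "det (refl_mat A) = det A" by (simp add: refl_mat_def det_2)

lemma cnj3_moebius3: "cnj3 (moebius3 A p) = moebius3 (cnj_mat A) (cnj3 p)"
proof -
  have "denom3 (cnj_mat A) (cnj3 p) = denom3 A p"
    unfolding denom3_def cnj_mat_def cnj3_def mat22_nth fst_conv snd_conv complex_cnj_mult[symmetric] complex_cnj_add[symmetric] complex_mod_cnj ..
  then show ?thesis by (simp add: moebius3_eq cnj3_def) (simp add: cnj_mat_def)
qed

lemma refl2_moebius2: "refl2 (moebius2 A z) = moebius2 (refl_mat A) (refl2 z)"
proof -
  have n: "of_real (A$1$1) * - cnj z + of_real (- A$1$2) = - cnj (of_real (A$1$1) * z + of_real (A$1$2))"
    and d: "of_real (- A$2$1) * - cnj z + of_real (A$2$2) = cnj (of_real (A$2$1) * z + of_real (A$2$2))" by simp_all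
  show ?thesis unfolding refl2_def moebius2_def refl_mat_def mat22_nth n d by (simp only: complex_cnj_divide minus_divide_left)
qed

lemma conj_of_intertwining:
  assumes "D ** P = P ** X \<or> D ** P = - (P ** X)" "det P = 1"
  shows "D = P ** X ** adj2 P \<or> D = - (P ** X ** adj2 P)"
proof -
  have "D ** P ** adj2 P = D" using assms(2) by (simp add: matrix_mul_assoc[symmetric] mult_adj2)
  then show ?thesis using assms(1) by (metis neg_mult2(1))
qed

text \<open>If the isometry between the covers reverses orientation, the embedding of the field is
  replaced by its complex conjugate, which belongs to the same complex place.\<close>

lemma commensurable_quotients_H3:
  assumes c: "commensurable_quotients H3 dist_H3 act3 \<Gamma> \<Delta>" and \<Gamma>: "subgroup \<Gamma> PSL2" and \<Delta>: "subgroup \<Delta> PSL2"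
    and ar: "power_arithmetic K a b \<sigma> (\<Union>\<Gamma>)"
  shows "power_arithmetic K a b \<sigma> (\<Union>\<Delta>) \<or> power_arithmetic K a b (restrict (cnj \<circ> \<sigma>) K) (\<Union>\<Delta>)"
proof -
  obtain \<Gamma>' \<Delta>' f where fi: "finite_index PSL2 \<Gamma>' \<Gamma>" "finite_index PSL2 \<Delta>' \<Delta>"
    and f: "bij_betw f H3 H3" "\<And>x y. x \<in> H3 \<Longrightarrow> y \<in> H3 \<Longrightarrow> dist_H3 (f x) (f y) = dist_H3 x y"
    and eq: "\<And>\<delta>. \<delta> \<in> \<Delta>' \<Longrightarrow> \<exists>\<gamma>\<in>\<Gamma>'. \<forall>x\<in>H3. f (act3 \<gamma> x) = act3 \<delta> (f x)"
    using c unfolding commensurable_quotients_def isometric_quotients_def by blast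
  have fH: "f x \<in> H3" if "x \<in> H3" for x using f(1) that by (auto simp: bij_betw_def)
  have "isometry3 f"
    unfolding isometry3_def using fH f(2) by (simp add: dist_H3_eq_iff[symmetric])
  then obtain A where A: "det A = 1" "(\<forall>p\<in>H3. f p = moebius3 A p) \<or> (\<forall>p\<in>H3. f p = moebius3 A (cnj3 p))"
    using isometry3_classification by blast
  have rel: "\<exists>B. psl_proj B \<in> \<Gamma>' \<and> det B = 1 \<and> (\<forall>x\<in>H3. f (moebius3 B x) = moebius3 D (f x))"
    if D: "psl_proj D \<in> \<Delta>'" for D
  proof -
    obtain \<gamma> where \<gamma>: "\<gamma> \<in> \<Gamma>'" "\<forall>x\<in>H3. f (act3 \<gamma> x) = act3 (psl_proj D) (f x)" using eq[OF D] by blast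
    have "\<gamma> \<in> \<Gamma>" using \<gamma> finite_index_subset[OF fi(1)] by blast
    then obtain B where "det B = 1" "\<gamma> = psl_proj B" using subgroup_PSL2_lifts(4)[OF \<Gamma>] by blast
    then show ?thesis using \<gamma> by (auto simp: act3_eq)
  qed
  have embH: "emb z \<in> H3" if "z \<in> H2" for z using that by (simp add: emb_H3)
  from A(2) show ?thesis
  proof
    assume fA: "\<forall>p\<in>H3. f p = moebius3 A p"
    have "power_arithmetic K a b \<sigma> (\<Union>\<Delta>)"
    proof (rule power_arithmetic_commensurable[OF ar \<Gamma> \<Delta> fi matrix_automorphism_id _ A(1)])
      fix D assume D: "det D = 1" "psl_proj D \<in> \<Delta>'"
      obtain B where B: "psl_proj B \<in> \<Gamma>'" "det B = 1" "\<forall>x\<in>H3. f (moebius3 B x) = moebius3 D (f x)" using rel[OF D(2)] by blast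
      have "D ** A = A ** B \<or> D ** A = - (A ** B)"
      proof (rule moebius3_eq_imp)
        fix z assume "z \<in> H2"
        then have "emb z \<in> H3" by (rule embH)
        then show "moebius3 (D ** A) (emb z) = moebius3 (A ** B) (emb z)"
          using B D A(1) fA by (simp add: moebius3_mult moebius3_H3)
      qed (use A D B in \<open>simp_all add: det_mul\<close>)
      then show "\<exists>B. psl_proj B \<in> \<Gamma>' \<and> (D = A ** B ** adj2 A \<or> D = - (A ** B ** adj2 A))"
        using conj_of_intertwining[OF _ A(1)] B(1) by blast
    qed simp_all
    then show ?thesis ..
  next
    assume fA: "\<forall>p\<in>H3. f p = moebius3 A (cnj3 p)"
    have "power_arithmetic K a b (restrict (cnj \<circ> \<sigma>) K) (\<Union>\<Delta>)"
    proof (rule power_arithmetic_commensurable[OF ar \<Gamma> \<Delta> fi matrix_automorphism_cnj _ A(1)])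
      fix D assume D: "det D = 1" "psl_proj D \<in> \<Delta>'"
      obtain B where B: "psl_proj B \<in> \<Gamma>'" "det B = 1" "\<forall>x\<in>H3. f (moebius3 B x) = moebius3 D (f x)" using rel[OF D(2)] by blast
      have dB: "det (cnj_mat B) = 1" using B(2) by (simp add: det_cnj_mat)
      have "D ** A = A ** cnj_mat B \<or> D ** A = - (A ** cnj_mat B)"
      proof (rule moebius3_eq_imp)
        fix z assume "z \<in> H2"
        then have z: "emb z \<in> H3" by (rule embH)
        have "cnj3 (emb z) = emb z" by (simp add: cnj3_def emb_def)
        then show "moebius3 (D ** A) (emb z) = moebius3 (A ** cnj_mat B) (emb z)"
          using B D A(1) fA z dB by (simp add: moebius3_mult moebius3_H3 cnj3_moebius3)
            (metis cnj3_moebius3 moebius3_H3)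
      qed (use A D dB in \<open>simp_all add: det_mul\<close>)
      then show "\<exists>B. psl_proj B \<in> \<Gamma>' \<and> (D = A ** cnj_mat B ** adj2 A \<or> D = - (A ** cnj_mat B ** adj2 A))"
        using conj_of_intertwining[OF _ A(1)] B(1) by blast
    qed simp_all
    then show ?thesis ..
  qed
qed

lemma commensurable_quotients_H2:
  assumes c: "commensurable_quotients H2 dist_H2 act2 \<Gamma> \<Delta>" and \<Gamma>: "subgroup \<Gamma> PSL2" and \<Delta>: "subgroup \<Delta> PSL2"
    and ar: "power_arithmetic K a b \<sigma> (\<Union>\<Gamma>)"
  shows "power_arithmetic K a b \<sigma> (\<Union>\<Delta>)"
proof -
  obtain \<Gamma>' \<Delta>' f where fi: "finite_index PSL2 \<Gamma>' \<Gamma>" "finite_index PSL2 \<Delta>' \<Delta>"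
    and f: "bij_betw f H2 H2" "\<And>x y. x \<in> H2 \<Longrightarrow> y \<in> H2 \<Longrightarrow> dist_H2 (f x) (f y) = dist_H2 x y"
    and eq: "\<And>\<delta>. \<delta> \<in> \<Delta>' \<Longrightarrow> \<exists>\<gamma>\<in>\<Gamma>'. \<forall>x\<in>H2. f (act2 \<gamma> x) = act2 \<delta> (f x)"
    using c unfolding commensurable_quotients_def isometric_quotients_def by blast
  have fH: "f x \<in> H2" if "x \<in> H2" for x using f(1) that by (auto simp: bij_betw_def)
  have "isometry2 f"
    using f(2) fH unfolding isometry2_def by (simp add: dist_H2_emb dist_H3_eq_iff emb_H3)
  then obtain A where A: "det A = 1" "(\<forall>p\<in>H2. f p = moebius2 A p) \<or> (\<forall>p\<in>H2. f p = moebius2 A (refl2 p))"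
    using isometry2_classification by blast
  have rel: "\<exists>B. psl_proj B \<in> \<Gamma>' \<and> det B = 1 \<and> (\<forall>x\<in>H2. f (moebius2 B x) = moebius2 D (f x))"
    if D: "psl_proj D \<in> \<Delta>'" for D
  proof -
    obtain \<gamma> where \<gamma>: "\<gamma> \<in> \<Gamma>'" "\<forall>x\<in>H2. f (act2 \<gamma> x) = act2 (psl_proj D) (f x)" using eq[OF D] by blast
    have "\<gamma> \<in> \<Gamma>" using \<gamma> finite_index_subset[OF fi(1)] by blast
    then obtain B where "det B = 1" "\<gamma> = psl_proj B" using subgroup_PSL2_lifts(4)[OF \<Gamma>] by blast
    then show ?thesis using \<gamma> by (auto simp: act2_eq)
  qed
  from A(2) show ?thesis
  proof
    assume fA: "\<forall>p\<in>H2. f p = moebius2 A p"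
    show ?thesis
    proof (rule power_arithmetic_commensurable[OF ar \<Gamma> \<Delta> fi matrix_automorphism_id _ A(1)])
      fix D assume D: "det D = 1" "psl_proj D \<in> \<Delta>'"
      obtain B where B: "psl_proj B \<in> \<Gamma>'" "det B = 1" "\<forall>x\<in>H2. f (moebius2 B x) = moebius2 D (f x)" using rel[OF D(2)] by blast
      have "D ** A = A ** B \<or> D ** A = - (A ** B)"
      proof (rule moebius2_eq_imp)
        fix z assume "z \<in> H2"
        then show "moebius2 (D ** A) z = moebius2 (A ** B) z"
          using B D A(1) fA by (simp add: moebius2_mult moebius2_H2)
      qed (use A D B in \<open>simp_all add: det_mul\<close>)
      then show "\<exists>B. psl_proj B \<in> \<Gamma>' \<and> (D = A ** B ** adj2 A \<or> D = - (A ** B ** adj2 A))"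
        using conj_of_intertwining[OF _ A(1)] B(1) by blast
    qed simp_all
  next
    assume fA: "\<forall>p\<in>H2. f p = moebius2 A (refl2 p)"
    show ?thesis
    proof (rule power_arithmetic_commensurable[OF ar \<Gamma> \<Delta> fi matrix_automorphism_refl _ A(1)])
      fix D assume D: "det D = 1" "psl_proj D \<in> \<Delta>'"
      obtain B where B: "psl_proj B \<in> \<Gamma>'" "det B = 1" "\<forall>x\<in>H2. f (moebius2 B x) = moebius2 D (f x)" using rel[OF D(2)] by blast
      have dB: "det (refl_mat B) = 1" using B(2) by (simp add: det_refl_mat)
      have "D ** A = A ** refl_mat B \<or> D ** A = - (A ** refl_mat B)"
      proof (rule moebius2_eq_imp)
        fix z assume z: "z \<in> H2"
        have r: "refl2 z \<in> H2" "refl2 (refl2 z) = z" using z by (simp_all add: refl2_def H2_def)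
        have "moebius2 A (refl2 (moebius2 B (refl2 z))) = moebius2 D (moebius2 A (refl2 (refl2 z)))"
          using B(3) fA r(1) moebius2_H2[OF B(2) r(1)] by metis
        then show "moebius2 (D ** A) z = moebius2 (A ** refl_mat B) z"
          using D A(1) z dB r by (simp add: moebius2_mult refl2_moebius2)
      qed (use A D dB in \<open>simp_all add: det_mul\<close>)
      then show "\<exists>B. psl_proj B \<in> \<Gamma>' \<and> (D = A ** refl_mat B ** adj2 A \<or> D = - (A ** refl_mat B ** adj2 A))"
        using conj_of_intertwining[OF _ A(1)] B(1) by blast
    qed simp_all
  qed
qed

section \<open>Translation lengths in bounded degree\<close>

text \<open>With \<open>power_arithmetic\<close> in place of \<open>arithmetic_via\<close>, a field
  that serves one orbifold serves every orbifold commensurable with it.\<close>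

primrec weak_field_of_definition :: "orbifold \<Rightarrow> complex set \<Rightarrow> bool" where
  "weak_field_of_definition (Orb2 \<Gamma>) K \<longleftrightarrow>
     number_field K \<and> totally_real K \<and>
     (\<exists>a\<in>K - {0}. \<exists>b\<in>K - {0}. \<exists>\<sigma>. {v \<in> real_places K. \<not> ramified_at a b v} = {\<sigma>} \<and>
        power_arithmetic K a b \<sigma> (\<Union>\<Gamma>))"
| "weak_field_of_definition (Orb3 \<Gamma>) K \<longleftrightarrow>
     number_field K \<and> card (complex_places K) = 1 \<and>
     (\<exists>a\<in>K - {0}. \<exists>b\<in>K - {0}. (\<forall>v\<in>real_places K. ramified_at a b v) \<and>
        (\<exists>\<tau>\<in>nonreal_embeddings K. power_arithmetic K a b \<tau> (\<Union>\<Gamma>)))"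

lemma weak_field_of_definition:
  assumes "hyperbolic_orbifold M" "field_of_definition M K"
  shows "weak_field_of_definition M K"
proof (cases M)
  case (Orb2 \<Gamma>)
  have "subgroup \<Gamma> PSL2" using assms(1) Orb2 by simp
  from arithmetic_via_power_arithmetic[OF this]
  have "arithmetic_via K a b \<sigma> \<Gamma> \<Longrightarrow> power_arithmetic K a b \<sigma> (\<Union>\<Gamma>)" for a b \<sigma> .
  then show ?thesis using assms(2) unfolding Orb2 field_of_definition.simps weak_field_of_definition.simps by blast
next
  case (Orb3 \<Gamma>)
  have "subgroup \<Gamma> PSL2" using assms(1) Orb3 by simp
  from arithmetic_via_power_arithmetic[OF this]
  have "arithmetic_via K a b \<sigma> \<Gamma> \<Longrightarrow> power_arithmetic K a b \<sigma> (\<Union>\<Gamma>)" for a b \<sigma> .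
  then show ?thesis using assms(2) unfolding Orb3 field_of_definition.simps weak_field_of_definition.simps by blast
qed

lemma restrict_cnj_nonreal:
  assumes "\<tau> \<in> nonreal_embeddings K" "number_field K"
  shows "restrict (cnj \<circ> \<tau>) K \<in> nonreal_embeddings K"
proof -
  interpret complex_subring K using assms(2) by (rule number_field_subring)
  obtain x where x: "x \<in> K" "\<tau> x \<notin> \<real>" using assms(1) by (auto simp: nonreal_embeddings_def)
  have "cnj (\<tau> x) \<notin> \<real>" using x(2) by (metis Reals_cnj_iff complex_cnj_cnj)
  then have "\<not> restrict (cnj \<circ> \<tau>) K ` K \<subseteq> \<real>" using x(1) by force
  then show ?thesis using assms(1)
    by (auto simp: nonreal_embeddings_def embeddings_def one_mem add_mem mult_mem)
qed

lemma weak_field_commensurable: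
  assumes c: "commensurable M N" and M: "hyperbolic_orbifold M" and N: "hyperbolic_orbifold N"
    and K: "weak_field_of_definition M K"
  shows "weak_field_of_definition N K"
proof (cases M)
  case (Orb2 \<Gamma>)
  then obtain \<Delta> where \<Delta>: "N = Orb2 \<Delta>" using c by (cases N) auto
  then show ?thesis using c M N K Orb2 commensurable_quotients_H2[of \<Gamma> \<Delta>] by auto blast
next
  case (Orb3 \<Gamma>)
  then obtain \<Delta> where \<Delta>: "N = Orb3 \<Delta>" using c by (cases N) auto
  obtain a b \<tau> where ab: "a \<in> K - {0}" "b \<in> K - {0}" "\<forall>v\<in>real_places K. ramified_at a b v"
    "\<tau> \<in> nonreal_embeddings K" "power_arithmetic K a b \<tau> (\<Union>\<Gamma>)" "number_field K" "card (complex_places K) = 1"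
    using K Orb3 by auto
  have "power_arithmetic K a b \<tau> (\<Union>\<Delta>) \<or> power_arithmetic K a b (restrict (cnj \<circ> \<tau>) K) (\<Union>\<Delta>)"
    using commensurable_quotients_H3[of \<Gamma> \<Delta>] c M N Orb3 \<Delta> ab(5) by simp
  then have "\<exists>\<tau>\<in>nonreal_embeddings K. power_arithmetic K a b \<tau> (\<Union>\<Delta>)"
    using ab(4) restrict_cnj_nonreal[OF ab(4,6)] by blast
  then show ?thesis using ab \<Delta> by auto
qed

text \<open>\<open>displacement\<close> is a definite description, so uniqueness has to be shown:
  \<open>A\<close> and \<open>- A\<close> have the eigenvalues \<open>u\<close>, \<open>1/u\<close>
  and their negatives, and those of norm above 1 all have the norm of \<open>u\<close>.\<close>

lemma hyperbolic_element_displacement: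
  fixes \<gamma> :: "('f::real_normed_field^2^2) set"
  assumes \<Gamma>: "subgroup \<Gamma> PSL2" "\<gamma> \<in> \<Gamma>" and hyp: "hyperbolic_element \<gamma>"
  obtains A u where "A \<in> \<Union>\<Gamma>" "trace A = u + inverse u" "norm u > 1" "displacement \<gamma> = 2 * ln (norm u)"
proof -
  obtain A u where A: "A \<in> \<gamma>" "trace A = u + inverse u" "norm u > 1"
    using hyp by (auto simp: hyperbolic_element_def)
  have \<gamma>: "\<gamma> = {A, - A}" using subgroup_PSL2_lifts(3)[OF \<Gamma> A(1)] by (simp add: psl_proj_eq)
  have u0: "u \<noteq> 0" using A(3) by auto
  have uniq: "norm u' = norm u" if B: "B \<in> \<gamma>" "trace B = u' + inverse u'" "norm u' > 1" for B u'
  proof -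
    have u'0: "u' \<noteq> 0" using B(3) by auto
    have "trace B = trace A \<or> trace B = - trace A" using B(1) \<gamma> by (auto simp: trace2)
    then obtain s :: 'f where s: "s = 1 \<or> s = -1" "trace B = s * trace A" by force
    then have ss: "s * s = 1" "norm s = 1" by auto
    have "u' + inverse u' = s * (u + inverse u)" using s(2) A(2) B(2) by simp
    then have "u' * (u' + inverse u') = u' * (s * (u + inverse u))" by simp
    then have e: "u' * u' + 1 = u' * (s * u) + u' * (s * inverse u)" using u'0 by (simp add: distrib_left)
    have "(u' - s * u) * (u' - s * inverse u) = (u' * u' + 1) - (u' * (s * u) + u' * (s * inverse u)) + (s * s * (u * inverse u) - 1)"
      by (simp add: algebra_simps)
    also have "\<dots> = 0" using e ss u0 by simp
    finally have "u' = s * u \<or> u' = s * inverse u" by auto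
    moreover have "u' \<noteq> s * inverse u"
    proof
      assume "u' = s * inverse u"
      then have "norm u' = inverse (norm u)" using ss by (simp add: norm_mult norm_inverse)
      also have "\<dots> < 1" using A(3) by (simp add: inverse_less_1_iff)
      finally show False using B(3) by simp
    qed
    ultimately show ?thesis using ss by (simp add: norm_mult)
  qed
  have "displacement \<gamma> = 2 * ln (norm u)"
    unfolding displacement_def
  proof (rule the_equality)
    show "\<exists>A\<in>\<gamma>. \<exists>v. trace A = v + inverse v \<and> norm v > 1 \<and> 2 * ln (norm u) = 2 * ln (norm v)" using A by blast
  qed (use uniq in fastforce)
  moreover have "A \<in> \<Union>\<Gamma>" using A(1) \<Gamma>(2) by blast
  ultimately show ?thesis using that A by blast
qed

text \<open>The constant 9 bounds the norm of (u + 1/u)^2 when 1 < |u| <= 2, as |u + 1/u| is then at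
  most 3; it also covers the bound 4 at ramified places.\<close>

definition small_eigenvalues :: "nat \<Rightarrow> complex set" where
  "small_eigenvalues d = {u. u \<noteq> 0 \<and> (\<exists>k\<le>d. \<exists>p\<in>bounded_int_polys k 9. poly p ((u + inverse u)\<^sup>2) = 0)}"

lemma finite_small_eigenvalues: "finite (small_eigenvalues d)"
proof -
  define T where "T = (\<Union>k\<le>d. \<Union>p\<in>bounded_int_polys k 9. {t. poly p t = 0})"
  have "finite {t. poly p t = 0}" if "p \<in> bounded_int_polys k 9" for p k
    using that by (intro poly_roots_finite) (auto simp: bounded_int_polys_def)
  then have T: "finite T" unfolding T_def using finite_bounded_int_polys by auto
  \<comment> \<open>The equation (u + 1/u)^2 = t with denominators cleared.\<close>
  let ?q = "\<lambda>t. [:1, 0, 2 - t, 0, 1:] :: complex poly"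
  have "small_eigenvalues d \<subseteq> (\<Union>t\<in>T. {u. poly (?q t) u = 0})"
  proof
    fix u assume "u \<in> small_eigenvalues d"
    then have u: "u \<noteq> 0" "(u + inverse u)\<^sup>2 \<in> T" by (auto simp: small_eigenvalues_def T_def)
    have "poly (?q ((u + inverse u)\<^sup>2)) u = 0"
      using u(1) by (simp add: field_simps power2_eq_square)
    then show "u \<in> (\<Union>t\<in>T. {u. poly (?q t) u = 0})" using u(2) by blast
  qed
  moreover have "finite (\<Union>t\<in>T. {u. poly (?q t) u = 0})"
    using T by (intro finite_UN_I poly_roots_finite) auto
  ultimately show ?thesis by (rule finite_subset)
qed

lemma norm_trace_sq_le:
  fixes u :: "'f::real_normed_field"
  assumes "1 < norm u" "norm u \<le> 2" shows "norm ((u + inverse u)\<^sup>2) \<le> 9"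
proof -
  have "inverse (norm u) < 1" using assms(1) by (simp add: inverse_less_1_iff)
  then have "norm (u + inverse u) \<le> 3" using norm_triangle_ineq[of u "inverse u"] assms by (simp add: norm_inverse)
  then have "(norm (u + inverse u))\<^sup>2 \<le> 3\<^sup>2" by (intro power_mono) auto
  then show ?thesis by (simp add: norm_power)
qed

lemma embedding_real_or_nonreal:
  assumes K: "number_field K" and v: "v \<in> embeddings K"
  shows "v \<in> nonreal_embeddings K \<or> (\<exists>w\<in>real_places K. \<forall>x\<in>K. v x = of_real (w x))"
proof (cases "v ` K \<subseteq> \<real>")
  case True
  interpret complex_subring K using K by (rule number_field_subring)
  have vr: "v x = of_real (Re (v x))" if "x \<in> K" for x using True that by (metis Re_complex_of_real Reals_cases image_subset_iff)
  have im: "Im (v x) = 0" if "x \<in> K" for x using vr[OF that] by (metis Im_complex_of_real)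
  have "restrict (Re \<circ> v) K \<in> real_places K"
    using v im by (auto simp: real_places_def embeddings_def one_mem add_mem mult_mem)
  then show ?thesis using vr by (intro disjI2 bexI[of _ "restrict (Re \<circ> v) K"]) auto
qed (use v in \<open>auto simp: nonreal_embeddings_def\<close>)

lemma eigenvalue_dichotomy:
  fixes u :: complex
  assumes K: "number_field K" "degree_over_Q K \<le> d" and x: "x \<in> K" "algebraic_int x"
    and bd: "\<And>v. v \<in> embeddings K \<Longrightarrow> norm (v x :: complex) \<le> 9"
    and v0: "v0 \<in> embeddings K" "v0 x = (u + inverse u)\<^sup>2" and u: "u \<noteq> 0"
  shows "u \<in> small_eigenvalues d"
proof -
  have "\<exists>p\<in>bounded_int_polys (degree_over_Q K) 9. \<forall>v\<in>embeddings K. poly p (v x) = 0"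
    by (rule embedding_bounded_int_poly[OF K(1) x]) (use bd in auto)
  then obtain p where p: "p \<in> bounded_int_polys (degree_over_Q K) 9" "\<And>v. v \<in> embeddings K \<Longrightarrow> poly p (v x) = 0"
    by blast
  then show ?thesis using K(2) p(2)[OF v0(1)] v0(2) u by (auto simp: small_eigenvalues_def)
qed

lemma power_arithmetic_trace:
  fixes \<sigma> :: "complex \<Rightarrow> 'f::real_normed_field"
  assumes K: "number_field K" "a \<in> K - {0}" "b \<in> K - {0}" "\<sigma> \<in> embeddings K"
    and ar: "power_arithmetic K a b \<sigma> G" and G: "matrix_group G"
    and A: "A \<in> G" "trace A = u + inverse u" and u: "norm u > 1"
    and ne: "\<And>P. det P = 1 \<Longrightarrow> A = P ** mat22 u 0 0 (inverse u) ** adj2 P \<Longrightarrow> nonelementary_at G P"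
  shows "\<exists>x\<in>K. \<sigma> x = (u + inverse u)\<^sup>2 \<and> algebraic_int x \<and> (\<forall>v\<in>embeddings K. ramified_at a b v \<longrightarrow> \<bar>v x\<bar> \<le> 4)"
proof -
  interpret matrix_group G by fact
  obtain \<O> \<rho> m where ar: "is_order K a b \<O>" "matrix_embedding K a b \<sigma> \<rho>" "m > 0"
    "\<And>B. B \<in> G \<Longrightarrow> \<exists>y\<in>\<O>. mpow B m = \<rho> y \<or> mpow B m = - \<rho> y"
    using ar by (auto simp: power_arithmetic_def)
  interpret quaternion_rep K a b \<sigma> \<rho> using K ar(2) by unfold_locales auto
  have pow: "(u ^ n)\<^sup>2 \<noteq> 1" if "n > 0" for n
  proof
    assume "(u ^ n)\<^sup>2 = 1"
    then have "norm (u ^ (n * 2)) = 1" by (metis norm_one power_mult)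
    moreover have "norm u ^ (n * 2) > 1" using u that by (intro one_less_power) auto
    ultimately show False by (simp add: norm_power)
  qed
  have u2: "u \<noteq> 0" "u\<^sup>2 \<noteq> 1" using u pow[of 1] by auto
  obtain P where P: "det P = 1" "A = P ** mat22 u 0 0 (inverse u) ** adj2 P"
    using diagonalise[OF det_one[OF A(1)] A(2) u2] by blast
  show ?thesis
    using hyperbolic_trace_in_field[OF G ar(1,3,4) A(1) P(2,1) u2 pow[OF ar(3)] ne[OF P]] unfolding A(2) .
qed

lemma hyperbolic_eigenvalue_real:
  assumes M: "hyperbolic_orbifold (Orb2 \<Gamma>)" "weak_field_of_definition (Orb2 \<Gamma>) K" and d: "degree_over_Q K \<le> d"
    and A: "A \<in> \<Union>\<Gamma>" "trace A = u + inverse u" "norm u > 1"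
  shows "norm u > 2 \<or> complex_of_real u \<in> small_eigenvalues d"
proof (cases "norm u > 2")
  case False
  obtain a b \<sigma> where K: "number_field K" "totally_real K" "a \<in> K - {0}" "b \<in> K - {0}"
    "{v \<in> real_places K. \<not> ramified_at a b v} = {\<sigma>}" "power_arithmetic K a b \<sigma> (\<Union>\<Gamma>)" using M(2) by auto
  have \<sigma>: "\<sigma> \<in> embeddings K" using K(5) by (auto simp: real_places_def)
  have \<Gamma>: "subgroup \<Gamma> PSL2" "discrete (\<Union>\<Gamma>)" "finite_covolume H2 vol_H2 act2 \<Gamma>" using M(1) by auto
  have act: "act2 = (\<lambda>\<gamma>. moebius2 (SOME A. A \<in> \<gamma>))" by (rule ext) (simp add: act2_def)
  obtain x where x: "x \<in> K" "\<sigma> x = (u + inverse u)\<^sup>2" "algebraic_int x"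
    "\<And>v. v \<in> embeddings K \<Longrightarrow> ramified_at a b v \<Longrightarrow> \<bar>v x\<bar> \<le> 4"
    using power_arithmetic_trace[OF K(1,3,4) \<sigma> K(6) subgroup_PSL2_lifts(1)[OF \<Gamma>(1)] A]
      H2.finite_covolume_nonelementary[OF \<Gamma>(1,2) \<Gamma>(3)[unfolded act] A(1) _ _ A(3)] by blast
  interpret complex_subring K using K(1) by (rule number_field_subring)
  have "complex_of_real u \<in> small_eigenvalues d"
  proof (rule eigenvalue_dichotomy[OF K(1) d x(1,3)])
    show "restrict (complex_of_real \<circ> \<sigma>) K \<in> embeddings K"
      using \<sigma> by (auto simp: embeddings_def one_mem add_mem mult_mem)
    show "restrict (complex_of_real \<circ> \<sigma>) K x = (complex_of_real u + inverse (complex_of_real u))\<^sup>2"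
      using x(1,2) by (simp flip: of_real_inverse of_real_add of_real_power)
    show "complex_of_real u \<noteq> 0" using A(3) by auto
    fix v :: "complex \<Rightarrow> complex" assume v: "v \<in> embeddings K"
    have "\<exists>w\<in>real_places K. \<forall>x\<in>K. v x = of_real (w x)"
      using embedding_real_or_nonreal[OF K(1) v] K(2) by (simp add: totally_real_def)
    then obtain w where w: "w \<in> real_places K" "v x = of_real (w x)" using x(1) by blast
    \<comment> \<open>At the split place the size of \<open>u\<close> bounds the conjugate, at all
      others ramification does.\<close>
    have "w = \<sigma> \<or> ramified_at a b w" using K(5) w(1) by blast
    then have "\<bar>w x\<bar> \<le> 9"
    proof
      assume "w = \<sigma>"
      then show ?thesis using norm_trace_sq_le[OF A(3)] False x(2) by simp
    next
      assume "ramified_at a b w"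
      then show ?thesis using x(4) w(1) by (force simp: real_places_def)
    qed
    then show "norm (v x) \<le> 9" using w(2) by simp
  qed
  then show ?thesis ..
qed simp

lemma hyperbolic_eigenvalue_complex:
  assumes M: "hyperbolic_orbifold (Orb3 \<Gamma>)" "weak_field_of_definition (Orb3 \<Gamma>) K" and d: "degree_over_Q K \<le> d"
    and A: "A \<in> \<Union>\<Gamma>" "trace A = u + inverse u" "norm u > 1"
  shows "norm u > 2 \<or> u \<in> small_eigenvalues d"
proof (cases "norm u > 2")
  case False
  obtain a b \<tau> where K: "number_field K" "card (complex_places K) = 1" "a \<in> K - {0}" "b \<in> K - {0}"
    "\<forall>v\<in>real_places K. ramified_at a b v" "\<tau> \<in> nonreal_embeddings K" "power_arithmetic K a b \<tau> (\<Union>\<Gamma>)" using M(2) by auto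
  have \<tau>: "\<tau> \<in> embeddings K" using K(6) by (auto simp: nonreal_embeddings_def)
  have \<Gamma>: "subgroup \<Gamma> PSL2" "discrete (\<Union>\<Gamma>)" "finite_covolume H3 vol_H3 act3 \<Gamma>" using M(1) by auto
  have act: "act3 = (\<lambda>\<gamma>. moebius3 (SOME A. A \<in> \<gamma>))" by (rule ext) (simp add: act3_def)
  obtain x where x: "x \<in> K" "\<tau> x = (u + inverse u)\<^sup>2" "algebraic_int x"
    "\<And>v. v \<in> embeddings K \<Longrightarrow> ramified_at a b v \<Longrightarrow> \<bar>v x\<bar> \<le> 4"
    using power_arithmetic_trace[OF K(1,3,4) \<tau> K(7) subgroup_PSL2_lifts(1)[OF \<Gamma>(1)] A]
      H3.finite_covolume_nonelementary[OF \<Gamma>(1,2) \<Gamma>(3)[unfolded act] A(1) _ _ A(3)] by blast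
  have "u \<in> small_eigenvalues d"
  proof (rule eigenvalue_dichotomy[OF K(1) d x(1,3) _ \<tau> x(2)])
    show "u \<noteq> 0" using A(3) by auto
    fix v :: "complex \<Rightarrow> complex" assume v: "v \<in> embeddings K"
    from embedding_real_or_nonreal[OF K(1) v] show "norm (v x) \<le> 9"
    proof
      assume nr: "v \<in> nonreal_embeddings K"
      \<comment> \<open>A single complex place leaves \<open>\<tau>\<close> and its conjugate as the
        only nonreal embeddings, and both give the same absolute value.\<close>
      let ?c = "\<lambda>\<tau>. {\<tau>, restrict (cnj \<circ> \<tau>) K}"
      have "?c v \<in> complex_places K" "?c \<tau> \<in> complex_places K" using nr K(6) by (auto simp: complex_places_def)
      then have "?c v = ?c \<tau>" using K(2) by (metis card_1_singletonE singletonD)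
      then have "v = \<tau> \<or> v = restrict (cnj \<circ> \<tau>) K" by blast
      then have "norm (v x) = norm (\<tau> x)" using x(1) by auto
      then show ?thesis using norm_trace_sq_le[OF A(3)] False x(2) by simp
    next
      assume "\<exists>w\<in>real_places K. \<forall>x\<in>K. v x = of_real (w x)"
      then obtain w where w: "w \<in> real_places K" "v x = of_real (w x)" using x(1) by blast
      then have "\<bar>w x\<bar> \<le> 4" using K(5) x(4) by (auto simp: real_places_def)
      then show ?thesis using w(2) by simp
    qed
  qed
  then show ?thesis ..
qed simp

text \<open>In bounded degree the eigenvalue of largest norm either exceeds 2 in norm or belongs to
  a finite set. The least of finitely many numbers above 1 is still above 1, and twice its logarithm
  bounds every displacement from below.\<close>

lemma systole_bound:
  "\<exists>\<epsilon>>0. \<forall>M K. hyperbolic_orbifold M \<longrightarrow> weak_field_of_definition M K \<longrightarrow> degree_over_Q K \<le> d \<longrightarrow> ereal \<epsilon> \<le> Syst1 M"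
proof -
  \<comment> \<open>The element 2 accounts for the eigenvalues of norm above 2 and keeps
    \<open>S\<close> nonempty.\<close>
  define S where "S = insert 2 {r. \<exists>u\<in>small_eigenvalues d. r = cmod u \<and> 1 < r}"
  have "finite {r. \<exists>u\<in>small_eigenvalues d. r = cmod u \<and> 1 < r}"
    by (rule finite_subset[OF _ finite_imageI[OF finite_small_eigenvalues[of d], of cmod]]) auto
  then have S: "finite S" "S \<noteq> {}" unfolding S_def by auto
  define r where "r = Min S"
  have r: "r > 1" unfolding r_def using S by (subst Min_gr_iff) (auto simp: S_def)
  have rle: "r \<le> cmod u" if "cmod u > 2 \<or> u \<in> small_eigenvalues d" "1 < cmod u" for u
    using that
  proof (elim disjE)
    assume "2 < cmod u"
    moreover have "r \<le> 2" unfolding r_def using S by (intro Min_le) (auto simp: S_def)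
    ultimately show ?thesis by simp
  next
    assume "u \<in> small_eigenvalues d"
    then show ?thesis unfolding r_def using S that(2) by (intro Min_le) (auto simp: S_def)
  qed
  have "ereal (2 * ln r) \<le> Syst1 M" if M: "hyperbolic_orbifold M" "weak_field_of_definition M K" "degree_over_Q K \<le> d" for M K
  proof (cases M)
    case (Orb2 \<Gamma>)
    have \<Gamma>: "subgroup \<Gamma> PSL2" using M(1) Orb2 by simp
    have "2 * ln r \<le> displacement \<gamma>" if \<gamma>: "\<gamma> \<in> \<Gamma>" "hyperbolic_element \<gamma>" for \<gamma>
    proof -
      obtain A u where A: "A \<in> \<Union>\<Gamma>" "trace A = u + inverse u" "norm u > 1" "displacement \<gamma> = 2 * ln (norm u)"
        using hyperbolic_element_displacement[OF \<Gamma> \<gamma>] by blast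
      have "norm u > 2 \<or> complex_of_real u \<in> small_eigenvalues d"
        using hyperbolic_eigenvalue_real[OF _ _ M(3) A(1-3)] M(1,2) Orb2 by blast
      then have "r \<le> norm u" using rle[of "complex_of_real u"] A(3) by simp
      then have "ln r \<le> ln (norm u)" using r by (subst ln_le_cancel_iff) linarith+
      then show ?thesis using A(4) by simp
    qed
    then show ?thesis using Orb2 by (auto intro!: INF_greatest)
  next
    case (Orb3 \<Gamma>)
    have \<Gamma>: "subgroup \<Gamma> PSL2" using M(1) Orb3 by simp
    have "2 * ln r \<le> displacement \<gamma>" if \<gamma>: "\<gamma> \<in> \<Gamma>" "hyperbolic_element \<gamma>" for \<gamma>
    proof -
      obtain A u where A: "A \<in> \<Union>\<Gamma>" "trace A = u + inverse u" "norm u > 1" "displacement \<gamma> = 2 * ln (norm u)"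
        using hyperbolic_element_displacement[OF \<Gamma> \<gamma>] by blast
      have "norm u > 2 \<or> u \<in> small_eigenvalues d"
        using hyperbolic_eigenvalue_complex[OF _ _ M(3) A(1-3)] M(1,2) Orb3 by blast
      then have "r \<le> norm u" using rle[of u] A(3) by simp
      then have "ln r \<le> ln (norm u)" using r by (subst ln_le_cancel_iff) linarith+
      then show ?thesis using A(4) by simp
    qed
    then show ?thesis using Orb3 by (auto intro!: INF_greatest)
  qed
  then show ?thesis using r by (intro exI[of _ "2 * ln r"]) auto
qed

lemma degree_at_top:
  fixes M :: "nat \<Rightarrow> orbifold" and k :: "nat \<Rightarrow> complex set"
  assumes M: "\<And>i. hyperbolic_orbifold (M i)" and lim: "(\<lambda>i. Syst1 (M i)) \<longlonglongrightarrow> 0"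
    and k: "\<And>i. weak_field_of_definition (M i) (k i)"
  shows "filterlim (\<lambda>i. degree_over_Q (k i)) at_top sequentially"
  unfolding filterlim_at_top
proof
  fix d
  obtain \<epsilon> where \<epsilon>: "\<epsilon> > 0" "\<And>M K. hyperbolic_orbifold M \<Longrightarrow> weak_field_of_definition M K \<Longrightarrow> degree_over_Q K \<le> d \<Longrightarrow> ereal \<epsilon> \<le> Syst1 M"
    using systole_bound[of d] by blast
  have "\<forall>\<^sub>F i in sequentially. Syst1 (M i) < ereal \<epsilon>"
    using order_tendstoD(2)[OF lim, of "ereal \<epsilon>"] \<epsilon>(1) by simp
  then show "\<forall>\<^sub>F i in sequentially. d \<le> degree_over_Q (k i)"
  proof eventually_elim
    case (elim i)
    show ?case
    proof (rule ccontr)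
      assume "\<not> d \<le> degree_over_Q (k i)"
      then have "ereal \<epsilon> \<le> Syst1 (M i)" using \<epsilon>(2)[OF M k] by simp
      then show False using elim by simp
    qed
  qed
qed

text \<open>Non-commensurability is a statement about the tail: repeating the first term of a
  sequence preserves the hypotheses, so it takes the form that every commensurability class contains
  only finitely many terms.\<close>

theorem corollary2:
  fixes M :: "nat \<Rightarrow> orbifold"
  assumes "\<And>i. hyperbolic_orbifold (M i)"
    and "\<And>i. arithmetic (M i)"
    and "(\<lambda>i. Syst1 (M i)) \<longlonglongrightarrow> 0"
  shows "(\<forall>i. finite {j. commensurable (M i) (M j)}) \<and>
         (\<forall>k :: nat \<Rightarrow> complex set. (\<forall>i. field_of_definition (M i) (k i)) \<longrightarrow>
            filterlim (\<lambda>i. degree_over_Q (k i)) at_top sequentially)"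
proof (intro conjI allI impI)
  fix k :: "nat \<Rightarrow> complex set" assume "\<forall>i. field_of_definition (M i) (k i)"
  then show "filterlim (\<lambda>i. degree_over_Q (k i)) at_top sequentially"
    using degree_at_top[OF assms(1,3)] weak_field_of_definition[OF assms(1)] by blast
next
  fix i
  obtain K where K: "\<And>j. weak_field_of_definition (M j) (K j)"
    using assms(2) weak_field_of_definition[OF assms(1)] unfolding arithmetic_def by metis
  \<comment> \<open>The whole class of \<open>M i\<close> receives the same field. The degrees of
    this modified choice still diverge, so only finitely many indices can carry it.\<close>
  define k where "k j = (if commensurable (M i) (M j) then K i else K j)" for j
  have "weak_field_of_definition (M j) (k j)" for j
    using weak_field_commensurable[OF _ assms(1) assms(1) K] K by (simp add: k_def)
  then have "filterlim (\<lambda>j. degree_over_Q (k j)) at_top sequentially" using degree_at_top[OF assms(1,3)] by blast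
  then have "\<forall>\<^sub>F j in sequentially. Suc (degree_over_Q (K i)) \<le> degree_over_Q (k j)"
    unfolding filterlim_at_top by blast
  then obtain N where N: "\<And>j. j \<ge> N \<Longrightarrow> Suc (degree_over_Q (K i)) \<le> degree_over_Q (k j)"
    by (auto simp: eventually_sequentially)
  have "{j. commensurable (M i) (M j)} \<subseteq> {..<N}"
  proof
    fix j assume "j \<in> {j. commensurable (M i) (M j)}"
    then have "k j = K i" by (simp add: k_def)
    then show "j \<in> {..<N}" using N[of j] by (cases "j < N") auto
  qed
  then show "finite {j. commensurable (M i) (M j)}" by (rule finite_subset) simp
qed

end
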